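(* Let $s_1,s_2\in\overline{\mathbf R_\flat}$ be such that $s_1<\frac12$ and $s_2\le\frac12$. Then the mappings $$\widehat{\mathcal A}_{s_1}(\mathbf C^{2d})\ni a\mapsto\operatorname{Op}_{\mathfrak V}^{\mathrm{aw}}(a)\in\operatorname{Op}_{\mathfrak V}(\widehat{\mathcal A}_{s_1}(\mathbf C^{2d}))$$ and $$\widehat{\mathcal A}_{0,s_2}(\mathbf C^{2d})\ni a\mapsto\operatorname{Op}_{\mathfrak V}^{\mathrm{aw}}(a)\in\operatorname{Op}_{\mathfrak V}(\widehat{\mathcal A}_{0,s_2}(\mathbf C^{2d}))$$ are isomorphisms (linear bijections), where $\operatorname{Op}_{\mathfrak V}(X)=\{\operatorname{Op}_{\mathfrak V}(a):a\in X\}$.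
   Context: **Indices and weights.** $\mathbf N=\{0,1,2,\dots\}$. $\overline{\mathbf R_\flat}=[0,\infty)\cup\{\flat_\sigma:\sigma>0\}$, where the $\flat_\sigma$ are formal symbols, ordered so that $x_1<\flat_{\sigma_1}<\flat_{\sigma_2}<x_2$ whenever $x_1<\frac12\le x_2$ and $\sigma_1<\sigma_2$. For $r>0$ and a multi-index $\alpha$: $\vartheta_{r,s}(\alpha)=e^{r|\alpha|^{1/(2s)}}$ if $s\in(0,\infty)$; $\vartheta_{r,s}(\alpha)=r^{|\alpha|}(\alpha!)^{1/(2\sigma)}$ if $s=\flat_\sigma$; $\vartheta_{r,0}(\alpha)=1$ if $|\alpha|\le r$ and $=\infty$ if $|\alpha|>r$ (with $\infty\cdot0=0$). **Spaces.** $\ell_s(\mathbf N^{2d})$ (resp. $\ell_{0,s}(\mathbf N^{2d})$, $s>0$) is the set of $c:\mathbf N^{2d}\to\mathbf C$ such that $c\,\vartheta_{r,s}\in\ell^p(\mathbf N^{2d})$ for some (resp. every) $r>0$, with inductive (resp. projective) limit topology, $p\in(0,\infty]$ fixed (irrelevant); $\ell_{0,0}=\{0\}$. With $e_\alpha(z)=z^\alpha/\sqrt{\alpha!}$, $\widehat{\mathcal A}_s(\mathbf C^{2d})$ and $\widehat{\mathcal A}_{0,s}(\mathbf C^{2d})$ are the spaces of series $a(z,w)=\sum_{\alpha,\beta\in\mathbf N^d}c(a;\alpha,\beta)e_\alpha(z)e_\beta(\overline w)$, $z,w\in\mathbf C^d$, with coefficients in $\ell_s(\mathbf N^{2d})$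 and $\ell_{0,s}(\mathbf N^{2d})$, respectively. For the indices considered here these series define functions that are entire in $(z,\overline w)$. $\mathcal A_0(\mathbf C^d)$ is the space of polynomials on $\mathbf C^d$. **Operators.** With $(z,w)=\sum_jz_j\overline{w_j}$, $d\mu(w)=\pi^{-d}e^{-|w|^2}d\lambda(w)$ ($d\lambda$ Lebesgue measure on $\mathbf C^d$), the Wick and anti-Wick operators with symbol $a$ are the operators on $F\in\mathcal A_0(\mathbf C^d)$ $$\operatorname{Op}_{\mathfrak V}(a)F(z)=\int_{\mathbf C^d}a(z,w)F(w)e^{(z,w)}\,d\mu(w),\qquad \operatorname{Op}_{\mathfrak V}^{\mathrm{aw}}(a)F(z)=\int_{\mathbf C^d}a(w,w)F(w)e^{(z,w)}\,d\mu(w).$$ Equivalently, $\operatorname{Op}_{\mathfrak V}^{\mathrm{aw}}(a)=\operatorname{Op}_{\mathfrak V}(\mathcal T_1^*a)$, where $\mathcal T_1^*$ acts on coefficients by $c(\mathcal T_1^*a;\alpha,\beta)=\sum_{\gamma\in\mathbf N^d}\big(\binom{\alpha+\gamma}\gamma\binom{\beta+\gamma}\gamma\big)^{1/2}c(a;\alpha+\gamma,\beta+\gamma)$. *)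

theory Defs
  imports "HOL-Analysis.Analysis"
begin

text \<open>The index set \<open>[0,\<infinity>) \<union> {\<flat>\<^sub>\<sigma> : \<sigma> > 0}\<close>. The datatype also contains \<open>Reg x\<close> and \<open>Flat \<sigma>\<close> for
  the remaining reals; the actual index set is the carrier \<open>Rflat\<close>.\<close>

datatype flat_index = Reg real | Flat real

definition Rflat :: "flat_index set" where
  "Rflat = Reg ` {0..} \<union> Flat ` {0<..}"

instantiation flat_index :: linorder
begin

fun less_flat_index :: "flat_index \<Rightarrow> flat_index \<Rightarrow> bool" where
  "Reg x < Reg y \<longleftrightarrow> x < y"
| "Reg x < Flat \<sigma> \<longleftrightarrow> x < 1/2"
| "Flat \<sigma> < Reg x \<longleftrightarrow> 1/2 \<le> x"
| "Flat \<sigma> < Flat \<tau> \<longleftrightarrow> \<sigma> < \<tau>"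

definition less_eq_flat_index :: "flat_index \<Rightarrow> flat_index \<Rightarrow> bool" where
  "less_eq_flat_index s t \<longleftrightarrow> s < t \<or> s = t"

instance
proof
  fix s t u :: flat_index
  show "s < t \<longleftrightarrow> s \<le> t \<and> \<not> t \<le> s"
    by (cases s; cases t) (auto simp: less_eq_flat_index_def)
  show "s \<le> s"
    by (simp add: less_eq_flat_index_def)
  show "s \<le> t \<Longrightarrow> t \<le> u \<Longrightarrow> s \<le> u"
    by (cases s; cases t; cases u) (auto simp: less_eq_flat_index_def)
  show "s \<le> t \<Longrightarrow> t \<le> s \<Longrightarrow> s = t"
    by (cases s; cases t) (auto simp: less_eq_flat_index_def)
  show "s \<le> t \<or> t \<le> s"
    by (cases s; cases t) (auto simp: less_eq_flat_index_def)
qed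

end

text \<open>Multi-indices in \<open>\<nat>\<^sup>n\<close> are functions \<open>'n \<Rightarrow> nat\<close> on a finite type with \<open>n\<close> elements.\<close>

definition mi_abs :: "('n::finite \<Rightarrow> nat) \<Rightarrow> nat" where
  "mi_abs \<alpha> = (\<Sum>j\<in>UNIV. \<alpha> j)"

definition mi_fact :: "('n::finite \<Rightarrow> nat) \<Rightarrow> real" where
  "mi_fact \<alpha> = (\<Prod>j\<in>UNIV. fact (\<alpha> j))"

definition mi_power :: "complex ^ 'd \<Rightarrow> ('d::finite \<Rightarrow> nat) \<Rightarrow> complex" where
  "mi_power z \<alpha> = (\<Prod>j\<in>UNIV. (z $ j) ^ \<alpha> j)"

fun weight :: "real \<Rightarrow> flat_index \<Rightarrow> ('n::finite \<Rightarrow> nat) \<Rightarrow> ennreal" where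
  "weight r (Reg s) \<alpha> =
     (if s = 0 then (if real (mi_abs \<alpha>) \<le> r then 1 else \<infinity>)
      else ennreal (exp (r * real (mi_abs \<alpha>) powr (1 / (2 * s)))))"
| "weight r (Flat \<sigma>) \<alpha> = ennreal (r ^ mi_abs \<alpha> * mi_fact \<alpha> powr (1 / (2 * \<sigma>)))"

text \<open>Membership in \<open>\<ell>\<^sup>p\<close>, \<open>0 < p \<le> \<infinity>\<close>, for a family with values in \<open>[0,\<infinity>]\<close>.\<close>

definition in_lp :: "ennreal \<Rightarrow> ('i \<Rightarrow> ennreal) \<Rightarrow> bool" where
  "in_lp p x \<longleftrightarrow> (\<forall>i. x i < \<infinity>) \<and>
     (if p = \<infinity> then bdd_above (range (\<lambda>i. enn2real (x i)))
      else (\<lambda>i. enn2real (x i) powr enn2real p) summable_on UNIV)"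

text \<open>The product below is that of \<^typ>\<open>ennreal\<close>, where \<open>0 * \<infinity> = 0\<close>.\<close>

definition ell :: "ennreal \<Rightarrow> flat_index \<Rightarrow> (('n::finite \<Rightarrow> nat) \<Rightarrow> complex) set" where
  "ell p s = {c. \<exists>r>0. in_lp p (\<lambda>\<alpha>. ennreal (cmod (c \<alpha>)) * weight r s \<alpha>)}"

definition ell0 :: "ennreal \<Rightarrow> flat_index \<Rightarrow> (('n::finite \<Rightarrow> nat) \<Rightarrow> complex) set" where
  "ell0 p s =
     (if s = Reg 0 then {\<lambda>_. 0}
      else {c. \<forall>r>0. in_lp p (\<lambda>\<alpha>. ennreal (cmod (c \<alpha>)) * weight r s \<alpha>)})"

definition mono_e :: "('d::finite \<Rightarrow> nat) \<Rightarrow> complex ^ 'd \<Rightarrow> complex" where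
  "mono_e \<alpha> z = mi_power z \<alpha> / complex_of_real (sqrt (mi_fact \<alpha>))"

definition cnj_vec :: "complex ^ 'd \<Rightarrow> complex ^ 'd::finite" where
  "cnj_vec w = (\<chi> j. cnj (w $ j))"

text \<open>A pair \<open>(\<alpha>,\<beta>)\<close> of multi-indices in \<open>\<nat>\<^sup>d\<close> is the multi-index \<open>case_sum \<alpha> \<beta>\<close> in \<open>\<nat>\<^sup>2\<^sup>d\<close>. The series are
  identified with the functions they define, everywhere (unconditionally) convergent.\<close>

definition is_symbol_series ::
  "(('d::finite + 'd \<Rightarrow> nat) \<Rightarrow> complex) \<Rightarrow> (complex ^ 'd \<Rightarrow> complex ^ 'd \<Rightarrow> complex) \<Rightarrow> bool" where
  "is_symbol_series c a \<longleftrightarrow>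
     (\<forall>z w. ((\<lambda>(\<alpha>, \<beta>). c (case_sum \<alpha> \<beta>) * mono_e \<alpha> z * mono_e \<beta> (cnj_vec w)) has_sum a z w) UNIV)"

definition Ahat :: "ennreal \<Rightarrow> flat_index \<Rightarrow> (complex ^ 'd::finite \<Rightarrow> complex ^ 'd \<Rightarrow> complex) set" where
  "Ahat p s = {a. \<exists>c\<in>ell p s. is_symbol_series c a}"

definition Ahat0 :: "ennreal \<Rightarrow> flat_index \<Rightarrow> (complex ^ 'd::finite \<Rightarrow> complex ^ 'd \<Rightarrow> complex) set" where
  "Ahat0 p s = {a. \<exists>c\<in>ell0 p s. is_symbol_series c a}"

definition polys :: "(complex ^ 'd::finite \<Rightarrow> complex) set" where
  "polys = {F. \<exists>S k. finite S \<and> F = (\<lambda>z. \<Sum>\<alpha>\<in>S. k \<alpha> * mi_power z \<alpha>)}"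

definition herm :: "complex ^ 'd::finite \<Rightarrow> complex ^ 'd \<Rightarrow> complex" where
  "herm z w = (\<Sum>j\<in>UNIV. z $ j * cnj (w $ j))"

definition gauss :: "(complex ^ 'd::finite) measure" where
  "gauss = density lborel (\<lambda>w. ennreal (exp (- (norm w)\<^sup>2) / pi ^ CARD('d)))"

text \<open>Operators act on polynomials only. They are extended by zero to all functions, so that equality
  and the linear operations of operators are those of their restrictions to the polynomials.\<close>

definition Op_wick ::
  "(complex ^ 'd::finite \<Rightarrow> complex ^ 'd \<Rightarrow> complex) \<Rightarrow> (complex ^ 'd \<Rightarrow> complex) \<Rightarrow> complex ^ 'd \<Rightarrow> complex" where
  "Op_wick a = (\<lambda>F z. if F \<in> polys then \<integral>w. a z w * F w * exp (herm z w) \<partial>gauss else 0)"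

definition Op_antiwick ::
  "(complex ^ 'd::finite \<Rightarrow> complex ^ 'd \<Rightarrow> complex) \<Rightarrow> (complex ^ 'd \<Rightarrow> complex) \<Rightarrow> complex ^ 'd \<Rightarrow> complex" where
  "Op_antiwick a = (\<lambda>F z. if F \<in> polys then \<integral>w. a w w * F w * exp (herm z w) \<partial>gauss else 0)"

text \<open>Complex linear bijections between spaces of complex-valued functions of two arguments; both the
  symbols \<open>a z w\<close> and the operators \<open>T F z\<close> are of this kind.\<close>

definition csubspace2 :: "('x \<Rightarrow> 'y \<Rightarrow> complex) set \<Rightarrow> bool" where
  "csubspace2 V \<longleftrightarrow> (\<lambda>x y. 0) \<in> V \<and>
     (\<forall>a\<in>V. \<forall>b\<in>V. (\<lambda>x y. a x y + b x y) \<in> V) \<and>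
     (\<forall>k. \<forall>a\<in>V. (\<lambda>x y. k * a x y) \<in> V)"

definition linear_bijection ::
  "(('x \<Rightarrow> 'y \<Rightarrow> complex) \<Rightarrow> ('u \<Rightarrow> 'v \<Rightarrow> complex)) \<Rightarrow>
   ('x \<Rightarrow> 'y \<Rightarrow> complex) set \<Rightarrow> ('u \<Rightarrow> 'v \<Rightarrow> complex) set \<Rightarrow> bool" where
  "linear_bijection T V W \<longleftrightarrow> csubspace2 V \<and> csubspace2 W \<and>
     (\<forall>a\<in>V. \<forall>b\<in>V. T (\<lambda>x y. a x y + b x y) = (\<lambda>u v. T a u v + T b u v)) \<and>
     (\<forall>k. \<forall>a\<in>V. T (\<lambda>x y. k * a x y) = (\<lambda>u v. k * T a u v)) \<and>
     bij_betw T V W"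

end

theory Submission
  imports Defs "HOL-Probability.Distributions" "HOL-Library.Function_Algebras"
begin

text \<open>On the coefficients, \<open>\<T>\<^sub>1\<^sup>*\<close> is the exponential of the operator that shifts both multi-indices (after
  normalisation by factorials), so it embeds into a one-parameter group whose member at \<open>-1\<close> is the
  inverse. Each of the coefficient spaces is invariant under this group, because its weights are
  supermultiplicative and grow faster than any exponential (for the projective spaces: any exponential
  is dominated by some weight). Gaussian moments, obtained by integration by parts, turn the Wick symbol
  \<open>z\<^sup>\<alpha>w\<^sup>\<beta>\<close> (with \<open>w\<close> conjugated) into \<open>z\<^sup>\<alpha>\<partial>\<^sup>\<beta>\<close> and the anti-Wick symbol into \<open>\<partial>\<^sup>\<beta>z\<^sup>\<alpha>\<close>, and the Leibniz rule gives that the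
  anti-Wick operator of \<open>a\<close> is the Wick operator of \<open>\<T>\<^sub>1\<^sup>*a\<close>. The values of a Wick operator on monomials
  determine its symbol.\<close>

subsection \<open>Integration by parts on Euclidean spaces\<close>

text \<open>Interchanging the sums and integrals costs only factors exponential in the degree,
  because the square roots of binomials in T_1^* grow at most exponentially. So one hypothesis,
  decay of the coefficients faster than every exponential, carries the whole analysis, and the index
  s enters only at the end, through inequalities between weights. There the shift loses an
  exponential factor: control by one weight becomes control by a weaker one. A space defined by some
  r tolerates this by decreasing r, a space defined by every r by starting from a larger r. This is
  also where the two ranges differ: at s = 1/2 the weight is exp(r|\<alpha>|), and a single r no
  longer dominates all exponentials. Index 0 is separate, since its weight takes the value infinity.
  The Gaussian estimates follow a fixed budget. Half of the exponent |w|^2 of the density is kept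
  for integrability, a quarter is granted to monomials and exp((z,w)), and a quarter to the symbol,
  1/8 for each of its two arguments.\<close>

lemma has_bochner_integral_exp_neg_square_real:
  fixes c :: real
  assumes "c > 0"
  shows "has_bochner_integral lborel (\<lambda>x::real. exp (- c * x\<^sup>2)) (sqrt (pi / c))"
proof -
  define s where "s = sqrt (1 / (2 * c))"
  have s: "s > 0" "2 * s\<^sup>2 = 1 / c"
    using assms by (auto simp: s_def)
  have "has_bochner_integral lborel (\<lambda>x. sqrt (2 * pi * s\<^sup>2) * normal_density 0 s x) (sqrt (2 * pi * s\<^sup>2) * 1)"
    using integrable_normal_density[OF s(1)] integral_normal_density[OF s(1)]
    by (intro has_bochner_integral_mult_right) (simp add: has_bochner_integral_iff)
  also have "(\<lambda>x. sqrt (2 * pi * s\<^sup>2) * normal_density 0 s x) = (\<lambda>x. exp (- c * x\<^sup>2))"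
    using s assms by (auto simp: normal_density_def fun_eq_iff)
  also have "2 * pi * s\<^sup>2 = pi / c"
    using s by (simp add: field_simps)
  finally show ?thesis
    by simp
qed

lemma has_bochner_integral_exp_neg_norm_square:
  fixes c :: real
  assumes "c > 0"
  shows "has_bochner_integral lborel (\<lambda>w::'a::euclidean_space. exp (- c * (norm w)\<^sup>2))
           (sqrt (pi / c) ^ DIM('a))"
proof (rule has_bochner_integral_nn_integral)
  have *: "exp (- c * (norm w)\<^sup>2) = (\<Prod>b\<in>Basis. exp (- c * (w \<bullet> b)\<^sup>2))" for w :: 'a
    by (subst power2_norm_eq_inner, subst euclidean_inner)
      (simp add: exp_sum[symmetric] sum_negf sum_distrib_left power2_eq_square)
  have 1: "(\<integral>\<^sup>+x. ennreal (exp (- c * x\<^sup>2)) \<partial>lborel) = ennreal (sqrt (pi / c))"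
    using has_bochner_integral_exp_neg_square_real[OF assms]
    by (subst nn_integral_eq_integral) (auto simp: has_bochner_integral_iff)
  have "(\<integral>\<^sup>+w. ennreal (exp (- c * (norm w)\<^sup>2)) \<partial>(lborel :: 'a measure)) =
        (\<integral>\<^sup>+w. (\<Prod>b\<in>Basis. ennreal (exp (- c * (w \<bullet> b)\<^sup>2))) \<partial>(lborel :: 'a measure))"
    by (subst *) (simp add: prod_ennreal)
  also have "\<dots> = (\<Prod>b\<in>(Basis::'a set). (\<integral>\<^sup>+x. ennreal (exp (- c * x\<^sup>2)) \<partial>lborel))"
    by (subst nn_integral_lborel_prod) auto
  also have "\<dots> = ennreal (sqrt (pi / c) ^ DIM('a))"
    using assms by (simp only: 1) (simp add: ennreal_power)
  finally show "(\<integral>\<^sup>+w. ennreal (exp (- c * (norm w)\<^sup>2)) \<partial>(lborel :: 'a measure)) =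
    ennreal (sqrt (pi / c) ^ DIM('a))" .
qed (use assms in auto)

text \<open>The uniform L1 bound \<open>B\<close> makes the derivative integrable on the product of
  the interval with the space, so Fubini applies. It serves both for translations of the variable
  and for the dilation \<open>t *\<^sub>R z\<close> of the parameter of the Gaussian kernel.\<close>

lemma integral_fundamental_theorem_parametric:
  fixes g g' :: "real \<Rightarrow> 'a::euclidean_space \<Rightarrow> complex" and B :: real
  assumes deriv: "\<And>t w. t \<in> {0..1} \<Longrightarrow> ((\<lambda>t. g t w) has_vector_derivative g' t w) (at t within {0..1})"
    and cont: "continuous_on UNIV (\<lambda>(t, w). g' t w)"
    and int0: "integrable lborel (g 0)" and int1: "integrable lborel (g 1)"
    and int': "\<And>t. t \<in> {0..1} \<Longrightarrow> integrable lborel (g' t)"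
    and bound: "\<And>t. t \<in> {0..1} \<Longrightarrow> (\<integral>w. norm (g' t w) \<partial>lborel) \<le> B"
  shows "(\<integral>w. g 1 w \<partial>lborel) - (\<integral>w. g 0 w \<partial>lborel) =
         (\<integral>t. indicator {0..1} t *\<^sub>R (\<integral>w. g' t w \<partial>lborel) \<partial>lborel)"
proof -
  define f where "f = (\<lambda>t w. indicator {0..1::real} t *\<^sub>R g' t w)"
  have [measurable]: "(\<lambda>(t, w). g' t w) \<in> borel_measurable (lborel \<Otimes>\<^sub>M lborel)"
    using borel_measurable_continuous_onI[OF cont]
    by (simp add: lborel_prod borel_prod)
  have fm [measurable]: "case_prod f \<in> borel_measurable (lborel \<Otimes>\<^sub>M lborel)"
    unfolding f_def by measurable
  have nf: "(\<integral>w. norm (f t w) \<partial>lborel) = indicator {0..1} t * (\<integral>w. norm (g' t w) \<partial>lborel)" for t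
    by (auto simp: f_def indicator_def)
  have intf: "integrable (lborel \<Otimes>\<^sub>M lborel) (case_prod f)"
  proof (rule lborel_pair.Fubini_integrable[OF fm])
    have m: "(\<lambda>t. \<integral>w. norm (case_prod f (t, w)) \<partial>lborel) \<in> borel_measurable lborel"
      by measurable
    show "integrable lborel (\<lambda>t. \<integral>w. norm (case_prod f (t, w)) \<partial>lborel)"
    proof (rule Bochner_Integration.integrable_bound[where f = "\<lambda>t. indicator {0..1::real} t *\<^sub>R B"])
      show "integrable lborel (\<lambda>t. indicator {0..1::real} t *\<^sub>R B)"
        using borel_integrable_atLeastAtMost'[of 0 1 "\<lambda>_. B"] by (simp add: set_integrable_def)
      show "AE t in lborel. norm (\<integral>w. norm (case_prod f (t, w)) \<partial>lborel) \<le> norm (indicator {0..1} t *\<^sub>R B)"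
      proof (rule AE_I2)
        fix t :: real
        show "norm (\<integral>w. norm (case_prod f (t, w)) \<partial>lborel) \<le> norm (indicator {0..1} t *\<^sub>R B)"
          using bound[of t] by (auto simp: nf indicator_def intro: order.trans[OF _ abs_ge_self])
      qed
    qed (fact m)
    show "AE t in lborel. integrable lborel (\<lambda>w. case_prod f (t, w))"
      using int' by (intro AE_I2) (auto simp: f_def indicator_def)
  qed
  have inner: "(\<integral>t. f t w \<partial>lborel) = g 1 w - g 0 w" for w
    unfolding f_def
  proof (rule integral_FTC_atLeastAtMost)
    show "continuous_on {0..1} (\<lambda>t. g' t w)"
      by (rule continuous_on_compose2[OF cont, where f = "\<lambda>t. (t, w)", simplified])
        (auto intro!: continuous_intros)
  qed (use deriv in auto)
  have "(\<integral>w. g 1 w \<partial>lborel) - (\<integral>w. g 0 w \<partial>lborel) = (\<integral>w. (\<integral>t. f t w \<partial>lborel) \<partial>lborel)"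
    by (simp add: inner int0 int1)
  also have "\<dots> = (\<integral>t. (\<integral>w. f t w \<partial>lborel) \<partial>lborel)"
    by (rule lborel_pair.Fubini_integral) (use intf in \<open>simp add: case_prod_beta'\<close>)
  also have "\<dots> = (\<integral>t. indicator {0..1} t *\<^sub>R (\<integral>w. g' t w \<partial>lborel) \<partial>lborel)"
    by (simp add: f_def)
  finally show ?thesis .
qed

lemma integrable_translate_lborel:
  fixes h :: "'a::euclidean_space \<Rightarrow> complex"
  assumes "integrable lborel h"
  shows "integrable lborel (\<lambda>w. h (w + v))" "(\<integral>w. h (w + v) \<partial>lborel) = (\<integral>w. h w \<partial>lborel)"
proof -
  have [measurable]: "h \<in> borel_measurable borel"
    using assms by simp
  have "integrable (distr lborel borel ((+) v)) h"
    using assms by (simp add: lborel_distr_plus)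
  then show "integrable lborel (\<lambda>w. h (w + v))"
    by (simp add: integrable_distr_eq add.commute)
  have "(\<integral>w. h w \<partial>lborel) = (\<integral>w. h w \<partial>distr lborel borel ((+) v))"
    by (simp add: lborel_distr_plus)
  then show "(\<integral>w. h (w + v) \<partial>lborel) = (\<integral>w. h w \<partial>lborel)"
    by (simp add: integral_distr add.commute)
qed

text \<open>Integrate \<open>h(w + v) - h(w)\<close>, written as the integral of \<open>h'(w + tv)\<close> over \<open>0 \<le> t \<le> 1\<close>, and use translation
  invariance.\<close>

lemma integral_directional_derivative_eq_0:
  fixes h h' :: "'a::euclidean_space \<Rightarrow> complex"
  assumes deriv: "\<And>w t. ((\<lambda>t. h (w + t *\<^sub>R v)) has_vector_derivative h' (w + t *\<^sub>R v)) (at t)"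
    and cont: "continuous_on UNIV h'"
    and int: "integrable lborel h" and int': "integrable lborel h'"
  shows "(\<integral>w. h' w \<partial>lborel) = 0"
proof -
  have "(\<integral>w. h (w + 1 *\<^sub>R v) \<partial>lborel) - (\<integral>w. h (w + 0 *\<^sub>R v) \<partial>lborel) =
        (\<integral>t. indicator {0..1} t *\<^sub>R (\<integral>w. h' (w + t *\<^sub>R v) \<partial>lborel) \<partial>lborel)"
  proof (rule integral_fundamental_theorem_parametric[where B = "\<integral>w. norm (h' w) \<partial>lborel"])
    show "continuous_on UNIV (\<lambda>(t::real, w). h' (w + t *\<^sub>R v))"
      unfolding case_prod_beta
      by (rule continuous_on_compose2[OF cont]) (auto intro!: continuous_intros)
    fix t :: real
    \<comment> \<open>\<open>integrable_translate_lborel\<close> concerns complex functions, so the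
      norm is embedded into the complex numbers.\<close>
    have "integrable lborel (\<lambda>w. complex_of_real (norm (h' w)))"
      using int' by (simp add: integrable_norm)
    then have "(\<integral>w. complex_of_real (norm (h' (w + t *\<^sub>R v))) \<partial>lborel) =
               (\<integral>w. complex_of_real (norm (h' w)) \<partial>lborel)"
      by (rule integrable_translate_lborel)
    then show "(\<integral>w. norm (h' (w + t *\<^sub>R v)) \<partial>lborel) \<le> (\<integral>w. norm (h' w) \<partial>lborel)"
      by simp
  qed (use deriv int int' in \<open>auto intro: integrable_translate_lborel has_vector_derivative_at_within\<close>)
  then have "0 = (\<integral>t. indicator {0..1::real} t *\<^sub>R (\<integral>w. h' w \<partial>lborel) \<partial>lborel)"
    by (simp add: integrable_translate_lborel(2)[OF int] integrable_translate_lborel(2)[OF int'])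
  then show ?thesis
    by simp
qed

text \<open>Dominated convergence speaks of sequences, \<open>has_sum\<close> of unconditional sums.
  An enumeration of the index set identifies the value, and absolute summability comes separately
  from the finite sums of norms, all bounded by the integral of \<open>G\<close>.\<close>

lemma has_sum_integral_dominated:
  fixes f :: "'i::countable \<Rightarrow> 'a \<Rightarrow> complex" and G :: "'a \<Rightarrow> real"
  assumes inf: "infinite (UNIV :: 'i set)"
    and meas: "\<And>i. f i \<in> borel_measurable M"
    and G: "integrable M G"
    and dom: "\<And>w S. finite S \<Longrightarrow> (\<Sum>i\<in>S. norm (f i w)) \<le> G w"
    and sum: "\<And>w. ((\<lambda>i. f i w) has_sum g w) UNIV"
  shows "integrable M g" "((\<lambda>i. \<integral>w. f i w \<partial>M) has_sum (\<integral>w. g w \<partial>M)) UNIV"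
proof -
  define e :: "nat \<Rightarrow> 'i" where "e = from_nat_into UNIV"
  have e: "bij_betw e UNIV UNIV"
    unfolding e_def using inf by (intro bij_betw_from_nat_into) auto
  have fi: "integrable M (f i)" for i
    using dom[of "{i}"] by (intro Bochner_Integration.integrable_bound[OF G meas]) 
      (auto intro: order.trans[OF _ abs_ge_self])
  have lim: "(\<lambda>n. \<Sum>k<n. f (e k) w) \<longlonglongrightarrow> g w" for w
  proof -
    have "((\<lambda>k. f (e k) w) has_sum g w) UNIV"
      using has_sum_reindex_bij_betw[OF e, of "\<lambda>i. f i w"] sum by simp
    then show ?thesis
      using has_sum_imp_sums sums_def by blast
  qed
  have bnd: "norm (\<Sum>k<n. f (e k) w) \<le> G w" for n w
  proof -
    have "norm (\<Sum>k<n. f (e k) w) \<le> (\<Sum>k<n. norm (f (e k) w))"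
      by (rule norm_sum)
    also have "\<dots> = (\<Sum>i\<in>e ` {..<n}. norm (f i w))"
      using e by (subst sum.reindex) (auto simp: bij_betw_def intro: inj_on_subset)
    also have "\<dots> \<le> G w"
      by (rule dom) auto
    finally show ?thesis .
  qed
  have [measurable]: "g \<in> borel_measurable M"
    by (rule borel_measurable_LIMSEQ_metric[OF _ lim]) (use meas in measurable)
  have m: "(\<lambda>w. \<Sum>k<n. f (e k) w) \<in> borel_measurable M" for n
    using meas by measurable
  show "integrable M g"
    by (rule integrable_dominated_convergence[where w = G and s = "\<lambda>n w. \<Sum>k<n. f (e k) w"])
      (use G lim bnd m in auto)
  have "(\<lambda>n. \<integral>w. (\<Sum>k<n. f (e k) w) \<partial>M) \<longlonglongrightarrow> (\<integral>w. g w \<partial>M)"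
    by (rule integral_dominated_convergence[where w = G]) (use G lim bnd m in auto)
  then have l1: "(\<lambda>n. \<Sum>k<n. (\<integral>w. f (e k) w \<partial>M)) \<longlonglongrightarrow> (\<integral>w. g w \<partial>M)"
    by (simp add: fi)
  have "(\<lambda>i. norm (\<integral>w. f i w \<partial>M)) summable_on UNIV"
  proof (rule nonneg_bdd_above_summable_on)
    show "bdd_above (sum (\<lambda>i. norm (\<integral>w. f i w \<partial>M)) ` {F. F \<subseteq> UNIV \<and> finite F})"
    proof (rule bdd_aboveI2)
      fix S :: "'i set" assume "S \<in> {F. F \<subseteq> UNIV \<and> finite F}"
      then have S: "finite S" by simp
      have "(\<Sum>i\<in>S. norm (\<integral>w. f i w \<partial>M)) \<le> (\<Sum>i\<in>S. \<integral>w. norm (f i w) \<partial>M)"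
        by (intro sum_mono integral_norm_bound)
      also have "\<dots> = (\<integral>w. (\<Sum>i\<in>S. norm (f i w)) \<partial>M)"
        using fi by (subst Bochner_Integration.integral_sum) (auto intro: integrable_norm)
      also have "\<dots> \<le> (\<integral>w. G w \<partial>M)"
        using fi G dom[OF S] by (intro integral_mono) (auto intro!: Bochner_Integration.integrable_sum integrable_norm)
      finally show "(\<Sum>i\<in>S. norm (\<integral>w. f i w \<partial>M)) \<le> (\<integral>w. G w \<partial>M)" .
    qed
  qed auto
  then have "(\<lambda>i. \<integral>w. f i w \<partial>M) summable_on UNIV"
    by (rule abs_summable_summable)
  then obtain l where l: "((\<lambda>i. \<integral>w. f i w \<partial>M) has_sum l) UNIV"
    by (auto simp: summable_on_def)
  then have "((\<lambda>k. \<integral>w. f (e k) w \<partial>M) has_sum l) UNIV"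
    using has_sum_reindex_bij_betw[OF e, of "\<lambda>i. \<integral>w. f i w \<partial>M"] by simp
  then have "(\<lambda>n. \<Sum>k<n. (\<integral>w. f (e k) w \<partial>M)) \<longlonglongrightarrow> l"
    using has_sum_imp_sums sums_def by blast
  with l1 have "l = (\<integral>w. g w \<partial>M)"
    using LIMSEQ_unique by blast
  with l show "((\<lambda>i. \<integral>w. f i w \<partial>M) has_sum (\<integral>w. g w \<partial>M)) UNIV"
    by simp
qed

section \<open>Growth of monomials and of exp((z,w))\<close>

lemma mi_power_fun_upd:
  "mi_power w (m(j := n)) = (w $ j) ^ n * (\<Prod>k\<in>UNIV - {j}. (w $ k) ^ m k)"
  unfolding mi_power_def by (subst prod.remove[of _ j]) (auto intro!: prod.cong)

lemma norm_mi_power_le: "norm (mi_power w m) \<le> norm w ^ mi_abs m"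
proof -
  have "norm (mi_power w m) = (\<Prod>j\<in>UNIV. norm (w $ j) ^ m j)"
    by (simp add: mi_power_def prod_norm[symmetric] norm_power)
  also have "\<dots> \<le> (\<Prod>j\<in>UNIV. norm w ^ m j)"
    by (intro prod_mono conjI power_mono Finite_Cartesian_Product.norm_nth_le) auto
  also have "\<dots> = norm w ^ mi_abs m"
    by (simp add: mi_abs_def power_sum)
  finally show ?thesis .
qed

lemma norm_cnj_vec [simp]: "norm (cnj_vec w) = norm w"
  by (simp add: cnj_vec_def norm_vec_def)

lemma cnj_vec_nth [simp]: "cnj_vec w $ j = cnj (w $ j)"
  by (simp add: cnj_vec_def)

lemma norm_herm_le: "norm (herm z w) \<le> (\<Sum>j\<in>UNIV. norm (z $ j)) * norm w"
proof -
  have "norm (herm z w) \<le> (\<Sum>j\<in>UNIV. norm (z $ j) * norm (w $ j))"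
    unfolding herm_def by (rule order.trans[OF norm_sum]) (simp add: norm_mult)
  also have "\<dots> \<le> (\<Sum>j\<in>UNIV. norm (z $ j) * norm w)"
    by (intro sum_mono mult_left_mono Finite_Cartesian_Product.norm_nth_le) auto
  finally show ?thesis
    by (simp add: sum_distrib_right)
qed

lemma herm_self: "herm w w = of_real ((norm w)\<^sup>2)"
proof -
  have "(norm w)\<^sup>2 = (\<Sum>j\<in>UNIV. (norm (w $ j))\<^sup>2)"
    by (simp add: norm_vec_def L2_set_def sum_nonneg)
  then show ?thesis
    by (simp add: herm_def complex_norm_square del: of_real_power)
qed

lemma continuous_on_mi_power [continuous_intros]:
  assumes "continuous_on S f"
  shows "continuous_on S (\<lambda>x. mi_power (f x) m)"
  unfolding mi_power_def by (intro continuous_intros assms)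

lemma continuous_on_cnj_vec [continuous_intros]:
  assumes "continuous_on S f"
  shows "continuous_on S (\<lambda>x. cnj_vec (f x))"
  unfolding cnj_vec_def by (intro continuous_intros assms)

lemma continuous_on_herm [continuous_intros]:
  assumes "continuous_on S f" "continuous_on S g"
  shows "continuous_on S (\<lambda>x. herm (f x) (g x))"
  unfolding herm_def by (intro continuous_intros assms)

lemma power_le_fact_mult_exp:
  fixes x :: real
  assumes "x \<ge> 0"
  shows "x ^ n \<le> fact n * exp x"
proof -
  have "(\<Sum>k\<in>{n}. x ^ k /\<^sub>R fact k) \<le> exp x"
    unfolding exp_def using summable_exp_generic[of x] assms by (intro sum_le_suminf) auto
  then show ?thesis
    by (simp add: field_simps)
qed

text \<open>The power is absorbed into \<open>exp x\<close>, and the resulting linear exponent is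
  completed to a square: \<open>((1 + B) - x / 2)\<^sup>2 \<ge> 0\<close>.\<close>

lemma power_mult_exp_le_gauss:
  fixes x B :: real
  assumes "x \<ge> 0"
  shows "x ^ n * exp (B * x) \<le> fact n * exp ((1 + B)\<^sup>2) * exp (x\<^sup>2 / 4)"
proof -
  have "x ^ n * exp (B * x) \<le> fact n * exp x * exp (B * x)"
    by (intro mult_right_mono power_le_fact_mult_exp assms) auto
  also have "\<dots> = fact n * exp ((1 + B) * x)"
    by (simp add: exp_add[symmetric] algebra_simps)
  also have "(1 + B) * x \<le> (1 + B)\<^sup>2 + x\<^sup>2 / 4"
    using zero_le_power2[of "(1 + B) - x / 2"] by (simp add: power2_eq_square algebra_simps)
  then have "fact n * exp ((1 + B) * x) \<le> fact n * exp ((1 + B)\<^sup>2 + x\<^sup>2 / 4)"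
    by simp
  finally show ?thesis
    by (simp add: exp_add mult.assoc)
qed

lemma mi_power_herm_bound:
  obtains C where "C \<ge> 0"
    "\<And>w. norm (mi_power w m) * norm (mi_power (cnj_vec w) b) * exp (norm (herm z w)) \<le> C * exp ((norm w)\<^sup>2 / 4)"
proof
  let ?B = "\<Sum>j\<in>UNIV. norm (z $ j)"
  show "0 \<le> fact (mi_abs m + mi_abs b) * exp ((1 + ?B)\<^sup>2)"
    by simp
  fix w
  have "norm (mi_power w m) * norm (mi_power (cnj_vec w) b) * exp (norm (herm z w)) \<le>
        norm w ^ mi_abs m * norm w ^ mi_abs b * exp (?B * norm w)"
    using norm_mi_power_le[of "cnj_vec w" b]
    by (intro mult_mono norm_mi_power_le) (auto simp: norm_herm_le)
  also have "\<dots> = norm w ^ (mi_abs m + mi_abs b) * exp (?B * norm w)"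
    by (simp add: power_add)
  also have "\<dots> \<le> fact (mi_abs m + mi_abs b) * exp ((1 + ?B)\<^sup>2) * exp ((norm w)\<^sup>2 / 4)"
    by (rule power_mult_exp_le_gauss) simp
  finally show "norm (mi_power w m) * norm (mi_power (cnj_vec w) b) * exp (norm (herm z w)) \<le>
    fact (mi_abs m + mi_abs b) * exp ((1 + ?B)\<^sup>2) * exp ((norm w)\<^sup>2 / 4)" .
qed

subsection \<open>Gaussian integrals\<close>

lemma sets_gauss [measurable_cong, simp]: "sets gauss = sets borel"
  by (simp add: gauss_def)

text \<open>Written with \<open>herm\<close>, the weight is the exponential of a polynomial in
  \<open>w\<close> and its conjugate, the form in which it is differentiated.\<close>

lemma gauss_density_eq:
  "(exp (- (norm w)\<^sup>2) / pi ^ CARD('d)) *\<^sub>R u = exp (- herm w w) * u / of_real (pi ^ CARD('d))"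
  for w :: "complex ^ 'd::finite" and u :: complex
  by (simp add: herm_self scaleR_conv_of_real exp_of_real[symmetric])

lemma integral_gauss:
  fixes f :: "complex ^ 'd::finite \<Rightarrow> complex"
  assumes "f \<in> borel_measurable borel"
  shows "(\<integral>w. f w \<partial>gauss) = (\<integral>w. exp (- herm w w) * f w \<partial>lborel) / of_real (pi ^ CARD('d))"
  unfolding gauss_def
  using assms by (subst integral_density) (auto simp only: gauss_density_eq, auto)

text \<open>Growth exp(|w|^2/2) against the density exp(-|w|^2) leaves the integrable
  exp(-|w|^2/2).\<close>

lemma integrable_gauss_real:
  fixes f :: "complex ^ 'd::finite \<Rightarrow> real"
  assumes "f \<in> borel_measurable borel" and bound: "\<And>w. norm (f w) \<le> C * exp ((norm w)\<^sup>2 / 2)"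
  shows "integrable gauss f"
  unfolding gauss_def
proof (subst integrable_density)
  have i: "integrable lborel (\<lambda>w :: complex ^ 'd. (C / pi ^ CARD('d)) * exp (- (1/2) * (norm w)\<^sup>2))"
    using has_bochner_integral_exp_neg_norm_square[of "1/2", where 'a = "complex ^ 'd"]
    by (intro integrable_mult_right) (simp add: has_bochner_integral_iff)
  have "norm ((exp (- (norm w)\<^sup>2) / pi ^ CARD('d)) *\<^sub>R f w) \<le>
      norm ((C / pi ^ CARD('d)) * exp (- (1/2) * (norm w)\<^sup>2))" for w :: "complex ^ 'd"
  proof -
    have "exp (- (norm w)\<^sup>2) * norm (f w) \<le> exp (- (norm w)\<^sup>2) * (C * exp ((norm w)\<^sup>2 / 2))"
      by (intro mult_left_mono bound) auto
    also have "\<dots> = C * exp (- (1/2) * (norm w)\<^sup>2)"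
      by (simp add: exp_add[symmetric])
    finally have "exp (- (norm w)\<^sup>2) * norm (f w) / pi ^ CARD('d) \<le> C * exp (- (1/2) * (norm w)\<^sup>2) / pi ^ CARD('d)"
      by (intro divide_right_mono) auto
    also have "\<dots> \<le> norm ((C / pi ^ CARD('d)) * exp (- (1/2) * (norm w)\<^sup>2))"
      unfolding real_norm_def by (rule order.trans[OF _ abs_ge_self]) simp
    finally show ?thesis
      by (simp add: abs_mult)
  qed
  then show "integrable lborel (\<lambda>w. (exp (- (norm w)\<^sup>2) / pi ^ CARD('d)) *\<^sub>R f w)"
    using assms(1) by (intro Bochner_Integration.integrable_bound[OF i]) (auto simp: borel_measurable_times)
qed (use assms in auto)

lemma integrable_gauss:
  fixes f :: "complex ^ 'd::finite \<Rightarrow> complex"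
  assumes "f \<in> borel_measurable borel" and "\<And>w. norm (f w) \<le> C * exp ((norm w)\<^sup>2 / 2)"
  shows "integrable gauss f"
proof -
  have "integrable gauss (\<lambda>w. norm (f w))"
    using assms by (intro integrable_gauss_real) auto
  then show ?thesis
    using assms(1) by (simp add: integrable_norm_iff)
qed

lemma integrable_lborel_exp_herm:
  fixes f :: "complex ^ 'd::finite \<Rightarrow> complex"
  assumes [measurable]: "f \<in> borel_measurable borel" and "\<And>w. norm (f w) \<le> C * exp ((norm w)\<^sup>2 / 2)"
  shows "integrable lborel (\<lambda>w. exp (- herm w w) * f w)"
proof -
  have "integrable gauss f"
    by (rule integrable_gauss) (use assms in auto)
  then have "integrable lborel (\<lambda>w. (exp (- (norm w)\<^sup>2) / pi ^ CARD('d)) *\<^sub>R f w)"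
    unfolding gauss_def by (subst (asm) integrable_density) auto
  then have "integrable lborel (\<lambda>w. of_real (pi ^ CARD('d)) * (exp (- herm w w) * f w / of_real (pi ^ CARD('d))))"
    unfolding gauss_density_eq by (rule integrable_mult_right)
  then show ?thesis
    by simp
qed

text \<open>The Gaussian weight is part of the integrand, so that the reference measure is Lebesgue
  measure and its translation invariance can be used. The factor pi^-d is restored in
  \<open>integral_gauss_monomial\<close>.\<close>

definition gauss_kernel ::
  "('d::finite \<Rightarrow> nat) \<Rightarrow> ('d \<Rightarrow> nat) \<Rightarrow> complex ^ 'd \<Rightarrow> complex ^ 'd \<Rightarrow> complex" where
  "gauss_kernel m b z w = exp (- herm w w) * (mi_power w m * mi_power (cnj_vec w) b * exp (herm z w))"

lemma continuous_on_gauss_kernel [continuous_intros]: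
  assumes "continuous_on S f" "continuous_on S g"
  shows "continuous_on S (\<lambda>x. gauss_kernel m b (f x) (g x))"
  unfolding gauss_kernel_def by (intro continuous_intros assms)

lemma integrable_gauss_kernel: "integrable lborel (gauss_kernel m b z)"
proof -
  obtain C where C: "C \<ge> 0" "\<And>w. norm (mi_power w m) * norm (mi_power (cnj_vec w) b) *
      exp (norm (herm z w)) \<le> C * exp ((norm w)\<^sup>2 / 4)"
    using mi_power_herm_bound[of m b z] by blast
  have "norm (mi_power w m * mi_power (cnj_vec w) b * exp (herm z w)) \<le> C * exp ((norm w)\<^sup>2 / 2)" for w
  proof -
    have "norm (mi_power w m * mi_power (cnj_vec w) b * exp (herm z w)) \<le>
       norm (mi_power w m) * norm (mi_power (cnj_vec w) b) * exp (norm (herm z w))"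
      by (simp add: norm_mult mult_left_mono complex_Re_le_cmod)
    also note C(2)
    also have "C * exp ((norm w)\<^sup>2 / 4) \<le> C * exp ((norm w)\<^sup>2 / 2)"
      using C(1) by (intro mult_left_mono) auto
    finally show ?thesis .
  qed
  then show ?thesis
    unfolding gauss_kernel_def
    by (intro integrable_lborel_exp_herm borel_measurable_continuous_onI) (auto intro!: continuous_intros)
qed

text \<open>The exponent -|w|^2 + (z,w) is a sum over k of (z_k - w_k) times the conjugate of w_k,
  so the kernel factors over the coordinates. Isolating coordinate j reduces the derivative along
  \<open>axis j \<zeta>\<close> to one variable.\<close>

lemma gauss_kernel_split:
  "gauss_kernel (m(j := p)) (b(j := q)) z w =
    (\<Prod>k\<in>UNIV - {j}. (w $ k) ^ m k) * (\<Prod>k\<in>UNIV - {j}. cnj (w $ k) ^ b k) *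
    exp (\<Sum>k\<in>UNIV - {j}. (z $ k - w $ k) * cnj (w $ k)) *
    ((w $ j) ^ p * cnj (w $ j) ^ q * exp ((z $ j - w $ j) * cnj (w $ j)))"
proof -
  have "exp (- herm w w) * exp (herm z w) = exp (\<Sum>k\<in>UNIV. (z $ k - w $ k) * cnj (w $ k))"
    by (simp add: exp_add[symmetric] herm_def sum_subtractf left_diff_distrib)
  also have "\<dots> = exp ((z $ j - w $ j) * cnj (w $ j)) * exp (\<Sum>k\<in>UNIV - {j}. (z $ k - w $ k) * cnj (w $ k))"
    by (subst sum.remove[of _ j]) (auto simp: exp_add)
  finally have e: "exp (- herm w w) * exp (herm z w) = \<dots>" .
  have "gauss_kernel (m(j := p)) (b(j := q)) z w =
    mi_power w (m(j := p)) * mi_power (cnj_vec w) (b(j := q)) * (exp (- herm w w) * exp (herm z w))"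
    by (simp add: gauss_kernel_def mult_ac)
  then show ?thesis
    unfolding e mi_power_fun_upd by (simp add: mult_ac)
qed

text \<open>The coefficients of \<open>\<zeta>\<close> and \<open>cnj \<zeta>\<close> are the two
  Wirtinger derivatives of the kernel in w_j. The truncated \<open>m j - 1\<close> and
  \<open>b j - 1\<close> are harmless, since at 0 the factor in front vanishes.\<close>

definition gauss_kernel_deriv ::
  "complex \<Rightarrow> 'd::finite \<Rightarrow> ('d \<Rightarrow> nat) \<Rightarrow> ('d \<Rightarrow> nat) \<Rightarrow> complex ^ 'd \<Rightarrow> complex ^ 'd \<Rightarrow> complex" where
  "gauss_kernel_deriv \<zeta> j m b z w =
     \<zeta> * (of_nat (m j) * gauss_kernel (m(j := m j - 1)) b z w - gauss_kernel m (b(j := b j + 1)) z w) +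
     cnj \<zeta> * (of_nat (b j) * gauss_kernel m (b(j := b j - 1)) z w + z $ j * gauss_kernel m b z w -
       gauss_kernel (m(j := m j + 1)) b z w)"

lemma gauss_kernel_has_vector_derivative:
  "((\<lambda>t. gauss_kernel m b z (w + t *\<^sub>R axis j \<zeta>)) has_vector_derivative
     gauss_kernel_deriv \<zeta> j m b z (w + t *\<^sub>R axis j \<zeta>)) (at t)"
proof -
  define R where "R = (\<Prod>k\<in>UNIV - {j}. (w $ k) ^ m k) * (\<Prod>k\<in>UNIV - {j}. cnj (w $ k) ^ b k) *
    exp (\<Sum>k\<in>UNIV - {j}. (z $ k - w $ k) * cnj (w $ k))"
  \<comment> \<open>At real arguments \<open>X\<close> and \<open>Y\<close> are the moved coordinate
    and its conjugate, but as functions of a complex argument both are holomorphic. The complex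
    product and chain rules apply and are then restricted to the real line.\<close>
  define X where "X = (\<lambda>\<tau>. w $ j + \<tau> * \<zeta>)"
  define Y where "Y = (\<lambda>\<tau>. cnj (w $ j) + \<tau> * cnj \<zeta>)"
  define E where "E = (\<lambda>\<tau>. exp ((z $ j - X \<tau>) * Y \<tau>))"
  define f where "f = (\<lambda>p q \<tau>. R * (X \<tau> ^ p * Y \<tau> ^ q * E \<tau>))"
  have f: "gauss_kernel (m(j := p)) (b(j := q)) z (w + t *\<^sub>R axis j \<zeta>) = f p q (of_real t)" for p q t
  proof -
    have nth: "(w + t *\<^sub>R axis j \<zeta>) $ k = (if k = j then X (of_real t) else w $ k)" for k
      by (simp add: axis_def X_def) (simp add: scaleR_conv_of_real)
    have "cnj (X (of_real t)) = Y (of_real t)"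
      by (simp add: X_def Y_def)
    then show ?thesis
      unfolding gauss_kernel_split nth by (simp add: f_def E_def R_def cong: prod.cong_simp sum.cong_simp)
  qed
  have f0: "gauss_kernel m b z (w + t *\<^sub>R axis j \<zeta>) = f (m j) (b j) (of_real t)"
    and f1: "gauss_kernel (m(j := p)) b z (w + t *\<^sub>R axis j \<zeta>) = f p (b j) (of_real t)"
    and f2: "gauss_kernel m (b(j := q)) z (w + t *\<^sub>R axis j \<zeta>) = f (m j) q (of_real t)" for p q t
    using f[of "m j" "b j" t] f[of p "b j" t] f[of "m j" q t] by simp_all
  have X: "(X has_field_derivative \<zeta>) (at \<tau>)" and Y: "(Y has_field_derivative cnj \<zeta>) (at \<tau>)" for \<tau>
    unfolding X_def Y_def by (auto intro!: derivative_eq_intros)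
  have "(f (m j) (b j) has_field_derivative
      \<zeta> * (of_nat (m j) * f (m j - 1) (b j) \<tau> - f (m j) (b j + 1) \<tau>) +
      cnj \<zeta> * (of_nat (b j) * f (m j) (b j - 1) \<tau> + z $ j * f (m j) (b j) \<tau> - f (m j + 1) (b j) \<tau>)) (at \<tau>)" for \<tau>
  proof -
    have "(E has_field_derivative E \<tau> * ((0 - \<zeta>) * Y \<tau> + cnj \<zeta> * (z $ j - X \<tau>))) (at \<tau>)"
      unfolding E_def by (intro DERIV_chain2[OF DERIV_exp] DERIV_mult DERIV_diff DERIV_const X Y)
    then have "(f (m j) (b j) has_field_derivative
       R * ((of_nat (m j) * (\<zeta> * X \<tau> ^ (m j - Suc 0)) * Y \<tau> ^ b j +
           of_nat (b j) * (cnj \<zeta> * Y \<tau> ^ (b j - Suc 0)) * X \<tau> ^ m j) * E \<tau> +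
         E \<tau> * ((0 - \<zeta>) * Y \<tau> + cnj \<zeta> * (z $ j - X \<tau>)) * (X \<tau> ^ m j * Y \<tau> ^ b j))) (at \<tau>)"
      unfolding f_def by (intro DERIV_cmult DERIV_mult DERIV_power X Y)
    then show ?thesis
      by (rule back_subst[where P = "\<lambda>D. (f (m j) (b j) has_field_derivative D) (at \<tau>)"])
        (simp add: f_def algebra_simps)
  qed
  then have "((\<lambda>t. f (m j) (b j) (of_real t)) has_vector_derivative
      \<zeta> * (of_nat (m j) * f (m j - 1) (b j) (of_real t) - f (m j) (b j + 1) (of_real t)) +
      cnj \<zeta> * (of_nat (b j) * f (m j) (b j - 1) (of_real t) + z $ j * f (m j) (b j) (of_real t) -
        f (m j + 1) (b j) (of_real t))) (at t)"
    by (intro has_vector_derivative_real_field) auto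
  then show ?thesis
    unfolding gauss_kernel_deriv_def f0 f1 f2 .
qed

section \<open>Gaussian moments\<close>

abbreviation gauss_kernel_integral where
  "gauss_kernel_integral m b z \<equiv> (\<integral>w. gauss_kernel m b z w \<partial>lborel)"

text \<open>On moments, a conjugate factor acts as a derivative of the holomorphic monomial, and a
  factor w_j as multiplication by z_j plus a derivative of the conjugate monomial. Both come from
  the vanishing of the integral of the derivative along \<open>axis j \<zeta>\<close>, for every
  \<zeta>.\<close>

lemma gauss_kernel_integration_by_parts:
  fixes m b :: "'d::finite \<Rightarrow> nat"
  shows "gauss_kernel_integral m (b(j := b j + 1)) z = of_nat (m j) * gauss_kernel_integral (m(j := m j - 1)) b z"
    and "gauss_kernel_integral (m(j := m j + 1)) b z =
      of_nat (b j) * gauss_kernel_integral m (b(j := b j - 1)) z + z $ j * gauss_kernel_integral m b z"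
proof -
  note [simp] = integrable_gauss_kernel
  have "(\<integral>w. gauss_kernel_deriv \<zeta> j m b z w \<partial>lborel) = 0" for \<zeta>
    by (rule integral_directional_derivative_eq_0[OF gauss_kernel_has_vector_derivative])
      (auto simp: gauss_kernel_deriv_def intro!: continuous_intros)
  then have *: "\<zeta> * (of_nat (m j) * gauss_kernel_integral (m(j := m j - 1)) b z -
          gauss_kernel_integral m (b(j := b j + 1)) z) +
     cnj \<zeta> * (of_nat (b j) * gauss_kernel_integral m (b(j := b j - 1)) z + z $ j * gauss_kernel_integral m b z -
       gauss_kernel_integral (m(j := m j + 1)) b z) = 0" (is "\<zeta> * ?A + cnj \<zeta> * ?B = 0") for \<zeta>
    by (simp add: gauss_kernel_deriv_def)
  \<comment> \<open>The directions 1 and i give A + B = 0 and A - B = 0, which separates the two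
    Wirtinger derivatives.\<close>
  have "A = 0 \<and> B = 0" if "\<And>\<zeta>. \<zeta> * A + cnj \<zeta> * B = 0" for A B
  proof -
    have "A = - B" "A = B"
      using that[of 1] that[of \<i>] by (auto simp: add_eq_0_iff2)
    then show ?thesis
      by simp
  qed
  from this[OF *] have "?A = 0" "?B = 0"
    by blast+
  then show "gauss_kernel_integral m (b(j := b j + 1)) z = of_nat (m j) * gauss_kernel_integral (m(j := m j - 1)) b z"
    and "gauss_kernel_integral (m(j := m j + 1)) b z =
      of_nat (b j) * gauss_kernel_integral m (b(j := b j - 1)) z + z $ j * gauss_kernel_integral m b z"
    by auto
qed


text \<open>The k-th derivative of x^n at x. For k > n the binomial makes it 0, where the truncated
  exponent alone would give 1.\<close>

definition deriv_power :: "nat \<Rightarrow> nat \<Rightarrow> complex \<Rightarrow> complex" where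
  "deriv_power k n x = of_nat (fact k * (n choose k)) * x ^ (n - k)"

lemma deriv_power_Suc: "deriv_power (Suc k) n x = of_nat n * deriv_power k (n - 1) x"
proof (cases n)
  case (Suc l)
  have "fact (Suc k) * (Suc l choose Suc k) = fact k * (Suc k * (Suc l choose Suc k))"
    by (simp only: fact_Suc of_nat_id mult_ac)
  also have "\<dots> = Suc l * (fact k * (l choose k))"
    by (simp only: Suc_times_binomial mult_ac)
  finally show ?thesis
    unfolding deriv_power_def Suc by (simp only: of_nat_mult diff_Suc_Suc diff_Suc_1 mult_ac)
qed (simp add: deriv_power_def)

text \<open>The integral does not depend on \<open>z\<close>: the derivative of \<open>t \<mapsto> exp (herm (t z) w)\<close> is antiholomorphic in \<open>w\<close>
  without constant term, so its Gaussian mean vanishes.\<close>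

lemma gauss_kernel_integral_0: "gauss_kernel_integral (\<lambda>_. 0) (\<lambda>_. 0) z = of_real (pi ^ CARD('d))"
  for z :: "complex ^ 'd::finite"
proof -
  have herm_scale: "herm (t *\<^sub>R z) w = of_real t * herm z w" for t and w :: "complex ^ 'd"
    by (simp add: herm_def sum_distrib_left) (simp add: scaleR_conv_of_real mult_ac)
  let ?g = "\<lambda>t w. gauss_kernel (\<lambda>_. 0) (\<lambda>_. 0) (t *\<^sub>R z) w"
  let ?g' = "\<lambda>t w. herm z w * ?g t w"
  \<comment> \<open>\<open>herm z w\<close> is linear in the conjugate of w, so \<open>?g'\<close>
    combines moments whose m is 0 and whose b is a unit vector. Integration by parts brings down the
    factor \<open>m j\<close>, which is 0. The form \<open>0 + 1\<close> matches that rule.\<close>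
  have g': "?g' t w = (\<Sum>j\<in>UNIV. z $ j * gauss_kernel (\<lambda>_. 0) ((\<lambda>_. 0)(j := 0 + 1)) (t *\<^sub>R z) w)" for t w
    by (simp add: gauss_kernel_def mi_power_fun_upd herm_def sum_distrib_right sum_distrib_left)
      (simp add: mi_power_def mult_ac)
  have z0: "(\<integral>w. ?g' t w \<partial>lborel) = 0" for t
    unfolding g' using gauss_kernel_integration_by_parts(1)[where m = "\<lambda>_ :: 'd. 0" and b = "\<lambda>_. 0"]
    by (subst Bochner_Integration.integral_sum) (auto intro: integrable_gauss_kernel)
  have i': "integrable lborel (?g' t)" for t
    unfolding g' by (intro Bochner_Integration.integrable_sum integrable_mult_right integrable_gauss_kernel)
  \<comment> \<open>A majorant independent of t in the unit interval, supplying the uniform L1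
    bound.\<close>
  define H where "H w = norm (herm z w) * exp (- (norm w)\<^sup>2) * exp (norm (herm z w))" for w
  have bound: "norm (?g' t w) \<le> H w" if "t \<in> {0..1}" for t w
  proof -
    have "Re (herm (t *\<^sub>R z) w) \<le> norm (herm (t *\<^sub>R z) w)"
      by (rule complex_Re_le_cmod)
    also have "\<dots> \<le> norm (herm z w)"
      using that by (simp add: herm_scale norm_mult mult_left_le_one_le)
    finally have "exp (Re (herm (t *\<^sub>R z) w)) \<le> exp (norm (herm z w))"
      by simp
    then show ?thesis
      by (simp add: H_def gauss_kernel_def norm_mult herm_self mi_power_def mult_left_mono mult_ac)
  qed
  have H: "integrable lborel H"
  proof -
    \<comment> \<open>The linear factor \<open>norm (herm z w)\<close> is at most another copy of
      its exponential, and two copies are the exponential belonging to \<open>2 *\<^sub>R z\<close>.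
      The remaining exponent is -1 + 1/4 = -3/4.\<close>
    obtain C where C: "C \<ge> 0" "\<And>w :: complex ^ 'd. norm (mi_power w (\<lambda>_. 0)) * norm (mi_power (cnj_vec w) (\<lambda>_. 0)) *
        exp (norm (herm (2 *\<^sub>R z) w)) \<le> C * exp ((norm w)\<^sup>2 / 4)"
      using mi_power_herm_bound[of "\<lambda>_. 0" "\<lambda>_. 0" "2 *\<^sub>R z"] by blast
    have i: "integrable lborel (\<lambda>w :: complex ^ 'd. C * exp (- (3/4) * (norm w)\<^sup>2))"
      using has_bochner_integral_exp_neg_norm_square[of "3/4", where 'a = "complex ^ 'd"]
      by (intro integrable_mult_right) (simp add: has_bochner_integral_iff)
    have "norm (H w) \<le> norm (C * exp (- (3/4) * (norm w)\<^sup>2))" for w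
    proof -
      have "norm (herm z w) \<le> exp (norm (herm z w))"
        using exp_ge_add_one_self[of "norm (herm z w)"] by linarith
      then have "norm (H w) \<le> exp (norm (herm z w)) * exp (- (norm w)\<^sup>2) * exp (norm (herm z w))"
        by (simp add: H_def)
      also have "\<dots> = exp (- (norm w)\<^sup>2) * exp (norm (herm (2 *\<^sub>R z) w))"
        by (simp add: herm_scale norm_mult exp_add[symmetric])
      also have "\<dots> \<le> exp (- (norm w)\<^sup>2) * (C * exp ((norm w)\<^sup>2 / 4))"
        using C(2)[of w] by (intro mult_left_mono) (auto simp: mi_power_def)
      also have "\<dots> = C * exp (- (3/4) * (norm w)\<^sup>2)"
        by (simp add: exp_add[symmetric] mult.left_commute)
      finally show ?thesis
        using C(1) by simp
    qed
    then show ?thesis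
      unfolding H_def
      by (intro Bochner_Integration.integrable_bound[OF i])
        (auto intro!: borel_measurable_continuous_onI continuous_intros simp: H_def)
  qed
  have "(\<integral>w. ?g 1 w \<partial>lborel) - (\<integral>w. ?g 0 w \<partial>lborel) =
      (\<integral>t. indicator {0..1} t *\<^sub>R (\<integral>w. ?g' t w \<partial>lborel) \<partial>lborel)"
  proof (rule integral_fundamental_theorem_parametric[where B = "\<integral>w. H w \<partial>lborel"])
    fix t :: real and w
    have "((\<lambda>\<tau>. exp (- herm w w) * exp (\<tau> * herm z w)) has_field_derivative
        exp (- herm w w) * (exp (of_real t * herm z w) * (1 * herm z w))) (at (of_real t))"
      by (intro DERIV_cmult DERIV_chain2[OF DERIV_exp] DERIV_cmult_right DERIV_ident)
    then have "((\<lambda>t. exp (- herm w w) * exp (of_real t * herm z w)) has_vector_derivative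
        exp (- herm w w) * (exp (of_real t * herm z w) * (1 * herm z w))) (at t within {0..1})"
      by (rule has_vector_derivative_real_field[THEN has_vector_derivative_at_within])
    then show "((\<lambda>t. ?g t w) has_vector_derivative ?g' t w) (at t within {0..1})"
      by (simp add: gauss_kernel_def mi_power_def herm_scale mult_ac)
  next
    show "continuous_on UNIV (\<lambda>(t, w). ?g' t w)"
      unfolding case_prod_beta by (intro continuous_intros)
  next
    fix t :: real assume t: "t \<in> {0..1}"
    show "(\<integral>w. norm (?g' t w) \<partial>lborel) \<le> (\<integral>w. H w \<partial>lborel)"
      using bound[OF t] i' H by (intro integral_mono integrable_norm) auto
  qed (use i' integrable_gauss_kernel in auto)
  then have "gauss_kernel_integral (\<lambda>_. 0) (\<lambda>_. 0) z = (\<integral>w. of_real (exp (- (norm w)\<^sup>2)) \<partial>(lborel :: (complex ^ 'd) measure))"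
    unfolding z0 by (simp add: gauss_kernel_def mi_power_def herm_def[of 0] herm_self exp_of_real[symmetric])
  also have "\<dots> = of_real (pi ^ CARD('d))"
  proof -
    have "(\<integral>w. exp (- (norm w)\<^sup>2) \<partial>(lborel :: (complex ^ 'd) measure)) = (sqrt pi) ^ DIM(complex ^ 'd)"
      using has_bochner_integral_exp_neg_norm_square[of 1, where 'a = "complex ^ 'd"]
      by (simp add: has_bochner_integral_iff)
    also have "\<dots> = pi ^ CARD('d)"
      by (simp add: power_mult real_sqrt_power[symmetric])
    finally show ?thesis
      by (simp only: integral_complex_of_real)
  qed
  finally show ?thesis .
qed

text \<open>Up to pi^d this is the derivative of order b of z^m. The first recursion lowers b at the
  price of lowering m, so the induction on |b| leaves m arbitrary. Its base b = 0 is an induction on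
  |m| with the second recursion, whose derivative term drops out because
  \<open>b j = 0\<close>.\<close>

lemma gauss_kernel_integral_eq:
  "gauss_kernel_integral m b z = (\<Prod>j\<in>UNIV. deriv_power (b j) (m j) (z $ j)) * of_real (pi ^ CARD('d))"
  for m b :: "'d::finite \<Rightarrow> nat"
proof -
  let ?P = "\<lambda>m b. \<Prod>j\<in>UNIV. deriv_power (b j) (m j) (z $ j)"
  have prod_upd: "?P (m(j := p)) (b(j := q)) =
      deriv_power q p (z $ j) * (\<Prod>k\<in>UNIV - {j}. deriv_power (b k) (m k) (z $ k))" for m b j p q
    by (subst prod.remove[of _ j]) (auto intro!: prod.cong)
  have base: "gauss_kernel_integral m (\<lambda>_. 0) z = ?P m (\<lambda>_. 0) * of_real (pi ^ CARD('d))" for m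
  proof (induction "mi_abs m" arbitrary: m)
    case 0
    then have "m = (\<lambda>_. 0)"
      by (auto simp: mi_abs_def)
    then show ?case
      by (simp add: gauss_kernel_integral_0 deriv_power_def)
  next
    case (Suc n)
    then obtain j where j: "m j > 0"
      by (auto simp: mi_abs_def) (metis Suc_neq_Zero gr0I sum.neutral)
    define m' where "m' = m(j := m j - 1)"
    have m: "m = m'(j := m' j + 1)"
      using j by (auto simp: m'_def)
    have "mi_abs m' = n"
      using Suc(2) j unfolding mi_abs_def m'_def
      by (simp add: sum.remove[of UNIV j])
    then have IH: "gauss_kernel_integral m' (\<lambda>_. 0) z = ?P m' (\<lambda>_. 0) * of_real (pi ^ CARD('d))"
      using Suc(1) by blast
    have "gauss_kernel_integral m (\<lambda>_. 0) z = z $ j * gauss_kernel_integral m' (\<lambda>_. 0) z"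
      by (subst m, subst gauss_kernel_integration_by_parts(2)) simp
    also have "z $ j * ?P m' (\<lambda>_. 0) = ?P m (\<lambda>_. 0)"
      using prod_upd[where m = m' and j = j and p = "m' j" and b = "\<lambda>_. 0" and q = 0]
        prod_upd[where m = m' and j = j and p = "m' j + 1" and b = "\<lambda>_. 0" and q = 0, folded m]
      by (simp add: deriv_power_def[of 0])
    then have "z $ j * gauss_kernel_integral m' (\<lambda>_. 0) z = ?P m (\<lambda>_. 0) * of_real (pi ^ CARD('d))"
      by (simp only: IH mult.assoc[symmetric])
    finally show ?case .
  qed
  show ?thesis
  proof (induction "mi_abs b" arbitrary: m b)
    case 0
    then have "b = (\<lambda>_. 0)"
      by (auto simp: mi_abs_def)
    then show ?case
      using base by simp
  next
    case (Suc n)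
    then obtain j where j: "b j > 0"
      by (auto simp: mi_abs_def) (metis Suc_neq_Zero gr0I sum.neutral)
    define b' where "b' = b(j := b j - 1)"
    have b: "b = b'(j := b' j + 1)"
      using j by (auto simp: b'_def)
    have "mi_abs b' = n"
      using Suc(2) j unfolding mi_abs_def b'_def
      by (simp add: sum.remove[of UNIV j])
    then have IH: "gauss_kernel_integral (m(j := m j - 1)) b' z =
        ?P (m(j := m j - 1)) b' * of_real (pi ^ CARD('d))"
      using Suc(1) by blast
    have "gauss_kernel_integral m b z = of_nat (m j) * gauss_kernel_integral (m(j := m j - 1)) b' z"
      by (subst b, subst gauss_kernel_integration_by_parts(1)) simp
    also have "of_nat (m j) * ?P (m(j := m j - 1)) b' = ?P m b"
      using prod_upd[where m = m and j = j and p = "m j - 1" and b = b' and q = "b' j"]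
        prod_upd[where m = m and j = j and p = "m j" and b = b' and q = "b' j + 1", folded b]
      by (simp add: deriv_power_Suc)
    then have "of_nat (m j) * gauss_kernel_integral (m(j := m j - 1)) b' z = ?P m b * of_real (pi ^ CARD('d))"
      by (simp only: IH mult.assoc[symmetric])
    finally show ?case .
  qed
qed

text \<open>For b = 0 this is the reproducing property of the kernel exp((z,w)); conjugate factors
  become derivatives.\<close>

lemma integral_gauss_monomial:
  "(\<integral>w. mi_power w m * mi_power (cnj_vec w) b * exp (herm z w) \<partial>gauss) =
     (\<Prod>j\<in>UNIV. deriv_power (b j) (m j) (z $ j))"
  for z :: "complex ^ 'd::finite"
proof -
  have "(\<integral>w. mi_power w m * mi_power (cnj_vec w) b * exp (herm z w) \<partial>gauss) =
      gauss_kernel_integral m b z / of_real (pi ^ CARD('d))"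
    unfolding gauss_kernel_def
    by (intro integral_gauss borel_measurable_continuous_onI continuous_intros)
  then show ?thesis
    by (simp add: gauss_kernel_integral_eq)
qed

subsection \<open>Multi-indices\<close>

lemma mi_abs_add [simp]: "mi_abs (\<mu> + \<nu>) = mi_abs \<mu> + mi_abs \<nu>"
  by (simp add: mi_abs_def sum.distrib)

lemma mi_abs_case_sum [simp]: "mi_abs (case_sum \<alpha> \<beta>) = mi_abs \<alpha> + mi_abs \<beta>"
  unfolding mi_abs_def UNIV_Plus_UNIV[symmetric] by (subst sum.Plus) auto

lemma mi_fact_case_sum: "mi_fact (case_sum \<alpha> \<beta>) = mi_fact \<alpha> * mi_fact \<beta>"
  unfolding mi_fact_def UNIV_Plus_UNIV[symmetric] by (subst prod.Plus) auto

lemma mi_fact_pos [simp]: "mi_fact \<alpha> > 0"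
  by (simp add: mi_fact_def prod_pos)

lemma mi_fact_nonneg [simp]: "mi_fact \<alpha> \<ge> 0"
  by (rule less_imp_le) simp

lemma mi_fact_neq_0 [simp]: "mi_fact \<alpha> \<noteq> 0"
  using mi_fact_pos[of \<alpha>] by linarith

lemma mi_fact_ge_1: "mi_fact \<alpha> \<ge> 1"
  unfolding mi_fact_def by (intro prod_ge_1) (simp add: fact_ge_1)

text \<open>The source of supermultiplicativity for the flat weights.\<close>

lemma mi_fact_add_ge: "mi_fact \<mu> * mi_fact \<nu> \<le> mi_fact (\<mu> + \<nu>)"
proof -
  have "fact m * fact n \<le> (fact (m + n) :: real)" for m n
    using fact_fact_dvd_fact[of m n, where 'a = nat]
    by (metis fact_gt_zero dvd_imp_le of_nat_fact of_nat_le_iff of_nat_mult)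
  then show ?thesis
    unfolding mi_fact_def prod.distrib[symmetric] plus_fun_apply by (intro prod_mono) auto
qed

text \<open>A binomial coefficient is at most a power of 2, so factorial quotients cost no more than
  an exponential factor.\<close>

lemma mi_fact_add_le: "mi_fact (\<mu> + \<nu>) \<le> 2 ^ mi_abs (\<mu> + \<nu>) * (mi_fact \<mu> * mi_fact \<nu>)"
proof -
  have "(fact (m + n) :: real) \<le> 2 ^ (m + n) * (fact m * fact n)" for m n :: nat
  proof -
    have "(fact (m + n) :: real) = of_nat ((m + n) choose m) * (fact m * fact n)"
      by (simp add: binomial_fact)
    also have "((m + n) choose m) \<le> 2 ^ (m + n)"
      by (rule binomial_le_pow2)
    then have "real ((m + n) choose m) \<le> 2 ^ (m + n)"
      by (metis of_nat_le_iff of_nat_numeral of_nat_power)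
    finally show ?thesis
      by (simp add: mult_right_mono)
  qed
  then have "mi_fact (\<mu> + \<nu>) \<le> (\<Prod>j\<in>UNIV. 2 ^ (\<mu> j + \<nu> j) * (fact (\<mu> j) * fact (\<nu> j)))"
    unfolding mi_fact_def plus_fun_apply by (intro prod_mono) auto
  then show ?thesis
    by (simp add: mi_fact_def mi_abs_def prod.distrib power_sum)
qed

lemma mi_le_eq_PiE: "{\<kappa> :: 'n \<Rightarrow> nat. \<kappa> \<le> \<tau>} = PiE UNIV (\<lambda>j. {..\<tau> j})"
  by (auto simp: le_fun_def PiE_UNIV_domain)

lemma finite_mi_le [simp]: "finite {\<kappa> :: 'n::finite \<Rightarrow> nat. \<kappa> \<le> \<tau>}"
  by (simp add: mi_le_eq_PiE finite_PiE)

lemma mi_le_add_diff: "\<kappa> \<le> \<tau> \<Longrightarrow> \<kappa> + (\<tau> - \<kappa>) = \<tau>" for \<kappa> :: "'n \<Rightarrow> nat"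
  by (auto simp: le_fun_def fun_eq_iff)

lemma mi_add_diff_cancel [simp]: "\<kappa> + \<tau> - \<kappa> = \<tau>" "\<tau> + \<kappa> - \<kappa> = \<tau>" for \<kappa> :: "'n \<Rightarrow> nat"
  by (auto simp: fun_eq_iff)

lemma mi_le_add [simp]: "\<kappa> \<le> \<kappa> + \<tau>" "\<kappa> \<le> \<tau> + \<kappa>" for \<kappa> :: "'n \<Rightarrow> nat"
  by (auto simp: le_fun_def)

text \<open>The one-variable binomial formulas multiplied out over the coordinates. It becomes the
  group law of \<open>wick_shift\<close>.\<close>

lemma mi_binomial_theorem:
  fixes s t :: complex and \<tau> :: "'n::finite \<Rightarrow> nat"
  shows "(\<Sum>\<kappa> | \<kappa> \<le> \<tau>. of_real (mi_fact \<tau> / (mi_fact \<kappa> * mi_fact (\<tau> - \<kappa>))) * s ^ mi_abs \<kappa> * t ^ mi_abs (\<tau> - \<kappa>)) =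
    (s + t) ^ mi_abs \<tau>"
proof -
  have "(s + t) ^ mi_abs \<tau> = (\<Prod>j\<in>UNIV. \<Sum>k\<le>\<tau> j. of_nat (\<tau> j choose k) * s ^ k * t ^ (\<tau> j - k))"
    by (simp add: mi_abs_def power_sum binomial_ring)
  also have "\<dots> = (\<Sum>\<kappa> | \<kappa> \<le> \<tau>. \<Prod>j\<in>UNIV. of_nat (\<tau> j choose \<kappa> j) * s ^ \<kappa> j * t ^ (\<tau> j - \<kappa> j))"
    unfolding mi_le_eq_PiE by (rule prod_sum_PiE) auto
  also have "\<dots> = (\<Sum>\<kappa> | \<kappa> \<le> \<tau>. of_real (mi_fact \<tau> / (mi_fact \<kappa> * mi_fact (\<tau> - \<kappa>))) * s ^ mi_abs \<kappa> * t ^ mi_abs (\<tau> - \<kappa>))"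
  proof (rule sum.cong[OF refl], safe)
    fix \<kappa> assume "\<kappa> \<le> \<tau>"
    then have "(of_nat (\<tau> j choose \<kappa> j) :: complex) = of_real (fact (\<tau> j) / (fact (\<kappa> j) * fact (\<tau> j - \<kappa> j)))" for j
      by (simp add: le_fun_def binomial_fact)
    then show "(\<Prod>j\<in>UNIV. of_nat (\<tau> j choose \<kappa> j) * s ^ \<kappa> j * t ^ (\<tau> j - \<kappa> j)) =
      of_real (mi_fact \<tau> / (mi_fact \<kappa> * mi_fact (\<tau> - \<kappa>))) * s ^ mi_abs \<kappa> * t ^ mi_abs (\<tau> - \<kappa>)"
      by (simp add: prod.distrib mi_fact_def mi_abs_def power_sum prod_dividef)
  qed
  finally show ?thesis ..
qed

lemma sum_prod_mi_le:
  fixes f :: "'n::finite \<Rightarrow> nat \<Rightarrow> real"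
  assumes nonneg: "\<And>j k. f j k \<ge> 0" and le: "\<And>j N. (\<Sum>k\<le>N. f j k) \<le> B j" and S: "finite S"
  shows "(\<Sum>\<nu>\<in>S. \<Prod>j\<in>UNIV. f j (\<nu> j)) \<le> (\<Prod>j\<in>UNIV. B j)"
proof -
  \<comment> \<open>The total degree of all members of \<open>S\<close> is a crude side length for a
    box containing \<open>S\<close>; over a box the sum of products factors.\<close>
  define N where "N = (\<Sum>\<nu>\<in>S. mi_abs \<nu>)"
  have "\<nu> j \<le> N" if "\<nu> \<in> S" for \<nu> j
  proof -
    have "\<nu> j \<le> mi_abs \<nu>"
      unfolding mi_abs_def by (rule member_le_sum) auto
    also have "\<dots> \<le> N"
      unfolding N_def using S that by (intro member_le_sum) auto
    finally show ?thesis .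
  qed
  then have "S \<subseteq> PiE UNIV (\<lambda>_. {..N})"
    by (auto simp: PiE_UNIV_domain)
  then have "(\<Sum>\<nu>\<in>S. \<Prod>j\<in>UNIV. f j (\<nu> j)) \<le> (\<Sum>\<nu>\<in>PiE UNIV (\<lambda>_. {..N}). \<Prod>j\<in>UNIV. f j (\<nu> j))"
    using nonneg by (intro sum_mono2 finite_PiE prod_nonneg) auto
  also have "\<dots> = (\<Prod>j\<in>UNIV. \<Sum>k\<le>N. f j k)"
    by (rule prod_sum_PiE[symmetric]) auto
  also have "\<dots> \<le> (\<Prod>j\<in>UNIV. B j)"
    using nonneg le by (intro prod_mono) (auto intro: sum_nonneg)
  finally show ?thesis .
qed

lemma sum_geometric_mi_le:
  fixes x :: real
  assumes "0 \<le> x" "x < 1" "finite S"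
  shows "(\<Sum>\<nu>\<in>S. x ^ mi_abs (\<nu> :: 'n::finite \<Rightarrow> nat)) \<le> (1 / (1 - x)) ^ CARD('n)"
proof -
  have "(\<Sum>k\<le>N. x ^ k) \<le> 1 / (1 - x)" for N
    using assms sum_le_suminf[OF summable_geometric[of x], of "{..N}"] by (simp add: suminf_geometric)
  then have "(\<Sum>\<nu>\<in>S. \<Prod>j\<in>UNIV. x ^ \<nu> j) \<le> (\<Prod>j\<in>(UNIV :: 'n set). 1 / (1 - x))"
    using assms by (intro sum_prod_mi_le) auto
  then show ?thesis
    by (simp add: mi_abs_def power_sum)
qed

lemma summable_on_geometric_mi:
  fixes x :: real
  assumes "0 \<le> x" "x < 1"
  shows "(\<lambda>\<nu> :: 'n::finite \<Rightarrow> nat. x ^ mi_abs \<nu>) summable_on UNIV"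
  by (rule nonneg_bdd_above_summable_on)
    (use assms in \<open>auto intro!: bdd_aboveI2 sum_geometric_mi_le\<close>)

lemma summable_on_product_nonneg:
  fixes f :: "'a \<Rightarrow> real" and g :: "'b \<Rightarrow> real"
  assumes "f summable_on A" "g summable_on B" "\<And>x. f x \<ge> 0" "\<And>y. g y \<ge> 0"
  shows "(\<lambda>(x, y). f x * g y) summable_on A \<times> B"
proof -
  have "(\<lambda>p. norm (case p of (x, y) \<Rightarrow> f x * g y)) summable_on A \<times> B"
    using assms by (subst Infinite_Sum.abs_summable_on_Sigma_iff)
      (auto simp: abs_mult infsum_cmult_right' infsum_nonneg intro!: summable_on_cmult_right summable_on_cmult_left)
  then show ?thesis
    by (rule abs_summable_summable)
qed

lemma summable_on_geometric_mi_pair: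
  fixes x :: real
  assumes "0 \<le> x" "x < 1"
  shows "(\<lambda>(\<mu>, \<nu>). x ^ mi_abs (\<mu> :: 'm::finite \<Rightarrow> nat) * x ^ mi_abs (\<nu> :: 'n::finite \<Rightarrow> nat)) summable_on UNIV"
  using summable_on_product_nonneg[OF summable_on_geometric_mi[OF assms] summable_on_geometric_mi[OF assms]] assms(1)
  by simp

lemma infinite_mi: "infinite (UNIV :: ('n::finite \<Rightarrow> nat) set)"
proof
  assume "finite (UNIV :: ('n \<Rightarrow> nat) set)"
  then have "finite (range (\<lambda>n::nat. (\<lambda>_::'n. n)))"
    by (rule finite_subset[OF subset_UNIV])
  moreover have "inj (\<lambda>n::nat. (\<lambda>_::'n. n))"
    by (auto simp: inj_def fun_eq_iff)
  ultimately show False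
    by (auto dest: finite_imageD)
qed

subsection \<open>The transformation on coefficients\<close>

text \<open>The one analytic hypothesis behind convergence, Fubini and termwise integration. It
  holds in every coefficient space of the theorem.\<close>

definition rapidly_decaying :: "(('n::finite \<Rightarrow> nat) \<Rightarrow> complex) \<Rightarrow> bool" where
  "rapidly_decaying c \<longleftrightarrow> (\<forall>R>0. \<exists>C. \<forall>\<nu>. norm (c \<nu>) * R ^ mi_abs \<nu> \<le> C)"

lemma rapidly_decayingE:
  assumes "rapidly_decaying c" "R > 0"
  obtains C where "C \<ge> 0" "\<And>\<nu>. norm (c \<nu>) \<le> C * (1 / R) ^ mi_abs \<nu>"
proof -
  obtain C where C: "\<And>\<nu>. norm (c \<nu>) * R ^ mi_abs \<nu> \<le> C"
    using assms by (auto simp: rapidly_decaying_def)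
  have "0 \<le> C"
    using C[of "\<lambda>_. 0"] by (auto simp: mi_abs_def intro: order.trans[OF norm_ge_zero])
  moreover have "norm (c \<nu>) \<le> C * (1 / R) ^ mi_abs \<nu>" for \<nu>
    using C[of \<nu>] assms(2) by (simp add: field_simps)
  ultimately show ?thesis
    by (rule that)
qed

lemma rapidly_decaying_diff:
  assumes "rapidly_decaying c" "rapidly_decaying c'"
  shows "rapidly_decaying (\<lambda>\<nu>. c \<nu> - c' \<nu>)"
  unfolding rapidly_decaying_def
proof (intro allI impI)
  fix R :: real assume R: "R > 0"
  obtain C C' where C: "norm (c \<nu>) * R ^ mi_abs \<nu> \<le> C" "norm (c' \<nu>) * R ^ mi_abs \<nu> \<le> C'" for \<nu>
    using assms R unfolding rapidly_decaying_def by meson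
  have "norm (c \<nu> - c' \<nu>) * R ^ mi_abs \<nu> \<le> C + C'" for \<nu>
  proof -
    have "norm (c \<nu> - c' \<nu>) * R ^ mi_abs \<nu> \<le> (norm (c \<nu>) + norm (c' \<nu>)) * R ^ mi_abs \<nu>"
      using R by (intro mult_right_mono norm_triangle_ineq4) auto
    then show ?thesis
      using C[of \<nu>] by (simp add: distrib_right)
  qed
  then show "\<exists>C. \<forall>\<nu>. norm (c \<nu> - c' \<nu>) * R ^ mi_abs \<nu> \<le> C"
    by blast
qed

definition diag :: "('d \<Rightarrow> nat) \<Rightarrow> 'd + 'd \<Rightarrow> nat" where
  "diag \<kappa> = case_sum \<kappa> \<kappa>"

lemma mi_abs_diag [simp]: "mi_abs (diag \<kappa>) = 2 * mi_abs \<kappa>"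
  by (simp add: diag_def)

lemma mi_fact_diag: "mi_fact (diag \<kappa>) = (mi_fact \<kappa>)\<^sup>2"
  by (simp add: diag_def mi_fact_case_sum power2_eq_square)

lemma diag_add: "diag (\<kappa> + \<tau>) = diag \<kappa> + diag \<tau>"
  by (auto simp: diag_def fun_eq_iff split: sum.split)

lemma case_sum_add_diag: "case_sum \<alpha> \<beta> + diag \<kappa> = case_sum (\<alpha> + \<kappa>) (\<beta> + \<kappa>)"
  by (auto simp: diag_def fun_eq_iff split: sum.split)

text \<open>At \<mu> = (\<alpha>,\<beta>) this is the factor of T_1^*, the square root of
  binom(\<alpha>+\<kappa>,\<kappa>) binom(\<beta>+\<kappa>,\<kappa>), because the factorial of
  \<open>diag \<kappa>\<close> is the square of that of \<kappa>.\<close>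

definition shift_coeff :: "('d::finite + 'd \<Rightarrow> nat) \<Rightarrow> ('d \<Rightarrow> nat) \<Rightarrow> real" where
  "shift_coeff \<mu> \<kappa> = sqrt (mi_fact (\<mu> + diag \<kappa>) / (mi_fact \<mu> * mi_fact (diag \<kappa>)))"

text \<open>The operator \<open>\<T>\<^sub>1\<^sup>*\<close> on coefficients is the member \<open>t = 1\<close> of the one-parameter group \<open>wick_shift t\<close>.\<close>

definition wick_shift ::
  "complex \<Rightarrow> (('d::finite + 'd \<Rightarrow> nat) \<Rightarrow> complex) \<Rightarrow> ('d + 'd \<Rightarrow> nat) \<Rightarrow> complex" where
  "wick_shift t c \<mu> = (\<Sum>\<^sub>\<infinity>\<kappa>. t ^ mi_abs \<kappa> * of_real (shift_coeff \<mu> \<kappa>) * c (\<mu> + diag \<kappa>))"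

lemma shift_coeff_nonneg [simp]: "shift_coeff \<mu> \<kappa> \<ge> 0"
  by (simp add: shift_coeff_def)

lemma shift_coeff_le: "shift_coeff \<mu> \<kappa> \<le> 2 ^ mi_abs (\<mu> + diag \<kappa>)"
proof -
  have "mi_fact (\<mu> + diag \<kappa>) / (mi_fact \<mu> * mi_fact (diag \<kappa>)) \<le> 2 ^ mi_abs (\<mu> + diag \<kappa>)"
    using mi_fact_add_le[of \<mu> "diag \<kappa>"] by (simp add: divide_le_eq)
  also have "(2 :: real) ^ mi_abs (\<mu> + diag \<kappa>) \<le> (2 ^ mi_abs (\<mu> + diag \<kappa>))\<^sup>2"
    by (rule self_le_power) auto
  finally show ?thesis
    unfolding shift_coeff_def by (rule real_le_lsqrt[rotated]) auto
qed

text \<open>The factorials of the intermediate index cancel. The square root removes the squares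
  coming from \<open>diag\<close>, so exactly a multinomial coefficient remains; this is why T_1^*
  is an exponential.\<close>

lemma shift_coeff_mult:
  assumes "\<kappa> \<le> \<tau>"
  shows "shift_coeff \<mu> \<kappa> * shift_coeff (\<mu> + diag \<kappa>) (\<tau> - \<kappa>) =
    mi_fact \<tau> / (mi_fact \<kappa> * mi_fact (\<tau> - \<kappa>)) * shift_coeff \<mu> \<tau>"
proof -
  have "\<mu> + diag \<kappa> + diag (\<tau> - \<kappa>) = \<mu> + diag \<tau>"
    using mi_le_add_diff[OF assms] by (simp add: add.assoc flip: diag_add)
  then show ?thesis
    by (simp add: shift_coeff_def mi_fact_diag real_sqrt_divide real_sqrt_mult)
qed

lemma wick_shift_has_sum:
  assumes c: "rapidly_decaying c" and t: "norm t \<le> 1"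
  shows "((\<lambda>\<kappa>. t ^ mi_abs \<kappa> * of_real (shift_coeff \<mu> \<kappa>) * c (\<mu> + diag \<kappa>)) has_sum wick_shift t c \<mu>) UNIV"
proof -
  \<comment> \<open>The rate 1/4 pays for the 2^n of \<open>shift_coeff_le\<close> and leaves the
    summable 1/2.\<close>
  obtain C where C: "C \<ge> 0" "\<And>\<nu>. norm (c \<nu>) \<le> C * (1 / 4) ^ mi_abs \<nu>"
    using rapidly_decayingE[OF c, of 4] by auto
  have "(\<lambda>\<kappa>. norm (t ^ mi_abs \<kappa> * of_real (shift_coeff \<mu> \<kappa>) * c (\<mu> + diag \<kappa>))) summable_on UNIV"
  proof (rule summable_on_comparison_test)
    show "(\<lambda>\<kappa> :: 'a \<Rightarrow> nat. C * (1 / 2) ^ mi_abs \<kappa>) summable_on UNIV"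
      by (intro summable_on_cmult_right summable_on_geometric_mi) auto
    fix \<kappa>
    have "norm (t ^ mi_abs \<kappa> * of_real (shift_coeff \<mu> \<kappa>) * c (\<mu> + diag \<kappa>)) \<le>
        1 * 2 ^ mi_abs (\<mu> + diag \<kappa>) * (C * (1 / 4) ^ mi_abs (\<mu> + diag \<kappa>))"
      unfolding norm_mult
      by (intro mult_mono C(2)) (use t C(1) in \<open>auto simp: norm_power power_le_one shift_coeff_le simp del: mi_abs_add\<close>)
    also have "\<dots> = C * (1 / 2) ^ mi_abs (\<mu> + diag \<kappa>)"
      by (simp add: power_mult_distrib[symmetric] mult.left_commute del: mi_abs_add)
    also have "\<dots> \<le> C * (1 / 2) ^ mi_abs \<kappa>"
      using C(1) by (intro mult_left_mono power_decreasing) auto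
    finally show "norm (t ^ mi_abs \<kappa> * of_real (shift_coeff \<mu> \<kappa>) * c (\<mu> + diag \<kappa>)) \<le> C * (1 / 2) ^ mi_abs \<kappa>" .
  qed auto
  then show ?thesis
    unfolding wick_shift_def by (rule has_sum_infsum[OF abs_summable_summable])
qed

text \<open>The convention \<open>0 ^ 0 = 1\<close> keeps exactly the term
  \<open>\<kappa> = 0\<close>.\<close>

lemma wick_shift_0: "wick_shift 0 c = c"
proof
  fix \<mu> :: "'a + 'a \<Rightarrow> nat"
  have "mi_abs \<kappa> = 0 \<longleftrightarrow> \<kappa> = 0" for \<kappa> :: "'a \<Rightarrow> nat"
    by (auto simp: mi_abs_def fun_eq_iff)
  then have "wick_shift 0 c \<mu> = (\<Sum>\<^sub>\<infinity>\<kappa>\<in>{0}. 0 ^ mi_abs \<kappa> * of_real (shift_coeff \<mu> \<kappa>) * c (\<mu> + diag \<kappa>))"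
    unfolding wick_shift_def by (intro infsum_cong_neutral) auto
  moreover have "diag (0 :: 'a \<Rightarrow> nat) = 0"
    by (auto simp: diag_def fun_eq_iff split: sum.split)
  ultimately show "wick_shift 0 c \<mu> = c \<mu>"
    by (simp add: shift_coeff_def mi_fact_def mi_abs_def)
qed

text \<open>The composition is an absolutely convergent double series over (\<kappa>,\<eta>).
  Regrouped by \<tau> = \<kappa> + \<eta>, its inner sums are finite and are evaluated by the
  binomial theorem.\<close>

lemma wick_shift_add:
  assumes c: "rapidly_decaying c" and s: "norm s \<le> 1" and t: "norm t \<le> 1"
  shows "wick_shift s (wick_shift t c) = wick_shift (s + t) c"
proof
  fix \<mu> :: "'a + 'a \<Rightarrow> nat"
  define F where "F = (\<lambda>(\<kappa>, \<eta>). s ^ mi_abs \<kappa> * of_real (shift_coeff \<mu> \<kappa>) *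
    (t ^ mi_abs \<eta> * of_real (shift_coeff (\<mu> + diag \<kappa>) \<eta>) * c (\<mu> + diag \<kappa> + diag \<eta>)))"
  \<comment> \<open>Two shift coefficients cost 2^n each, so the rate 1/8 leaves 1/2.\<close>
  obtain C where C: "C \<ge> 0" "\<And>\<nu>. norm (c \<nu>) \<le> C * (1 / 8) ^ mi_abs \<nu>"
    using rapidly_decayingE[OF c, of 8] by auto
  have "(\<lambda>p. norm (F p)) summable_on UNIV"
  proof (rule summable_on_comparison_test)
    show "(\<lambda>p :: ('a \<Rightarrow> nat) \<times> ('a \<Rightarrow> nat). C * (case p of (\<kappa>, \<eta>) \<Rightarrow> (1 / 2) ^ mi_abs \<kappa> * (1 / 2) ^ mi_abs \<eta>)) summable_on UNIV"
      by (intro summable_on_cmult_right summable_on_geometric_mi_pair) auto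
    fix p :: "('a \<Rightarrow> nat) \<times> ('a \<Rightarrow> nat)"
    obtain \<kappa> \<eta> where p: "p = (\<kappa>, \<eta>)"
      by (cases p)
    define n where "n = mi_abs (\<mu> + diag \<kappa> + diag \<eta>)"
    have "norm (s ^ mi_abs \<kappa> * of_real (shift_coeff \<mu> \<kappa>) *
        (t ^ mi_abs \<eta> * of_real (shift_coeff (\<mu> + diag \<kappa>) \<eta>) * c (\<mu> + diag \<kappa> + diag \<eta>))) \<le>
        1 * 2 ^ mi_abs (\<mu> + diag \<kappa>) * (1 * 2 ^ n * (C * (1 / 8) ^ n))"
      unfolding norm_mult n_def
      by (intro mult_mono C(2)) (use s t C(1) in \<open>auto simp: norm_power power_le_one shift_coeff_le simp del: mi_abs_add\<close>)
    also have "\<dots> \<le> 1 * 2 ^ n * (1 * 2 ^ n * (C * (1 / 8) ^ n))"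
      using C(1) by (intro mult_right_mono mult_left_mono power_increasing) (auto simp: n_def)
    also have "\<dots> = C * (1 / 2) ^ n"
      by (simp add: power_mult_distrib[symmetric] mult.left_commute)
    also have "\<dots> \<le> C * (1 / 2) ^ (mi_abs \<kappa> + mi_abs \<eta>)"
      using C(1) by (intro mult_left_mono power_decreasing) (auto simp: n_def)
    finally show "norm (F p) \<le> C * (case p of (\<kappa>, \<eta>) \<Rightarrow> (1 / 2) ^ mi_abs \<kappa> * (1 / 2) ^ mi_abs \<eta>)"
      by (simp add: F_def p power_add)
  qed auto
  then have "F summable_on UNIV"
    by (rule abs_summable_summable)
  then obtain S where S: "(F has_sum S) UNIV"
    by (auto simp: summable_on_def)
  have "((\<lambda>\<kappa>. s ^ mi_abs \<kappa> * of_real (shift_coeff \<mu> \<kappa>) * wick_shift t c (\<mu> + diag \<kappa>)) has_sum S) UNIV"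
  proof (rule has_sum_SigmaD)
    show "(F has_sum S) (Sigma UNIV (\<lambda>_. UNIV))"
      using S by simp
    show "((\<lambda>\<eta>. F (\<kappa>, \<eta>)) has_sum s ^ mi_abs \<kappa> * of_real (shift_coeff \<mu> \<kappa>) * wick_shift t c (\<mu> + diag \<kappa>)) UNIV" for \<kappa>
      unfolding F_def prod.case by (intro has_sum_cmult_right wick_shift_has_sum c t)
  qed
  then have 1: "wick_shift s (wick_shift t c) \<mu> = S"
    unfolding wick_shift_def[of s] by (rule infsumI)
  have "(F has_sum S) UNIV \<longleftrightarrow> ((\<lambda>(\<tau>, \<kappa>). F (\<kappa>, \<tau> - \<kappa>)) has_sum S) (Sigma UNIV (\<lambda>\<tau>. {\<kappa>. \<kappa> \<le> \<tau>}))"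
    by (rule has_sum_reindex_bij_witness[of _ "\<lambda>(\<tau>, \<kappa>). (\<kappa>, \<tau> - \<kappa>)" "\<lambda>(\<kappa>, \<eta>). (\<kappa> + \<eta>, \<kappa>)"])
      (auto simp: mi_le_add_diff)
  with S have "((\<lambda>(\<tau>, \<kappa>). F (\<kappa>, \<tau> - \<kappa>)) has_sum S) (Sigma UNIV (\<lambda>\<tau>. {\<kappa>. \<kappa> \<le> \<tau>}))"
    by simp
  then have "((\<lambda>\<tau>. (s + t) ^ mi_abs \<tau> * of_real (shift_coeff \<mu> \<tau>) * c (\<mu> + diag \<tau>)) has_sum S) UNIV"
  proof (rule has_sum_SigmaD)
    fix \<tau> :: "'a \<Rightarrow> nat"
    have "F (\<kappa>, \<tau> - \<kappa>) = of_real (mi_fact \<tau> / (mi_fact \<kappa> * mi_fact (\<tau> - \<kappa>))) * s ^ mi_abs \<kappa> * t ^ mi_abs (\<tau> - \<kappa>) *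
        (of_real (shift_coeff \<mu> \<tau>) * c (\<mu> + diag \<tau>))" if "\<kappa> \<le> \<tau>" for \<kappa>
    proof -
      have "F (\<kappa>, \<tau> - \<kappa>) = s ^ mi_abs \<kappa> * t ^ mi_abs (\<tau> - \<kappa>) *
          of_real (shift_coeff \<mu> \<kappa> * shift_coeff (\<mu> + diag \<kappa>) (\<tau> - \<kappa>)) * c (\<mu> + diag \<kappa> + diag (\<tau> - \<kappa>))"
        by (simp add: F_def mult_ac)
      also have "\<mu> + diag \<kappa> + diag (\<tau> - \<kappa>) = \<mu> + diag \<tau>"
        using mi_le_add_diff[OF that] by (simp add: add.assoc flip: diag_add)
      finally show ?thesis
        unfolding shift_coeff_mult[OF that] by (simp only: of_real_mult mult_ac)
    qed
    then have "(\<Sum>\<kappa> | \<kappa> \<le> \<tau>. F (\<kappa>, \<tau> - \<kappa>)) = (\<Sum>\<kappa> | \<kappa> \<le> \<tau>.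
        of_real (mi_fact \<tau> / (mi_fact \<kappa> * mi_fact (\<tau> - \<kappa>))) * s ^ mi_abs \<kappa> * t ^ mi_abs (\<tau> - \<kappa>) *
        (of_real (shift_coeff \<mu> \<tau>) * c (\<mu> + diag \<tau>)))"
      by (intro sum.cong refl) simp
    also have "\<dots> = (s + t) ^ mi_abs \<tau> * of_real (shift_coeff \<mu> \<tau>) * c (\<mu> + diag \<tau>)"
      unfolding sum_distrib_right[symmetric] mi_binomial_theorem by (rule mult.assoc[symmetric])
    finally show "((\<lambda>\<kappa>. case (\<tau>, \<kappa>) of (\<tau>, \<kappa>) \<Rightarrow> F (\<kappa>, \<tau> - \<kappa>)) has_sum
        (s + t) ^ mi_abs \<tau> * of_real (shift_coeff \<mu> \<tau>) * c (\<mu> + diag \<tau>)) {\<kappa>. \<kappa> \<le> \<tau>}"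
      unfolding prod.case by (intro has_sum_finiteI finite_mi_le) (rule sym)
  qed
  then have "wick_shift (s + t) c \<mu> = S"
    unfolding wick_shift_def by (rule infsumI)
  with 1 show "wick_shift s (wick_shift t c) \<mu> = wick_shift (s + t) c \<mu>"
    by simp
qed

subsection \<open>Wick and anti-Wick operators on monomials\<close>

text \<open>The usual bound exp(|z|^2/2) has no factor depending on \<alpha>, but its Gaussian
  exponent is too large for a product of two such terms against the density. Applying x^n \<le> n!
  e^x at x = |z_j|^2/4 lowers the exponent to 1/8 for the price of 2^|\<alpha>|, which the
  coefficients absorb.\<close>

lemma norm_mono_e_le: "norm (mono_e \<alpha> z) \<le> 2 ^ mi_abs \<alpha> * exp ((norm z)\<^sup>2 / 8)"
proof (rule power2_le_imp_le)
  have "(norm (mono_e \<alpha> z))\<^sup>2 = (\<Prod>j\<in>UNIV. ((norm (z $ j))\<^sup>2) ^ \<alpha> j / fact (\<alpha> j))"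
    by (simp add: mono_e_def norm_divide power_divide mi_power_def mi_fact_def prod_norm[symmetric] norm_power
        prod_dividef prod_nonneg prod_power_distrib power_mult[symmetric] mult.commute)
  also have "\<dots> \<le> (\<Prod>j\<in>UNIV. 4 ^ \<alpha> j * exp ((norm (z $ j))\<^sup>2 / 4))"
  proof (intro prod_mono conjI)
    fix j
    have "((norm (z $ j))\<^sup>2 / 4) ^ \<alpha> j \<le> fact (\<alpha> j) * exp ((norm (z $ j))\<^sup>2 / 4)"
      by (intro power_le_fact_mult_exp) auto
    then show "((norm (z $ j))\<^sup>2) ^ \<alpha> j / fact (\<alpha> j) \<le> 4 ^ \<alpha> j * exp ((norm (z $ j))\<^sup>2 / 4)"
      by (simp add: power_divide field_simps)
  qed simp
  also have "\<dots> = 4 ^ mi_abs \<alpha> * exp ((\<Sum>j\<in>UNIV. (norm (z $ j))\<^sup>2) / 4)"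
    by (simp add: prod.distrib mi_abs_def power_sum exp_sum sum_divide_distrib)
  also have "(\<Sum>j\<in>UNIV. (norm (z $ j))\<^sup>2) = (norm z)\<^sup>2"
    by (simp add: norm_vec_def L2_set_def sum_nonneg)
  also have "4 ^ mi_abs \<alpha> * exp ((norm z)\<^sup>2 / 4) = (2 ^ mi_abs \<alpha> * exp ((norm z)\<^sup>2 / 8))\<^sup>2"
    proof -
    have "(4 :: real) ^ mi_abs \<alpha> = (2 ^ mi_abs \<alpha>)\<^sup>2"
      by (simp add: power2_eq_square power_mult_distrib[symmetric])
    moreover have "exp ((norm z)\<^sup>2 / 4) = (exp ((norm z)\<^sup>2 / 8))\<^sup>2"
      by (simp add: power2_eq_square exp_add[symmetric])
    ultimately show ?thesis
      by (simp only: power_mult_distrib)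
  qed
  finally show "(norm (mono_e \<alpha> z))\<^sup>2 \<le> (2 ^ mi_abs \<alpha> * exp ((norm z)\<^sup>2 / 8))\<^sup>2" .
qed auto

definition symbol_term ::
  "(('d::finite + 'd \<Rightarrow> nat) \<Rightarrow> complex) \<Rightarrow> complex ^ 'd \<Rightarrow> complex ^ 'd \<Rightarrow> ('d \<Rightarrow> nat) \<times> ('d \<Rightarrow> nat) \<Rightarrow> complex" where
  "symbol_term c z w = (\<lambda>(\<alpha>, \<beta>). c (case_sum \<alpha> \<beta>) * mono_e \<alpha> z * mono_e \<beta> (cnj_vec w))"

lemma is_symbol_series_iff: "is_symbol_series c a \<longleftrightarrow> (\<forall>z w. (symbol_term c z w has_sum a z w) UNIV)"
  by (simp add: is_symbol_series_def symbol_term_def)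

lemma symbol_term_bound:
  assumes "rapidly_decaying c"
  obtains C where "C \<ge> 0"
    "\<And>z w S. finite S \<Longrightarrow> (\<Sum>p\<in>S. norm (symbol_term c z w p)) \<le> C * (exp ((norm z)\<^sup>2 / 8) * exp ((norm w)\<^sup>2 / 8))"
proof -
  \<comment> \<open>Rate 1/4 against the factors 2^|\<alpha>| and 2^|\<beta>| of the monomials
    leaves 1/2 in each variable.\<close>
  obtain C where C: "C \<ge> 0" "\<And>\<nu>. norm (c \<nu>) \<le> C * (1 / 4) ^ mi_abs \<nu>"
    using rapidly_decayingE[OF assms, of 4] by auto
  define g :: "('a \<Rightarrow> nat) \<times> ('a \<Rightarrow> nat) \<Rightarrow> real"
    where "g = (\<lambda>(\<alpha>, \<beta>). (1 / 2) ^ mi_abs \<alpha> * (1 / 2) ^ mi_abs \<beta>)"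
  have g: "g summable_on UNIV"
    unfolding g_def by (rule summable_on_geometric_mi_pair) auto
  have g0: "g p \<ge> 0" for p
    by (simp add: g_def case_prod_unfold)
  have *: "norm (symbol_term c z w p) \<le> g p * (C * (exp ((norm z)\<^sup>2 / 8) * exp ((norm w)\<^sup>2 / 8)))" for z w p
  proof -
    obtain \<alpha> \<beta> where p: "p = (\<alpha>, \<beta>)"
      by (cases p)
    have "norm (symbol_term c z w p) \<le> C * (1 / 4) ^ mi_abs (case_sum \<alpha> \<beta>) *
        (2 ^ mi_abs \<alpha> * exp ((norm z)\<^sup>2 / 8)) * (2 ^ mi_abs \<beta> * exp ((norm w)\<^sup>2 / 8))"
      unfolding p symbol_term_def prod.case norm_mult
      using norm_mono_e_le[of \<beta> "cnj_vec w"] C(1) C(2)[of "case_sum \<alpha> \<beta>"]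
      by (intro mult_mono norm_mono_e_le) (auto intro!: mult_nonneg_nonneg)
    also have "\<dots> = C * ((1 / 4) ^ mi_abs \<alpha> * 2 ^ mi_abs \<alpha>) * ((1 / 4) ^ mi_abs \<beta> * 2 ^ mi_abs \<beta>) *
        (exp ((norm z)\<^sup>2 / 8) * exp ((norm w)\<^sup>2 / 8))"
      by (simp add: power_add)
    also have "\<dots> = g p * (C * (exp ((norm z)\<^sup>2 / 8) * exp ((norm w)\<^sup>2 / 8)))"
      unfolding power_mult_distrib[symmetric] by (simp add: g_def p)
    finally show ?thesis .
  qed
  show ?thesis
  proof (rule that)
    show "infsum g UNIV * C \<ge> 0"
      using g0 C(1) by (intro mult_nonneg_nonneg infsum_nonneg) auto
    fix z w :: "complex ^ 'a" and S :: "(('a \<Rightarrow> nat) \<times> ('a \<Rightarrow> nat)) set"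
    assume S: "finite S"
    have "(\<Sum>p\<in>S. norm (symbol_term c z w p)) \<le> (\<Sum>p\<in>S. g p) * (C * (exp ((norm z)\<^sup>2 / 8) * exp ((norm w)\<^sup>2 / 8)))"
      unfolding sum_distrib_right by (intro sum_mono *)
    also have "\<dots> \<le> infsum g UNIV * (C * (exp ((norm z)\<^sup>2 / 8) * exp ((norm w)\<^sup>2 / 8)))"
      using C(1) g g0 S by (intro mult_right_mono finite_sum_le_infsum) auto
    finally show "(\<Sum>p\<in>S. norm (symbol_term c z w p)) \<le> infsum g UNIV * C * (exp ((norm z)\<^sup>2 / 8) * exp ((norm w)\<^sup>2 / 8))"
      by (simp only: mult.assoc)
  qed
qed

lemma is_symbol_series_exists:
  assumes "rapidly_decaying c"
  obtains a where "is_symbol_series c a"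
proof -
  obtain C where "C \<ge> 0" and C:
    "\<And>z w S. finite S \<Longrightarrow> (\<Sum>p\<in>S. norm (symbol_term c z w p)) \<le> C * (exp ((norm z)\<^sup>2 / 8) * exp ((norm w)\<^sup>2 / 8))"
    using symbol_term_bound[OF assms] by blast
  have "symbol_term c z w summable_on UNIV" for z w
  proof (rule abs_summable_summable, rule nonneg_bdd_above_summable_on)
    show "bdd_above (sum (\<lambda>p. norm (symbol_term c z w p)) ` {F. F \<subseteq> UNIV \<and> finite F})"
      using C by (intro bdd_aboveI2) auto
  qed auto
  then have "is_symbol_series c (\<lambda>z w. \<Sum>\<^sub>\<infinity>p. symbol_term c z w p)"
    unfolding is_symbol_series_iff by (intro allI has_sum_infsum)
  then show ?thesis
    by (rule that)
qed

lemma is_symbol_series_unique: "is_symbol_series c a \<Longrightarrow> is_symbol_series c b \<Longrightarrow> a = b"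
  unfolding is_symbol_series_iff by (intro ext) (blast intro: has_sum_unique)

lemma is_symbol_series_0: "is_symbol_series (\<lambda>_. 0) (\<lambda>_ _. 0)"
  by (simp add: is_symbol_series_def case_prod_unfold)

lemma is_symbol_series_add:
  "is_symbol_series c a \<Longrightarrow> is_symbol_series c' b \<Longrightarrow> is_symbol_series (\<lambda>\<nu>. c \<nu> + c' \<nu>) (\<lambda>z w. a z w + b z w)"
  unfolding is_symbol_series_def
  by (auto simp: case_prod_unfold distrib_right intro!: has_sum_add)

lemma is_symbol_series_cmult:
  "is_symbol_series c a \<Longrightarrow> is_symbol_series (\<lambda>\<nu>. k * c \<nu>) (\<lambda>z w. k * a z w)"
  unfolding is_symbol_series_def
  by (auto simp: case_prod_unfold mult.assoc intro!: has_sum_cmult_right)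

text \<open>Both operators arise from this lemma, with \<open>x w = z\<close> (Wick) and \<open>x w = w\<close> (anti-Wick).\<close>

lemma symbol_series_integral:
  fixes c :: "('d::finite + 'd \<Rightarrow> nat) \<Rightarrow> complex"
  assumes c: "rapidly_decaying c" and a: "is_symbol_series c a"
    and x: "continuous_on UNIV x" "\<And>w. (norm (x w))\<^sup>2 \<le> A + (norm w)\<^sup>2"
  shows "integrable gauss (\<lambda>w. a (x w) w * (mi_power w m * mi_power (cnj_vec w) b * exp (herm z w)))" (is ?int)
    and "((\<lambda>p. \<integral>w. symbol_term c (x w) w p * (mi_power w m * mi_power (cnj_vec w) b * exp (herm z w)) \<partial>gauss)
      has_sum (\<integral>w. a (x w) w * (mi_power w m * mi_power (cnj_vec w) b * exp (herm z w)) \<partial>gauss)) UNIV" (is ?sum)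
proof -
  let ?M = "\<lambda>w. mi_power w m * mi_power (cnj_vec w) b * exp (herm z w)"
  obtain C where C: "C \<ge> 0"
    "\<And>z w S. finite S \<Longrightarrow> (\<Sum>p\<in>S. norm (symbol_term c z w p)) \<le> C * (exp ((norm z)\<^sup>2 / 8) * exp ((norm w)\<^sup>2 / 8))"
    using symbol_term_bound[OF c] by blast
  obtain D where D: "D \<ge> 0" "\<And>w. norm (mi_power w m) * norm (mi_power (cnj_vec w) b) *
      exp (norm (herm z w)) \<le> D * exp ((norm w)\<^sup>2 / 4)"
    using mi_power_herm_bound[of m b z] by blast
  \<comment> \<open>The exponents add up to 1/2: two times 1/8 from the symbol, where |x w|^2
    contributes at most A + |w|^2, and 1/4 from the monomials and
    \<open>exp (herm z w)\<close>.\<close>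
  define G where "G = (\<lambda>w :: complex ^ 'd. C * exp (A / 8) * D * exp ((norm w)\<^sup>2 / 2))"
  have G: "integrable gauss G"
    unfolding G_def using C(1) D(1)
    by (intro integrable_gauss_real[where C = "C * exp (A / 8) * D"] borel_measurable_continuous_onI continuous_intros) auto
  have dom: "(\<Sum>p\<in>S. norm (symbol_term c (x w) w p * ?M w)) \<le> G w" if S: "finite S" for S w
  proof -
    have "norm (?M w) \<le> norm (mi_power w m) * norm (mi_power (cnj_vec w) b) * exp (norm (herm z w))"
      by (simp add: norm_mult mult_left_mono complex_Re_le_cmod)
    also note D(2)
    finally have M: "norm (?M w) \<le> D * exp ((norm w)\<^sup>2 / 4)" .
    have "exp ((norm (x w))\<^sup>2 / 8) * exp ((norm w)\<^sup>2 / 8) \<le> exp (A / 8) * exp ((norm w)\<^sup>2 / 4)"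
      using x(2)[of w] by (simp add: exp_add[symmetric])
    then have "C * (exp ((norm (x w))\<^sup>2 / 8) * exp ((norm w)\<^sup>2 / 8)) \<le> C * (exp (A / 8) * exp ((norm w)\<^sup>2 / 4))"
      using C(1) by (rule mult_left_mono)
    with C(2)[OF S, of "x w" w]
    have "(\<Sum>p\<in>S. norm (symbol_term c (x w) w p)) \<le> C * (exp (A / 8) * exp ((norm w)\<^sup>2 / 4))"
      by linarith
    then have "(\<Sum>p\<in>S. norm (symbol_term c (x w) w p)) * norm (?M w) \<le>
        C * (exp (A / 8) * exp ((norm w)\<^sup>2 / 4)) * (D * exp ((norm w)\<^sup>2 / 4))"
      using M C(1) by (intro mult_mono) auto
    also have "\<dots> = C * exp (A / 8) * D * (exp ((norm w)\<^sup>2 / 4) * exp ((norm w)\<^sup>2 / 4))"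
      by (simp only: mult_ac)
    also have "\<dots> = G w"
      unfolding exp_add[symmetric] by (simp add: G_def)
    finally show ?thesis
      by (simp only: norm_mult sum_distrib_right)
  qed
  have meas: "(\<lambda>w. symbol_term c (x w) w p * ?M w) \<in> borel_measurable gauss" for p
  proof -
    have "continuous_on UNIV (\<lambda>w. symbol_term c (x w) w p * ?M w)"
      unfolding symbol_term_def case_prod_unfold mono_e_def
      by (intro continuous_intros x) auto
    then show ?thesis
      using borel_measurable_continuous_onI by (simp add: measurable_cong_sets[OF sets_gauss refl])
  qed
  have sum: "((\<lambda>p. symbol_term c (x w) w p * ?M w) has_sum a (x w) w * ?M w) UNIV" for w
    using a by (intro has_sum_cmult_left) (simp add: is_symbol_series_iff)
  have inf: "infinite (UNIV :: (('d \<Rightarrow> nat) \<times> ('d \<Rightarrow> nat)) set)"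
    using infinite_mi by (simp add: finite_prod)
  show ?int ?sum
    by (rule has_sum_integral_dominated[OF inf meas G dom sum]; assumption)+
qed

lemma integrable_symbol_poly:
  assumes c: "rapidly_decaying c" and a: "is_symbol_series c a" and F: "F \<in> polys"
    and x: "continuous_on UNIV x" "\<And>w. (norm (x w))\<^sup>2 \<le> A + (norm w)\<^sup>2"
  shows "integrable gauss (\<lambda>w. a (x w) w * F w * exp (herm z w))"
proof -
  obtain S k where F: "finite S" "F = (\<lambda>z. \<Sum>\<alpha>\<in>S. k \<alpha> * mi_power z \<alpha>)"
    using F by (auto simp: polys_def)
  have "integrable gauss (\<lambda>w. \<Sum>\<alpha>\<in>S. k \<alpha> * (a (x w) w * (mi_power w \<alpha> * mi_power (cnj_vec w) (\<lambda>_. 0) * exp (herm z w))))"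
    by (intro Bochner_Integration.integrable_sum integrable_mult_right symbol_series_integral(1)[OF c a x])
  then show ?thesis
    by (simp add: F(2) mi_power_def sum_distrib_left sum_distrib_right mult_ac)
qed

lemma integrable_Op_wick:
  assumes "rapidly_decaying c" "is_symbol_series c a" "F \<in> polys"
  shows "integrable gauss (\<lambda>w. a z w * F w * exp (herm z w))"
  by (rule integrable_symbol_poly[OF assms, where x = "\<lambda>_. z" and A = "(norm z)\<^sup>2"]) auto

lemma integrable_Op_antiwick:
  assumes "rapidly_decaying c" "is_symbol_series c a" "F \<in> polys"
  shows "integrable gauss (\<lambda>w. a w w * F w * exp (herm z w))"
  by (rule integrable_symbol_poly[OF assms, where x = "\<lambda>w. w" and A = 0]) auto

lemma mi_power_in_polys: "(\<lambda>w. mi_power w \<delta>) \<in> polys"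
  unfolding polys_def by (intro CollectI exI[of _ "{\<delta>}"] exI[of _ "\<lambda>_. 1"]) auto

lemma symbol_term_eq:
  "symbol_term c z w (\<alpha>, \<beta>) = c (case_sum \<alpha> \<beta>) / of_real (sqrt (mi_fact \<alpha>) * sqrt (mi_fact \<beta>)) *
    (mi_power z \<alpha> * mi_power (cnj_vec w) \<beta>)"
  by (simp add: symbol_term_def mono_e_def)

lemma mi_power_add: "mi_power w (\<alpha> + \<beta>) = mi_power w \<alpha> * mi_power w \<beta>"
  by (simp add: mi_power_def power_add prod.distrib)

section \<open>Action on monomials, term by term\<close>

lemma Op_wick_mi_power_has_sum:
  assumes c: "rapidly_decaying c" and a: "is_symbol_series c a"
  shows "((\<lambda>(\<alpha>, \<beta>). c (case_sum \<alpha> \<beta>) / of_real (sqrt (mi_fact \<alpha>) * sqrt (mi_fact \<beta>)) *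
      (mi_power z \<alpha> * (\<Prod>j\<in>UNIV. deriv_power (\<beta> j) (\<delta> j) (z $ j)))) has_sum
      Op_wick a (\<lambda>w. mi_power w \<delta>) z) UNIV"
proof -
  let ?M = "\<lambda>w. mi_power w \<delta> * mi_power (cnj_vec w) 0 * exp (herm z w)"
  have "(\<integral>w. symbol_term c z w (\<alpha>, \<beta>) * ?M w \<partial>gauss) =
    c (case_sum \<alpha> \<beta>) / of_real (sqrt (mi_fact \<alpha>) * sqrt (mi_fact \<beta>)) *
      (mi_power z \<alpha> * (\<Prod>j\<in>UNIV. deriv_power (\<beta> j) (\<delta> j) (z $ j)))" for \<alpha> \<beta>
  proof -
    have "(\<integral>w. symbol_term c z w (\<alpha>, \<beta>) * ?M w \<partial>gauss) =
      (\<integral>w. c (case_sum \<alpha> \<beta>) / of_real (sqrt (mi_fact \<alpha>) * sqrt (mi_fact \<beta>)) * mi_power z \<alpha> *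
        (mi_power w \<delta> * mi_power (cnj_vec w) \<beta> * exp (herm z w)) \<partial>gauss)"
      unfolding symbol_term_eq by (intro Bochner_Integration.integral_cong refl) (simp add: mi_power_def[of _ 0] mult_ac)
    then show ?thesis
      unfolding integral_mult_right_zero integral_gauss_monomial by (simp only: mult.assoc)
  qed
  then have 1: "(\<lambda>p. \<integral>w. symbol_term c z w p * ?M w \<partial>gauss) =
    (\<lambda>(\<alpha>, \<beta>). c (case_sum \<alpha> \<beta>) / of_real (sqrt (mi_fact \<alpha>) * sqrt (mi_fact \<beta>)) *
      (mi_power z \<alpha> * (\<Prod>j\<in>UNIV. deriv_power (\<beta> j) (\<delta> j) (z $ j))))"
    by (simp only: fun_eq_iff split_paired_All prod.case simp_thms)
  have 2: "(\<integral>w. a z w * ?M w \<partial>gauss) = Op_wick a (\<lambda>w. mi_power w \<delta>) z"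
    by (simp add: Op_wick_def mi_power_in_polys mi_power_def[of _ 0] mult.assoc)
  show ?thesis
    using symbol_series_integral(2)[OF c a, of "\<lambda>_. z" "(norm z)\<^sup>2" \<delta> 0 z] unfolding 1 2 by simp
qed

lemma Op_antiwick_mi_power_has_sum:
  assumes c: "rapidly_decaying c" and a: "is_symbol_series c a"
  shows "((\<lambda>(\<alpha>, \<beta>). c (case_sum \<alpha> \<beta>) / of_real (sqrt (mi_fact \<alpha>) * sqrt (mi_fact \<beta>)) *
      (\<Prod>j\<in>UNIV. deriv_power (\<beta> j) (\<alpha> j + \<delta> j) (z $ j))) has_sum
      Op_antiwick a (\<lambda>w. mi_power w \<delta>) z) UNIV"
proof -
  let ?M = "\<lambda>w. mi_power w \<delta> * mi_power (cnj_vec w) 0 * exp (herm z w)"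
  have "(\<integral>w. symbol_term c w w (\<alpha>, \<beta>) * ?M w \<partial>gauss) =
    c (case_sum \<alpha> \<beta>) / of_real (sqrt (mi_fact \<alpha>) * sqrt (mi_fact \<beta>)) *
      (\<Prod>j\<in>UNIV. deriv_power (\<beta> j) (\<alpha> j + \<delta> j) (z $ j))" for \<alpha> \<beta>
  proof -
    have "(\<integral>w. symbol_term c w w (\<alpha>, \<beta>) * ?M w \<partial>gauss) =
      (\<integral>w. c (case_sum \<alpha> \<beta>) / of_real (sqrt (mi_fact \<alpha>) * sqrt (mi_fact \<beta>)) *
        (mi_power w (\<alpha> + \<delta>) * mi_power (cnj_vec w) \<beta> * exp (herm z w)) \<partial>gauss)"
      unfolding symbol_term_eq mi_power_add
      by (intro Bochner_Integration.integral_cong refl) (simp add: mi_power_def[of _ 0] mult_ac)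
    then show ?thesis
      by (simp only: integral_mult_right_zero integral_gauss_monomial plus_fun_apply)
  qed
  then have 1: "(\<lambda>p. \<integral>w. symbol_term c w w p * ?M w \<partial>gauss) =
    (\<lambda>(\<alpha>, \<beta>). c (case_sum \<alpha> \<beta>) / of_real (sqrt (mi_fact \<alpha>) * sqrt (mi_fact \<beta>)) *
      (\<Prod>j\<in>UNIV. deriv_power (\<beta> j) (\<alpha> j + \<delta> j) (z $ j)))"
    by (simp only: fun_eq_iff split_paired_All prod.case simp_thms)
  have 2: "(\<integral>w. a w w * ?M w \<partial>gauss) = Op_antiwick a (\<lambda>w. mi_power w \<delta>) z"
    by (simp add: Op_antiwick_def mi_power_in_polys mi_power_def[of _ 0] mult.assoc)
  show ?thesis
    using symbol_series_integral(2)[OF c a, of "\<lambda>w. w" 0 \<delta> 0 z] unfolding 1 2 by simp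
qed

lemma Op_wick_sum_mi_power:
  assumes "rapidly_decaying c" "is_symbol_series c a" "finite S"
  shows "Op_wick a (\<lambda>w. \<Sum>\<delta>\<in>S. k \<delta> * mi_power w \<delta>) z = (\<Sum>\<delta>\<in>S. k \<delta> * Op_wick a (\<lambda>w. mi_power w \<delta>) z)"
proof -
  have "(\<lambda>w. \<Sum>\<delta>\<in>S. k \<delta> * mi_power w \<delta>) \<in> polys"
    using assms(3) by (auto simp: polys_def)
  then have "Op_wick a (\<lambda>w. \<Sum>\<delta>\<in>S. k \<delta> * mi_power w \<delta>) z =
      (\<integral>w. (\<Sum>\<delta>\<in>S. k \<delta> * (a z w * mi_power w \<delta> * exp (herm z w))) \<partial>gauss)"
    by (simp add: Op_wick_def sum_distrib_left sum_distrib_right mult_ac)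
  also have "\<dots> = (\<Sum>\<delta>\<in>S. k \<delta> * (\<integral>w. a z w * mi_power w \<delta> * exp (herm z w) \<partial>gauss))"
    by (subst Bochner_Integration.integral_sum)
      (auto intro!: integrable_mult_right integrable_Op_wick[OF assms(1,2)] mi_power_in_polys)
  finally show ?thesis
    by (simp add: Op_wick_def mi_power_in_polys)
qed

lemma Op_antiwick_sum_mi_power:
  assumes "rapidly_decaying c" "is_symbol_series c a" "finite S"
  shows "Op_antiwick a (\<lambda>w. \<Sum>\<delta>\<in>S. k \<delta> * mi_power w \<delta>) z = (\<Sum>\<delta>\<in>S. k \<delta> * Op_antiwick a (\<lambda>w. mi_power w \<delta>) z)"
proof -
  have "(\<lambda>w. \<Sum>\<delta>\<in>S. k \<delta> * mi_power w \<delta>) \<in> polys"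
    using assms(3) by (auto simp: polys_def)
  then have "Op_antiwick a (\<lambda>w. \<Sum>\<delta>\<in>S. k \<delta> * mi_power w \<delta>) z =
      (\<integral>w. (\<Sum>\<delta>\<in>S. k \<delta> * (a w w * mi_power w \<delta> * exp (herm z w))) \<partial>gauss)"
    by (simp add: Op_antiwick_def sum_distrib_left sum_distrib_right mult_ac)
  also have "\<dots> = (\<Sum>\<delta>\<in>S. k \<delta> * (\<integral>w. a w w * mi_power w \<delta> * exp (herm z w) \<partial>gauss))"
    by (subst Bochner_Integration.integral_sum)
      (auto intro!: integrable_mult_right integrable_Op_antiwick[OF assms(1,2)] mi_power_in_polys)
  finally show ?thesis
    by (simp add: Op_antiwick_def mi_power_in_polys)
qed

subsection \<open>Anti-Wick operators as Wick operators\<close>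

text \<open>On coefficients the Leibniz rule for x^a x^n is the Vandermonde identity: k derivatives
  fall on x^a and b - k on x^n.\<close>

lemma deriv_power_Leibniz:
  "deriv_power b (a + n) x =
    (\<Sum>k\<le>min a b. of_nat (fact k * (a choose k) * (b choose k)) * x ^ (a - k) * deriv_power (b - k) n x)"
proof -
  have term_eq: "of_nat (fact b * ((a choose k) * (n choose (b - k)))) * x ^ (a + n - b) =
      of_nat (fact k * (a choose k) * (b choose k)) * x ^ (a - k) * deriv_power (b - k) n x" if "k \<le> b" for k
  proof (cases "k \<le> a \<and> b - k \<le> n")
    case True
    then have "a + n - b = (a - k) + (n - (b - k))"
      using that by auto
    moreover have "fact b = fact k * fact (b - k) * (b choose k)"
      using that by (simp add: binomial_fact_lemma)
    ultimately show ?thesis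
      by (simp add: deriv_power_def power_add mult_ac)
  \<comment> \<open>If k > a or b - k > n, a binomial on each side vanishes, and the truncated
    exponents do not matter.\<close>
  next
    case False
    then have "(a choose k) * (n choose (b - k)) = 0"
      by (auto simp: not_le)
    then show ?thesis
      by (auto simp: deriv_power_def)
  qed
  have "fact b * ((a + n) choose b) = (\<Sum>k\<le>b. fact b * ((a choose k) * (n choose (b - k))))"
    by (simp add: vandermonde[symmetric] sum_distrib_left)
  then have "deriv_power b (a + n) x =
      (\<Sum>k\<le>b. of_nat (fact b * ((a choose k) * (n choose (b - k)))) * x ^ (a + n - b))"
    unfolding deriv_power_def by (simp only: of_nat_sum sum_distrib_right)
  also have "\<dots> = (\<Sum>k\<le>b. of_nat (fact k * (a choose k) * (b choose k)) * x ^ (a - k) * deriv_power (b - k) n x)"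
    by (intro sum.cong refl term_eq) auto
  \<comment> \<open>Cutting at \<open>min a b\<close> makes the range symmetric, so that in several
    variables it becomes \<kappa> \<le> \<alpha> and \<kappa> \<le> \<beta>.\<close>
  also have "\<dots> = (\<Sum>k\<le>min a b. of_nat (fact k * (a choose k) * (b choose k)) * x ^ (a - k) * deriv_power (b - k) n x)"
    by (rule sum.mono_neutral_right) auto
  finally show ?thesis .
qed

text \<open>Crude, but uniform in the order b of the derivative, over which the series is
  summed.\<close>

lemma norm_deriv_power_le: "norm (deriv_power b n x) \<le> fact n * (1 + norm x) ^ n"
proof (cases "b \<le> n")
  case True
  have "fact b * (n choose b) \<le> (fact n :: nat)"
    using binomial_fact_lemma[OF True] by (metis dvd_triv_right fact_nonzero dvd_imp_le fact_gt_zero mult.assoc mult.commute)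
  then have "real (fact b * (n choose b)) \<le> fact n"
    by (metis of_nat_fact of_nat_le_iff)
  moreover have "norm x ^ (n - b) \<le> (1 + norm x) ^ n"
  proof -
    have "norm x ^ (n - b) \<le> (1 + norm x) ^ (n - b)"
      by (intro power_mono) auto
    also have "\<dots> \<le> (1 + norm x) ^ n"
      by (intro power_increasing) auto
    finally show ?thesis .
  qed
  ultimately show ?thesis
    unfolding deriv_power_def norm_mult norm_power norm_of_nat by (intro mult_mono) auto
qed (simp add: deriv_power_def not_le binomial_eq_0)

lemma mi_fact_binomial:
  assumes "\<kappa> \<le> \<alpha>"
  shows "(\<Prod>j\<in>UNIV. real (\<alpha> j choose \<kappa> j)) = mi_fact \<alpha> / (mi_fact \<kappa> * mi_fact (\<alpha> - \<kappa>))"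
proof -
  have "real (\<alpha> j choose \<kappa> j) = fact (\<alpha> j) / (fact (\<kappa> j) * fact (\<alpha> j - \<kappa> j))" for j
    using assms by (simp add: le_fun_def binomial_fact)
  then show ?thesis
    by (simp add: mi_fact_def prod_dividef prod.distrib)
qed

text \<open>The normal ordering of \<open>\<partial>\<^sup>\<beta>z\<^sup>\<alpha>\<close>, applied to \<open>z\<^sup>\<delta>\<close>.\<close>

lemma deriv_power_normal_ordering:
  fixes \<alpha> \<beta> \<delta> :: "'d::finite \<Rightarrow> nat"
  shows "(\<Prod>j\<in>UNIV. deriv_power (\<beta> j) (\<alpha> j + \<delta> j) (z $ j)) =
    (\<Sum>\<kappa> | \<kappa> \<le> \<alpha> \<and> \<kappa> \<le> \<beta>. of_real (mi_fact \<alpha> * mi_fact \<beta> / (mi_fact \<kappa> * mi_fact (\<alpha> - \<kappa>) * mi_fact (\<beta> - \<kappa>))) *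
      (mi_power z (\<alpha> - \<kappa>) * (\<Prod>j\<in>UNIV. deriv_power ((\<beta> - \<kappa>) j) (\<delta> j) (z $ j))))"
proof -
  have set_eq: "{\<kappa>. \<kappa> \<le> \<alpha> \<and> \<kappa> \<le> \<beta>} = PiE UNIV (\<lambda>j. {..min (\<alpha> j) (\<beta> j)})"
    by (auto simp: le_fun_def PiE_UNIV_domain)
  have "(\<Prod>j\<in>UNIV. deriv_power (\<beta> j) (\<alpha> j + \<delta> j) (z $ j)) =
    (\<Sum>\<kappa> | \<kappa> \<le> \<alpha> \<and> \<kappa> \<le> \<beta>. \<Prod>j\<in>UNIV. of_nat (fact (\<kappa> j) * (\<alpha> j choose \<kappa> j) * (\<beta> j choose \<kappa> j)) *
      (z $ j) ^ (\<alpha> j - \<kappa> j) * deriv_power (\<beta> j - \<kappa> j) (\<delta> j) (z $ j))"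
    unfolding set_eq deriv_power_Leibniz by (rule prod_sum_PiE) auto
  also have "\<dots> = (\<Sum>\<kappa> | \<kappa> \<le> \<alpha> \<and> \<kappa> \<le> \<beta>.
      of_real (mi_fact \<alpha> * mi_fact \<beta> / (mi_fact \<kappa> * mi_fact (\<alpha> - \<kappa>) * mi_fact (\<beta> - \<kappa>))) *
      (mi_power z (\<alpha> - \<kappa>) * (\<Prod>j\<in>UNIV. deriv_power ((\<beta> - \<kappa>) j) (\<delta> j) (z $ j))))"
  proof (rule sum.cong[OF refl], safe)
    fix \<kappa> assume \<kappa>: "\<kappa> \<le> \<alpha>" "\<kappa> \<le> \<beta>"
    have "(\<Prod>j\<in>UNIV. of_nat (fact (\<kappa> j) * (\<alpha> j choose \<kappa> j) * (\<beta> j choose \<kappa> j)) :: complex) =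
        of_real ((\<Prod>j\<in>UNIV. fact (\<kappa> j)) * (\<Prod>j\<in>UNIV. real (\<alpha> j choose \<kappa> j)) * (\<Prod>j\<in>UNIV. real (\<beta> j choose \<kappa> j)))"
      by (simp add: prod.distrib)
    also have "(\<Prod>j\<in>UNIV. fact (\<kappa> j)) * (\<Prod>j\<in>UNIV. real (\<alpha> j choose \<kappa> j)) * (\<Prod>j\<in>UNIV. real (\<beta> j choose \<kappa> j)) =
        mi_fact \<alpha> * mi_fact \<beta> / (mi_fact \<kappa> * mi_fact (\<alpha> - \<kappa>) * mi_fact (\<beta> - \<kappa>))"
      by (simp add: mi_fact_binomial \<kappa> mi_fact_def[of \<kappa>, symmetric])
    finally show "(\<Prod>j\<in>UNIV. of_nat (fact (\<kappa> j) * (\<alpha> j choose \<kappa> j) * (\<beta> j choose \<kappa> j)) *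
      (z $ j) ^ (\<alpha> j - \<kappa> j) * deriv_power (\<beta> j - \<kappa> j) (\<delta> j) (z $ j)) =
      of_real (mi_fact \<alpha> * mi_fact \<beta> / (mi_fact \<kappa> * mi_fact (\<alpha> - \<kappa>) * mi_fact (\<beta> - \<kappa>))) *
      (mi_power z (\<alpha> - \<kappa>) * (\<Prod>j\<in>UNIV. deriv_power ((\<beta> - \<kappa>) j) (\<delta> j) (z $ j)))"
      by (simp only: prod.distrib mi_power_def minus_apply mult.assoc)
  qed
  finally show ?thesis .
qed

text \<open>Both values are iterated sums of one absolutely convergent series over
  (\<alpha>,\<beta>,\<kappa>). Summing over \<kappa> with (\<alpha>,\<beta>) fixed produces the
  shifted coefficients, hence the Wick side. Summing over \<kappa> with
  (\<alpha>+\<kappa>,\<beta>+\<kappa>) fixed is a finite sum, evaluated by normal ordering to the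
  anti-Wick side.\<close>

lemma Op_antiwick_mi_power_eq_Op_wick:
  fixes c :: "('d::finite + 'd \<Rightarrow> nat) \<Rightarrow> complex"
  assumes c: "rapidly_decaying c" and a: "is_symbol_series c a"
    and Tc: "rapidly_decaying (wick_shift 1 c)" and b: "is_symbol_series (wick_shift 1 c) b"
  shows "Op_antiwick a (\<lambda>w. mi_power w \<delta>) z = Op_wick b (\<lambda>w. mi_power w \<delta>) z"
proof -
  define P where "P \<beta> = (\<Prod>j\<in>UNIV. deriv_power (\<beta> j) (\<delta> j) (z $ j))" for \<beta>
  define Q where "Q \<alpha> \<beta> = mi_power z \<alpha> * P \<beta> / of_real (sqrt (mi_fact \<alpha>) * sqrt (mi_fact \<beta>))" for \<alpha> \<beta>
  define G where "G = (\<lambda>((\<alpha>, \<beta>), \<kappa>). of_real (shift_coeff (case_sum \<alpha> \<beta>) \<kappa>) * c (case_sum \<alpha> \<beta> + diag \<kappa>) * Q \<alpha> \<beta>)"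
  \<comment> \<open>The rate 1/8 pays for 2^n from \<open>shift_coeff\<close> and for 2^|\<alpha>|
    from \<open>Q\<close>, leaving 1/2.\<close>
  obtain C where C: "C \<ge> 0" "\<And>\<nu>. norm (c \<nu>) \<le> C * (1 / 8) ^ mi_abs \<nu>"
    using rapidly_decayingE[OF c, of 8] by auto
  define D where "D = (\<Prod>j\<in>UNIV. fact (\<delta> j) * (1 + norm (z $ j)) ^ \<delta> j)"
  define E where "E = exp ((norm z)\<^sup>2 / 8) * D"
  have P: "norm (P \<beta>) \<le> D" for \<beta>
    unfolding P_def D_def prod_norm[symmetric] by (intro prod_mono conjI norm_deriv_power_le) auto
  have "D \<ge> 0"
    unfolding D_def by (intro prod_nonneg) auto
  then have E0: "E \<ge> 0"
    by (simp add: E_def)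
  have Q: "norm (Q \<alpha> \<beta>) \<le> 2 ^ mi_abs \<alpha> * E" for \<alpha> \<beta>
  proof -
    \<comment> \<open>The bound on \<open>P\<close> is uniform in \<beta>, so the factor
      1/sqrt(\<beta>!) is simply estimated by 1.\<close>
    have "norm (P \<beta> / of_real (sqrt (mi_fact \<beta>))) \<le> norm (P \<beta>)"
      using mi_fact_ge_1[of \<beta>] divide_left_mono[of 1 "sqrt (mi_fact \<beta>)" "norm (P \<beta>)"]
      by (simp add: norm_divide)
    with P[of \<beta>] have 1: "norm (P \<beta> / of_real (sqrt (mi_fact \<beta>))) \<le> D"
      by linarith
    have "norm (Q \<alpha> \<beta>) = norm (mono_e \<alpha> z) * norm (P \<beta> / of_real (sqrt (mi_fact \<beta>)))"
      by (simp add: Q_def mono_e_def norm_mult norm_divide)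
    also have "\<dots> \<le> 2 ^ mi_abs \<alpha> * exp ((norm z)\<^sup>2 / 8) * D"
      by (intro mult_mono norm_mono_e_le 1) auto
    finally show ?thesis
      by (simp add: E_def mult.assoc)
  qed
  have "(\<lambda>p. norm (G p)) summable_on UNIV"
  proof (rule summable_on_comparison_test)
    show "(\<lambda>p :: (('d \<Rightarrow> nat) \<times> ('d \<Rightarrow> nat)) \<times> ('d \<Rightarrow> nat).
        C * E * (case p of (q, \<kappa>) \<Rightarrow>
        (case q of (\<alpha>, \<beta>) \<Rightarrow> (1 / 2) ^ mi_abs \<alpha> * (1 / 2) ^ mi_abs \<beta>) * (1 / 2) ^ mi_abs \<kappa>)) summable_on UNIV"
      using summable_on_product_nonneg[OF summable_on_geometric_mi_pair[of "1/2", where 'm = 'd and 'n = 'd]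
          summable_on_geometric_mi[of "1/2", where 'n = 'd]]
      by (intro summable_on_cmult_right) (simp add: case_prod_unfold)
    fix p :: "(('d \<Rightarrow> nat) \<times> ('d \<Rightarrow> nat)) \<times> ('d \<Rightarrow> nat)"
    obtain \<alpha> \<beta> \<kappa> where p: "p = ((\<alpha>, \<beta>), \<kappa>)"
      by (cases p) auto
    define n where "n = mi_abs (case_sum \<alpha> \<beta> + diag \<kappa>)"
    have "norm (G p) \<le> 2 ^ n * (C * (1 / 8) ^ n) * (2 ^ mi_abs \<alpha> * E)"
      unfolding G_def p prod.case norm_mult n_def
      by (intro mult_mono C(2) Q) (use C(1) in \<open>auto simp: shift_coeff_le simp del: mi_abs_add\<close>)
    also have "\<dots> \<le> 2 ^ n * (C * (1 / 8) ^ n) * (2 ^ n * E)"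
      using C(1) E0 by (intro mult_left_mono mult_right_mono power_increasing) (auto simp: n_def)
    also have "\<dots> = C * E * (2 ^ n * (1 / 8) ^ n * 2 ^ n)"
      by (simp only: mult_ac)
    also have "2 ^ n * (1 / 8) ^ n * 2 ^ n = (1 / 2 :: real) ^ n"
      unfolding power_mult_distrib[symmetric] by simp
    also have "C * E * (1 / 2) ^ n \<le> C * E * (1 / 2) ^ (mi_abs \<alpha> + mi_abs \<beta> + mi_abs \<kappa>)"
      using C(1) E0 by (intro mult_left_mono power_decreasing) (auto simp: n_def)
    finally show "norm (G p) \<le> C * E * (case p of (q, \<kappa>) \<Rightarrow>
        (case q of (\<alpha>, \<beta>) \<Rightarrow> (1 / 2) ^ mi_abs \<alpha> * (1 / 2) ^ mi_abs \<beta>) * (1 / 2) ^ mi_abs \<kappa>)"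
      by (simp add: p power_add)
  qed auto
  then have "G summable_on UNIV"
    by (rule abs_summable_summable)
  then obtain S where S: "(G has_sum S) UNIV"
    by (auto simp: summable_on_def)
  have "((\<lambda>(\<alpha>, \<beta>). wick_shift 1 c (case_sum \<alpha> \<beta>) * Q \<alpha> \<beta>) has_sum S) UNIV"
  proof (rule has_sum_SigmaD)
    show "(G has_sum S) (Sigma UNIV (\<lambda>_. UNIV))"
      using S by simp
    fix q :: "('d \<Rightarrow> nat) \<times> ('d \<Rightarrow> nat)"
    obtain \<alpha> \<beta> where q: "q = (\<alpha>, \<beta>)"
      by (cases q)
    show "((\<lambda>\<kappa>. G (q, \<kappa>)) has_sum (case q of (\<alpha>, \<beta>) \<Rightarrow> wick_shift 1 c (case_sum \<alpha> \<beta>) * Q \<alpha> \<beta>)) UNIV"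
      using has_sum_cmult_left[OF wick_shift_has_sum[OF c, of 1 "case_sum \<alpha> \<beta>"], of "Q \<alpha> \<beta>"]
      by (simp add: G_def q)
  qed
  moreover have "((\<lambda>(\<alpha>, \<beta>). wick_shift 1 c (case_sum \<alpha> \<beta>) * Q \<alpha> \<beta>) has_sum Op_wick b (\<lambda>w. mi_power w \<delta>) z) UNIV"
    using Op_wick_mi_power_has_sum[OF Tc b, where \<delta> = \<delta> and z = z] by (simp add: Q_def P_def)
  ultimately have 1: "Op_wick b (\<lambda>w. mi_power w \<delta>) z = S"
    using has_sum_unique by blast
  \<comment> \<open>Now (\<alpha>,\<beta>) denotes the index after the shift, the one at which
    \<open>c\<close> is evaluated.\<close>
  have "(G has_sum S) UNIV \<longleftrightarrow> ((\<lambda>((\<alpha>, \<beta>), \<kappa>). G ((\<alpha> - \<kappa>, \<beta> - \<kappa>), \<kappa>)) has_sum S)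
      (Sigma UNIV (\<lambda>(\<alpha>, \<beta>). {\<kappa>. \<kappa> \<le> \<alpha> \<and> \<kappa> \<le> \<beta>}))"
    by (rule has_sum_reindex_bij_witness[of _ "\<lambda>((\<alpha>, \<beta>), \<kappa>). ((\<alpha> - \<kappa>, \<beta> - \<kappa>), \<kappa>)" "\<lambda>((\<alpha>, \<beta>), \<kappa>). ((\<alpha> + \<kappa>, \<beta> + \<kappa>), \<kappa>)"])
      (auto simp: mi_le_add_diff add.commute[of "_ - _"])
  with S have "((\<lambda>((\<alpha>, \<beta>), \<kappa>). G ((\<alpha> - \<kappa>, \<beta> - \<kappa>), \<kappa>)) has_sum S)
      (Sigma UNIV (\<lambda>(\<alpha>, \<beta>). {\<kappa>. \<kappa> \<le> \<alpha> \<and> \<kappa> \<le> \<beta>}))"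
    by simp
  then have "((\<lambda>(\<alpha>, \<beta>). c (case_sum \<alpha> \<beta>) / of_real (sqrt (mi_fact \<alpha>) * sqrt (mi_fact \<beta>)) *
      (\<Prod>j\<in>UNIV. deriv_power (\<beta> j) (\<alpha> j + \<delta> j) (z $ j))) has_sum S) UNIV"
  proof (rule has_sum_SigmaD)
    fix q :: "('d \<Rightarrow> nat) \<times> ('d \<Rightarrow> nat)"
    obtain \<alpha> \<beta> where q: "q = (\<alpha>, \<beta>)"
      by (cases q)
    have G: "G ((\<alpha> - \<kappa>, \<beta> - \<kappa>), \<kappa>) = c (case_sum \<alpha> \<beta>) / of_real (sqrt (mi_fact \<alpha>) * sqrt (mi_fact \<beta>)) *
      (of_real (mi_fact \<alpha> * mi_fact \<beta> / (mi_fact \<kappa> * mi_fact (\<alpha> - \<kappa>) * mi_fact (\<beta> - \<kappa>))) *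
      (mi_power z (\<alpha> - \<kappa>) * P (\<beta> - \<kappa>)))" if \<kappa>: "\<kappa> \<le> \<alpha>" "\<kappa> \<le> \<beta>" for \<kappa>
    proof -
      have eq: "case_sum (\<alpha> - \<kappa>) (\<beta> - \<kappa>) + diag \<kappa> = case_sum \<alpha> \<beta>"
        using \<kappa> by (simp add: case_sum_add_diag mi_le_add_diff add.commute[of "_ - _"])
      have sq: "mi_fact \<gamma> = sqrt (mi_fact \<gamma>) * sqrt (mi_fact \<gamma>)" for \<gamma> :: "'d \<Rightarrow> nat"
        by simp
      have "shift_coeff (case_sum (\<alpha> - \<kappa>) (\<beta> - \<kappa>)) \<kappa> / (sqrt (mi_fact (\<alpha> - \<kappa>)) * sqrt (mi_fact (\<beta> - \<kappa>))) =
          sqrt (mi_fact \<alpha>) * sqrt (mi_fact \<beta>) / (mi_fact \<kappa> * mi_fact (\<alpha> - \<kappa>) * mi_fact (\<beta> - \<kappa>))"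
        by (simp add: shift_coeff_def eq mi_fact_case_sum mi_fact_diag real_sqrt_divide real_sqrt_mult)
          (simp add: field_simps)
      also have "\<dots> = mi_fact \<alpha> * mi_fact \<beta> / (mi_fact \<kappa> * mi_fact (\<alpha> - \<kappa>) * mi_fact (\<beta> - \<kappa>)) /
          (sqrt (mi_fact \<alpha>) * sqrt (mi_fact \<beta>))"
        by (simp add: field_simps)
      finally have *: "(of_real (shift_coeff (case_sum (\<alpha> - \<kappa>) (\<beta> - \<kappa>)) \<kappa> /
          (sqrt (mi_fact (\<alpha> - \<kappa>)) * sqrt (mi_fact (\<beta> - \<kappa>)))) :: complex) =
          of_real (mi_fact \<alpha> * mi_fact \<beta> / (mi_fact \<kappa> * mi_fact (\<alpha> - \<kappa>) * mi_fact (\<beta> - \<kappa>)) /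
          (sqrt (mi_fact \<alpha>) * sqrt (mi_fact \<beta>)))"
        by (rule arg_cong)
      have "G ((\<alpha> - \<kappa>, \<beta> - \<kappa>), \<kappa>) = of_real (shift_coeff (case_sum (\<alpha> - \<kappa>) (\<beta> - \<kappa>)) \<kappa> /
          (sqrt (mi_fact (\<alpha> - \<kappa>)) * sqrt (mi_fact (\<beta> - \<kappa>)))) *
          c (case_sum \<alpha> \<beta>) * (mi_power z (\<alpha> - \<kappa>) * P (\<beta> - \<kappa>))"
        by (simp add: G_def Q_def eq)
      then show ?thesis
        unfolding * by (simp add: mult_ac)
    qed
    have fin: "finite {\<kappa>. \<kappa> \<le> \<alpha> \<and> \<kappa> \<le> \<beta>}"
      by (rule finite_subset[OF _ finite_mi_le[of \<alpha>]]) auto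
    have "(\<Sum>\<kappa> | \<kappa> \<le> \<alpha> \<and> \<kappa> \<le> \<beta>. G ((\<alpha> - \<kappa>, \<beta> - \<kappa>), \<kappa>)) =
        c (case_sum \<alpha> \<beta>) / of_real (sqrt (mi_fact \<alpha>) * sqrt (mi_fact \<beta>)) *
      (\<Prod>j\<in>UNIV. deriv_power (\<beta> j) (\<alpha> j + \<delta> j) (z $ j))"
      unfolding deriv_power_normal_ordering sum_distrib_left P_def[symmetric]
      by (intro sum.cong refl G) auto
    then show "((\<lambda>\<kappa>. (\<lambda>((\<alpha>, \<beta>), \<kappa>). G ((\<alpha> - \<kappa>, \<beta> - \<kappa>), \<kappa>)) (q, \<kappa>)) has_sum
      (case q of (\<alpha>, \<beta>) \<Rightarrow> c (case_sum \<alpha> \<beta>) / of_real (sqrt (mi_fact \<alpha>) * sqrt (mi_fact \<beta>)) *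
      (\<Prod>j\<in>UNIV. deriv_power (\<beta> j) (\<alpha> j + \<delta> j) (z $ j)))) (case q of (\<alpha>, \<beta>) \<Rightarrow> {\<kappa>. \<kappa> \<le> \<alpha> \<and> \<kappa> \<le> \<beta>})"
      unfolding q prod.case by (intro has_sum_finiteI[OF fin]) (rule sym)
  qed
  with Op_antiwick_mi_power_has_sum[OF c a, where \<delta> = \<delta> and z = z] have "Op_antiwick a (\<lambda>w. mi_power w \<delta>) z = S"
    using has_sum_unique by blast
  with 1 show ?thesis
    by simp
qed

lemma Op_antiwick_eq_Op_wick:
  assumes c: "rapidly_decaying c" and a: "is_symbol_series c a"
    and Tc: "rapidly_decaying (wick_shift 1 c)" and b: "is_symbol_series (wick_shift 1 c) b"
  shows "Op_antiwick a = Op_wick b"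
proof (intro ext)
  fix F z
  show "Op_antiwick a F z = Op_wick b F z"
  proof (cases "F \<in> polys")
    case True
    then obtain S k where "finite S" "F = (\<lambda>z. \<Sum>\<delta>\<in>S. k \<delta> * mi_power z \<delta>)"
      by (auto simp: polys_def)
    then show ?thesis
      by (simp add: Op_antiwick_sum_mi_power[OF c a] Op_wick_sum_mi_power[OF Tc b]
          Op_antiwick_mi_power_eq_Op_wick[OF c a Tc b])
  qed (simp add: Op_antiwick_def Op_wick_def)
qed

text \<open>Pairing the series with the Gaussian moments extracts its coefficients.\<close>

lemma mono_e_series_eq_0:
  fixes f :: "('d::finite \<Rightarrow> nat) \<Rightarrow> complex"
  assumes f: "\<And>R. R > 0 \<Longrightarrow> \<exists>C. \<forall>\<alpha>. norm (f \<alpha>) * R ^ mi_abs \<alpha> \<le> C"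
    and sum: "\<And>z. ((\<lambda>\<alpha>. f \<alpha> * mono_e \<alpha> z) has_sum 0) UNIV"
  shows "f \<gamma> = 0"
proof -
  \<comment> \<open>The series in z alone is read as a symbol with coefficients concentrated on
    \<beta> = 0, so the termwise integration of symbol series applies to it.\<close>
  define c :: "('d + 'd \<Rightarrow> nat) \<Rightarrow> complex" where "c \<nu> = (if \<nu> \<circ> Inr = 0 then f (\<nu> \<circ> Inl) else 0)" for \<nu>
  have inl: "case_sum \<alpha> \<beta> \<circ> Inl = \<alpha>" and inr: "case_sum \<alpha> \<beta> \<circ> Inr = \<beta>" for \<alpha> \<beta> :: "'d \<Rightarrow> nat"
    by (auto simp: fun_eq_iff)
  have c_eq: "c (case_sum \<alpha> \<beta>) = (if \<beta> = 0 then f \<alpha> else 0)" for \<alpha> \<beta>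
    by (simp add: c_def inl inr)
  have abs0: "mi_abs (0 :: 'd \<Rightarrow> nat) = 0"
    by (simp add: mi_abs_def)
  have c: "rapidly_decaying c"
    unfolding rapidly_decaying_def
  proof (intro allI impI)
    fix R :: real assume "R > 0"
    then obtain C where C: "\<And>\<alpha>. norm (f \<alpha>) * R ^ mi_abs \<alpha> \<le> C"
      using f by blast
    have "C \<ge> 0"
      using C[of 0] by (auto simp: abs0 intro: order.trans[OF norm_ge_zero])
    have "norm (c \<nu>) * R ^ mi_abs \<nu> \<le> C" for \<nu>
    proof -
      define \<alpha> where "\<alpha> = \<nu> \<circ> Inl"
      define \<beta> where "\<beta> = \<nu> \<circ> Inr"
      have "\<nu> = case_sum \<alpha> \<beta>"
        by (auto simp: \<alpha>_def \<beta>_def fun_eq_iff split: sum.split)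
      then show ?thesis
        using C[of \<alpha>] \<open>C \<ge> 0\<close> by (simp add: c_eq abs0)
    qed
    then show "\<exists>C. \<forall>\<nu>. norm (c \<nu>) * R ^ mi_abs \<nu> \<le> C"
      by blast
  qed
  have c0: "is_symbol_series c (\<lambda>_ _. 0)"
    unfolding is_symbol_series_def
  proof (intro allI)
    fix z w :: "complex ^ 'd"
    have "((\<lambda>\<alpha>. f \<alpha> * mono_e \<alpha> z) has_sum 0) UNIV \<longleftrightarrow>
      ((\<lambda>(\<alpha>, \<beta>). c (case_sum \<alpha> \<beta>) * mono_e \<alpha> z * mono_e \<beta> (cnj_vec w)) has_sum 0) (range (\<lambda>\<alpha>. (\<alpha>, 0)))"
      by (rule has_sum_reindex_bij_witness[of _ fst "\<lambda>\<alpha>. (\<alpha>, 0)"])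
        (auto simp: c_eq mono_e_def[of 0] mi_power_def[of _ 0] mi_fact_def)
    also have "\<dots> \<longleftrightarrow> ((\<lambda>(\<alpha>, \<beta>). c (case_sum \<alpha> \<beta>) * mono_e \<alpha> z * mono_e \<beta> (cnj_vec w)) has_sum 0) UNIV"
      by (rule has_sum_cong_neutral) (auto simp: c_eq image_iff)
    finally show "((\<lambda>(\<alpha>, \<beta>). c (case_sum \<alpha> \<beta>) * mono_e \<alpha> z * mono_e \<beta> (cnj_vec w)) has_sum 0) UNIV"
      using sum by blast
  qed
  let ?g = "\<lambda>p :: ('d \<Rightarrow> nat) \<times> ('d \<Rightarrow> nat).
    if p = (\<gamma>, 0) then f \<gamma> / of_real (sqrt (mi_fact \<gamma>)) * of_real (mi_fact \<gamma>) else 0"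
  \<comment> \<open>The zero symbol is integrated against the conjugate of w^\<gamma>. With z = 0
    the exponential is 1, and the moments are the orthogonality relations of the monomials.\<close>
  from symbol_series_integral(2)[OF c c0, of "\<lambda>w. w" 0 0 \<gamma> 0]
  have "((\<lambda>p. \<integral>w. symbol_term c w w p * (mi_power w 0 * mi_power (cnj_vec w) \<gamma> * exp (herm 0 w)) \<partial>gauss)
      has_sum 0) UNIV"
    by simp
  also have "(\<lambda>p. \<integral>w. symbol_term c w w p * (mi_power w 0 * mi_power (cnj_vec w) \<gamma> * exp (herm 0 w)) \<partial>gauss) =
    ?g"
  proof
    fix p :: "('d \<Rightarrow> nat) \<times> ('d \<Rightarrow> nat)"
    obtain \<alpha> \<beta> where p: "p = (\<alpha>, \<beta>)"
      by (cases p)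
    have "(\<integral>w. symbol_term c w w p * (mi_power w 0 * mi_power (cnj_vec w) \<gamma> * exp (herm 0 w)) \<partial>gauss) =
      (\<integral>w. c (case_sum \<alpha> \<beta>) / of_real (sqrt (mi_fact \<alpha>) * sqrt (mi_fact \<beta>)) *
        (mi_power w \<alpha> * mi_power (cnj_vec w) (\<beta> + \<gamma>) * exp (herm 0 w)) \<partial>gauss)"
      unfolding p symbol_term_eq mi_power_add
      by (intro Bochner_Integration.integral_cong refl) (simp add: mi_power_def[of _ 0] mult_ac)
    also have "\<dots> = c (case_sum \<alpha> \<beta>) / of_real (sqrt (mi_fact \<alpha>) * sqrt (mi_fact \<beta>)) *
        (\<Prod>j\<in>UNIV. deriv_power (\<beta> j + \<gamma> j) (\<alpha> j) 0)"
      unfolding integral_mult_right_zero integral_gauss_monomial by simp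
    also have "\<dots> = ?g p"
    proof -
      \<comment> \<open>For n > k a positive power of 0 remains, and for n < k the binomial is
        0.\<close>
      have d: "deriv_power k n 0 = (if n = k then of_nat (fact k) else 0)" for k n
        by (auto simp: deriv_power_def power_0_left)
      show ?thesis
      proof (cases "\<beta> = 0 \<and> \<alpha> \<noteq> \<gamma>")
        case True
        then obtain j where "\<alpha> j \<noteq> \<gamma> j"
          by (auto simp: fun_eq_iff)
        then have "(\<Prod>j\<in>UNIV. deriv_power (\<beta> j + \<gamma> j) (\<alpha> j) 0) = 0"
          using True by (intro prod_zero bexI[of _ j]) (auto simp: d)
        with True show ?thesis
          by (auto simp: p)
      next
        case False
        then show ?thesis
          by (auto simp: p c_eq d mi_fact_def)
      qed
    qed
    finally show "(\<integral>w. symbol_term c w w p * (mi_power w 0 * mi_power (cnj_vec w) \<gamma> * exp (herm 0 w)) \<partial>gauss) =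
      ?g p" .
  qed
  finally have 0: "(?g has_sum 0) UNIV" .
  have "(?g has_sum
      f \<gamma> / of_real (sqrt (mi_fact \<gamma>)) * of_real (mi_fact \<gamma>)) UNIV"
    by (rule has_sum_finite_neutralI[of "{(\<gamma>, 0)}"]) auto
  with 0 have "f \<gamma> / of_real (sqrt (mi_fact \<gamma>)) * of_real (mi_fact \<gamma>) = 0"
    using has_sum_unique by blast
  then show ?thesis
    by simp
qed

text \<open>Applied to \<open>z\<^sup>\<delta>\<close>, the operator only sees the coefficients \<open>c(\<alpha>,\<beta>)\<close> with \<open>\<beta> \<le> \<delta>\<close>, so these are
  determined recursively.\<close>

lemma Op_wick_inject:
  fixes c c' :: "('d::finite + 'd \<Rightarrow> nat) \<Rightarrow> complex"
  assumes c: "rapidly_decaying c" "is_symbol_series c a"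
    and c': "rapidly_decaying c'" "is_symbol_series c' a'"
    and eq: "Op_wick a = Op_wick a'"
  shows "c = c'"
proof -
  define f where "f \<nu> = c \<nu> - c' \<nu>" for \<nu>
  have f: "rapidly_decaying f"
    unfolding f_def by (intro rapidly_decaying_diff c c')
  have sum: "((\<lambda>(\<alpha>, \<beta>). f (case_sum \<alpha> \<beta>) / of_real (sqrt (mi_fact \<alpha>) * sqrt (mi_fact \<beta>)) *
      (mi_power z \<alpha> * (\<Prod>j\<in>UNIV. deriv_power (\<beta> j) (\<delta> j) (z $ j)))) has_sum 0) UNIV" for \<delta> z
    using has_sum_add[OF Op_wick_mi_power_has_sum[OF c, where \<delta> = \<delta> and z = z]
        has_sum_cmult_right[OF Op_wick_mi_power_has_sum[OF c', where \<delta> = \<delta> and z = z], of "- 1"]]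
    by (simp add: f_def eq case_prod_unfold diff_divide_distrib left_diff_distrib)
  have "f (case_sum \<alpha> \<delta>) = 0" for \<alpha> \<delta>
  proof (induction "mi_abs \<delta>" arbitrary: \<alpha> \<delta> rule: less_induct)
    case less
    \<comment> \<open>Either \<beta> \<le> \<delta> has smaller degree and the induction hypothesis
      removes the coefficient, or some order of differentiation exceeds the power it acts
      on.\<close>
    have zero: "f (case_sum \<alpha> \<beta>) * (\<Prod>j\<in>UNIV. deriv_power (\<beta> j) (\<delta> j) (z $ j)) = 0" if "\<beta> \<noteq> \<delta>" for \<alpha> \<beta> z
    proof (cases "\<beta> \<le> \<delta>")
      case True
      with that obtain j where "\<beta> j < \<delta> j"
        by (metis antisym le_fun_def not_le)
      then have "mi_abs \<beta> < mi_abs \<delta>"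
        unfolding mi_abs_def using True by (intro sum_strict_mono_ex1) (auto simp: le_fun_def)
      then show ?thesis
        using less by simp
    next
      case False
      then obtain j where "\<beta> j > \<delta> j"
        by (auto simp: le_fun_def not_le)
      then have "(\<Prod>j\<in>UNIV. deriv_power (\<beta> j) (\<delta> j) (z $ j)) = 0"
        by (intro prod_zero bexI[of _ j]) (auto simp: deriv_power_def)
      then show ?thesis
        by simp
    qed
    have K: "(\<Prod>j\<in>UNIV. deriv_power (\<delta> j) (\<delta> j) (z $ j)) = of_real (mi_fact \<delta>)" for z
      by (simp add: deriv_power_def mi_fact_def)
    have "((\<lambda>\<alpha>. f (case_sum \<alpha> \<delta>) * mono_e \<alpha> z) has_sum 0) UNIV" for z
    proof -
      let ?t = "\<lambda>(\<alpha>, \<beta>). f (case_sum \<alpha> \<beta>) / of_real (sqrt (mi_fact \<alpha>) * sqrt (mi_fact \<beta>)) *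
        (mi_power z \<alpha> * (\<Prod>j\<in>UNIV. deriv_power (\<beta> j) (\<delta> j) (z $ j)))"
      have "(?t has_sum 0) UNIV \<longleftrightarrow> (?t has_sum 0) (range (\<lambda>\<alpha>. (\<alpha>, \<delta>)))"
      proof (rule has_sum_cong_neutral)
        fix p :: "('d \<Rightarrow> nat) \<times> ('d \<Rightarrow> nat)" assume "p \<in> UNIV - range (\<lambda>\<alpha>. (\<alpha>, \<delta>))"
        then obtain \<alpha> \<beta> where p: "p = (\<alpha>, \<beta>)" "\<beta> \<noteq> \<delta>"
          by (cases p) auto
        then show "?t p = 0"
          using zero[OF p(2), of \<alpha> z] by auto
      qed auto
      also have "\<dots> \<longleftrightarrow> ((\<lambda>\<alpha>. of_real (mi_fact \<delta> / sqrt (mi_fact \<delta>)) * (f (case_sum \<alpha> \<delta>) * mono_e \<alpha> z)) has_sum 0) UNIV"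
        by (rule has_sum_reindex_bij_witness[of _ "\<lambda>\<alpha>. (\<alpha>, \<delta>)" fst]) (auto simp: K mono_e_def mult_ac)
      finally have "((\<lambda>\<alpha>. of_real (mi_fact \<delta> / sqrt (mi_fact \<delta>)) * (f (case_sum \<alpha> \<delta>) * mono_e \<alpha> z)) has_sum 0) UNIV"
        using sum[where \<delta> = \<delta> and z = z] by blast
      from has_sum_cmult_right[OF this, of "inverse (of_real (mi_fact \<delta> / sqrt (mi_fact \<delta>)))"]
      show ?thesis
        by (simp add: field_simps)
    qed
    moreover have "\<exists>C. \<forall>\<alpha>. norm (f (case_sum \<alpha> \<delta>)) * R ^ mi_abs \<alpha> \<le> C" if R: "R > 0" for R
    proof -
      obtain C where C: "\<And>\<nu>. norm (f \<nu>) * R ^ mi_abs \<nu> \<le> C"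
        using f R by (auto simp: rapidly_decaying_def)
      have "norm (f (case_sum \<alpha> \<delta>)) * R ^ mi_abs \<alpha> \<le> C / R ^ mi_abs \<delta>" for \<alpha>
        using C[of "case_sum \<alpha> \<delta>"] R by (simp add: field_simps power_add)
      then show ?thesis
        by blast
    qed
    ultimately show ?case
      by (rule mono_e_series_eq_0[rotated])
  qed
  then have "c (case_sum \<alpha> \<beta>) = c' (case_sum \<alpha> \<beta>)" for \<alpha> \<beta>
    by (simp add: f_def)
  moreover have "\<nu> = case_sum (\<nu> \<circ> Inl) (\<nu> \<circ> Inr)" for \<nu> :: "'d + 'd \<Rightarrow> nat"
    by (auto simp: fun_eq_iff split: sum.split)
  ultimately show "c = c'"
    by (metis ext)
qed

text \<open>The analysis ends here: a coefficient space qualifies as soon as it is linear, rapidly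
  decaying and stable under the shifts. \<open>Op_antiwick\<close> is the injective
  \<open>Op_wick\<close> after \<open>wick_shift 1\<close>, and stability under
  \<open>wick_shift (-1)\<close> as well makes that shift a bijection of the space.\<close>

lemma linear_bijection_Op_antiwick:
  fixes X :: "(('d::finite + 'd \<Rightarrow> nat) \<Rightarrow> complex) set"
  assumes zero: "(\<lambda>_. 0) \<in> X"
    and add: "\<And>c c'. c \<in> X \<Longrightarrow> c' \<in> X \<Longrightarrow> (\<lambda>\<nu>. c \<nu> + c' \<nu>) \<in> X"
    and cmult: "\<And>k c. c \<in> X \<Longrightarrow> (\<lambda>\<nu>. k * c \<nu>) \<in> X"
    and rapid: "\<And>c. c \<in> X \<Longrightarrow> rapidly_decaying c"
    and shift: "\<And>t c. norm t = 1 \<Longrightarrow> c \<in> X \<Longrightarrow> wick_shift t c \<in> X"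
  shows "linear_bijection Op_antiwick {a. \<exists>c\<in>X. is_symbol_series c a}
    (Op_wick ` {a. \<exists>c\<in>X. is_symbol_series c a})"
proof -
  let ?V = "{a. \<exists>c\<in>X. is_symbol_series c a}"
  have V0: "(\<lambda>x y. 0) \<in> ?V"
    using zero is_symbol_series_0 by auto
  have Vadd: "(\<lambda>x y. a x y + b x y) \<in> ?V" if "a \<in> ?V" "b \<in> ?V" for a b
  proof -
    from that obtain c c' where "c \<in> X" "is_symbol_series c a" "c' \<in> X" "is_symbol_series c' b"
      by auto
    then show ?thesis
      by (intro CollectI bexI[of _ "\<lambda>\<nu>. c \<nu> + c' \<nu>"] is_symbol_series_add add)
  qed
  have Vcmult: "(\<lambda>x y. k * a x y) \<in> ?V" if "a \<in> ?V" for k a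
  proof -
    from that obtain c where "c \<in> X" "is_symbol_series c a"
      by auto
    then show ?thesis
      by (intro CollectI bexI[of _ "\<lambda>\<nu>. k * c \<nu>"] is_symbol_series_cmult cmult)
  qed
  have V: "csubspace2 ?V"
    unfolding csubspace2_def by (intro conjI ballI allI V0 Vadd Vcmult)
  have addW: "Op_wick (\<lambda>x y. a x y + b x y) = (\<lambda>u v. Op_wick a u v + Op_wick b u v)" if "a \<in> ?V" "b \<in> ?V" for a b
  proof -
    have "(\<integral>w. (a z w + b z w) * F w * exp (herm z w) \<partial>gauss) =
        (\<integral>w. a z w * F w * exp (herm z w) \<partial>gauss) + (\<integral>w. b z w * F w * exp (herm z w) \<partial>gauss)"
      if "F \<in> polys" for F z
      using that \<open>a \<in> ?V\<close> \<open>b \<in> ?V\<close> unfolding distrib_right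
      by (intro Bochner_Integration.integral_add) (auto intro: integrable_Op_wick rapid)
    then show ?thesis
      by (auto simp: Op_wick_def fun_eq_iff)
  qed
  have addA: "Op_antiwick (\<lambda>x y. a x y + b x y) = (\<lambda>u v. Op_antiwick a u v + Op_antiwick b u v)"
    if "a \<in> ?V" "b \<in> ?V" for a b
  proof -
    have "(\<integral>w. (a w w + b w w) * F w * exp (herm z w) \<partial>gauss) =
        (\<integral>w. a w w * F w * exp (herm z w) \<partial>gauss) + (\<integral>w. b w w * F w * exp (herm z w) \<partial>gauss)"
      if "F \<in> polys" for F z
      using that \<open>a \<in> ?V\<close> \<open>b \<in> ?V\<close> unfolding distrib_right
      by (intro Bochner_Integration.integral_add) (auto intro: integrable_Op_antiwick rapid)
    then show ?thesis
      by (auto simp: Op_antiwick_def fun_eq_iff)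
  qed
  have cmultW: "Op_wick (\<lambda>x y. k * a x y) = (\<lambda>u v. k * Op_wick a u v)" for k a
    by (auto simp: Op_wick_def fun_eq_iff mult.assoc)
  have cmultA: "Op_antiwick (\<lambda>x y. k * a x y) = (\<lambda>u v. k * Op_antiwick a u v)" for k a
    by (auto simp: Op_antiwick_def fun_eq_iff mult.assoc)
  have W: "csubspace2 (Op_wick ` ?V)"
    unfolding csubspace2_def
  proof (intro conjI ballI allI)
    have "Op_wick (\<lambda>(x :: complex ^ 'd) y. 0) = (\<lambda>x y. 0)"
      by (auto simp: Op_wick_def fun_eq_iff)
    then show "(\<lambda>x y. 0) \<in> Op_wick ` ?V"
      using imageI[OF V0, of Op_wick] by simp
  next
    fix S T assume "S \<in> Op_wick ` ?V" "T \<in> Op_wick ` ?V"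
    then obtain a b where ab: "a \<in> ?V" "b \<in> ?V" "S = Op_wick a" "T = Op_wick b"
      by (auto simp only: image_iff)
    show "(\<lambda>x y. S x y + T x y) \<in> Op_wick ` ?V"
      using imageI[OF Vadd[OF ab(1,2)], of Op_wick] unfolding addW[OF ab(1,2)] ab(3,4) .
  next
    fix k S assume "S \<in> Op_wick ` ?V"
    then obtain a where a: "a \<in> ?V" "S = Op_wick a"
      by (auto simp only: image_iff)
    show "(\<lambda>x y. k * S x y) \<in> Op_wick ` ?V"
      using imageI[OF Vcmult[OF a(1)], of Op_wick] unfolding cmultW a(2) .
  qed
  \<comment> \<open>The parameters 1 and -1 add up to 0, where the group is the identity.\<close>
  have inv: "wick_shift (-1) (wick_shift 1 c) = c" "wick_shift 1 (wick_shift (-1) c) = c" if "c \<in> X" for c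
    using wick_shift_add[OF rapid[OF that]] by (simp_all add: wick_shift_0)
  have conv: "Op_antiwick a = Op_wick b" if "c \<in> X" "is_symbol_series c a" "is_symbol_series (wick_shift 1 c) b" for a b c
    using that by (intro Op_antiwick_eq_Op_wick rapid shift) auto
  have ex: "\<exists>b. is_symbol_series c b" if "c \<in> X" for c
    using is_symbol_series_exists[OF rapid[OF that]] by blast
  have "inj_on Op_antiwick ?V"
  proof (rule inj_onI)
    fix a a' assume "a \<in> ?V" "a' \<in> ?V" and eq: "Op_antiwick a = Op_antiwick a'"
    then obtain c c' where c: "c \<in> X" "is_symbol_series c a" and c': "c' \<in> X" "is_symbol_series c' a'"
      by blast
    from c c' have T: "wick_shift 1 c \<in> X" "wick_shift 1 c' \<in> X"
      using shift by auto
    then obtain b b' where b: "is_symbol_series (wick_shift 1 c) b" and b': "is_symbol_series (wick_shift 1 c') b'"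
      using ex by blast
    have "Op_wick b = Op_wick b'"
      using conv[OF c b] conv[OF c' b'] eq by simp
    then have "wick_shift 1 c = wick_shift 1 c'"
      using Op_wick_inject[OF rapid[OF T(1)] b rapid[OF T(2)] b'] by simp
    then have "wick_shift (-1) (wick_shift 1 c) = wick_shift (-1) (wick_shift 1 c')"
      by (rule arg_cong)
    then have "c = c'"
      unfolding inv(1)[OF c(1)] inv(1)[OF c'(1)] .
    with c(2) c'(2) show "a = a'"
      by (auto intro: is_symbol_series_unique)
  qed
  moreover have "Op_antiwick ` ?V = Op_wick ` ?V"
  proof (intro equalityI subsetI)
    fix T assume "T \<in> Op_antiwick ` ?V"
    then obtain a c where c: "c \<in> X" "is_symbol_series c a" and T: "T = Op_antiwick a"
      by blast
    then have Tc: "wick_shift 1 c \<in> X"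
      using shift by auto
    then obtain b where b: "is_symbol_series (wick_shift 1 c) b"
      using ex by blast
    then show "T \<in> Op_wick ` ?V"
      using conv[OF c b] T Tc by blast
  next
    fix T assume "T \<in> Op_wick ` ?V"
    then obtain b c where c: "c \<in> X" "is_symbol_series c b" and T: "T = Op_wick b"
      by blast
    then have Tc: "wick_shift (-1) c \<in> X"
      using shift by auto
    then obtain a where a: "is_symbol_series (wick_shift (-1) c) a"
      using ex by blast
    have "is_symbol_series (wick_shift 1 (wick_shift (-1) c)) b"
      unfolding inv(2)[OF c(1)] by (rule c(2))
    from conv[OF Tc a this] show "T \<in> Op_antiwick ` ?V"
      using T Tc a by (intro image_eqI[where x = a]) auto
  qed
  ultimately have "bij_betw Op_antiwick ?V (Op_wick ` ?V)"
    by (simp add: bij_betw_def)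
  then show ?thesis
    unfolding linear_bijection_def by (intro conjI ballI allI V W addA cmultA)
qed

subsection \<open>Weighted sequence spaces\<close>

text \<open>Supermultiplicativity separates \<mu> from \<open>diag \<kappa>\<close>. The factor
  2^|\<mu>| of the shift coefficient is absorbed by passing from \<open>w\<close> to the weaker
  \<open>w'\<close>. In \<kappa>, the 4 in \<open>w_ge\<close> is 2 times 2: one 2 pays for the
  shift coefficient and the other gives the geometric decay needed for the sum.\<close>

lemma wick_shift_weight_bound:
  fixes c :: "('d::finite + 'd \<Rightarrow> nat) \<Rightarrow> complex"
  assumes c: "rapidly_decaying c" and t: "norm t = 1"
    and w_pos: "\<And>\<nu>. w \<nu> > 0" and w'_pos: "\<And>\<nu>. w' \<nu> > 0"
    and supermult: "\<And>\<mu> \<nu>. w \<mu> * w \<nu> \<le> w (\<mu> + \<nu>)"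
    and w': "\<And>\<nu>. w' \<nu> * 2 ^ mi_abs \<nu> \<le> A * w \<nu>"
    and w_ge: "\<And>\<nu>. 4 ^ mi_abs \<nu> \<le> B * w \<nu>"
    and C: "\<And>\<nu>. norm (c \<nu>) * w \<nu> \<le> C"
  shows "\<exists>D. \<forall>\<mu>. norm (wick_shift t c \<mu>) * w' \<mu> \<le> D"
proof (intro exI allI)
  fix \<mu> :: "'d + 'd \<Rightarrow> nat"
  have A0: "A \<ge> 0"
  proof -
    have "0 < w' 0 * 2 ^ mi_abs (0 :: 'd + 'd \<Rightarrow> nat)"
      using w'_pos by simp
    also note w'
    finally show ?thesis
      using w_pos[of 0] by (simp add: zero_less_mult_iff)
  qed
  have C0: "C \<ge> 0"
    by (rule order.trans[OF mult_nonneg_nonneg C[of 0]]) (use w_pos[of 0] in auto)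
  have term_le: "norm (t ^ mi_abs \<kappa> * of_real (shift_coeff \<mu> \<kappa>) * c (\<mu> + diag \<kappa>)) \<le> C * A * B / w' \<mu> * (1 / 2) ^ mi_abs \<kappa>" for \<kappa>
  proof -
    have 1: "norm (c (\<mu> + diag \<kappa>)) \<le> C / (w \<mu> * w (diag \<kappa>))"
    proof -
      have "norm (c (\<mu> + diag \<kappa>)) * (w \<mu> * w (diag \<kappa>)) \<le> norm (c (\<mu> + diag \<kappa>)) * w (\<mu> + diag \<kappa>)"
        by (intro mult_left_mono supermult) auto
      also have "\<dots> \<le> C"
        by (rule C)
      finally show ?thesis
        using w_pos by (simp add: le_divide_eq)
    qed
    have "norm (t ^ mi_abs \<kappa> * of_real (shift_coeff \<mu> \<kappa>) * c (\<mu> + diag \<kappa>)) =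
        shift_coeff \<mu> \<kappa> * norm (c (\<mu> + diag \<kappa>))"
      by (simp add: norm_mult norm_power t)
    also have "\<dots> \<le> 2 ^ mi_abs (\<mu> + diag \<kappa>) * (C / (w \<mu> * w (diag \<kappa>)))"
      using C0 by (intro mult_mono shift_coeff_le 1) auto
    also have "\<dots> = C * (2 ^ mi_abs \<mu> / w \<mu>) * (2 ^ mi_abs (diag \<kappa>) / w (diag \<kappa>))"
      by (simp add: power_add)
    also have "\<dots> \<le> C * (A / w' \<mu>) * (B * (1 / 2) ^ mi_abs (diag \<kappa>))"
    proof (intro mult_mono mult_left_mono mult_nonneg_nonneg)
      show "2 ^ mi_abs \<mu> / w \<mu> \<le> A / w' \<mu>"
        using w'[of \<mu>] w_pos[of \<mu>] w'_pos[of \<mu>] by (simp add: divide_simps mult.commute)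
      have "2 ^ mi_abs (diag \<kappa>) * 2 ^ mi_abs (diag \<kappa>) \<le> B * w (diag \<kappa>)"
        using w_ge[of "diag \<kappa>"] by (simp flip: power_mult_distrib)
      then show "2 ^ mi_abs (diag \<kappa>) / w (diag \<kappa>) \<le> B * (1 / 2) ^ mi_abs (diag \<kappa>)"
        using w_pos[of "diag \<kappa>"] by (simp add: divide_simps power_one_over)
    qed (use A0 C0 w_pos w'_pos in \<open>auto simp: less_imp_le\<close>)
    also have "\<dots> = C * A * B / w' \<mu> * (1 / 2) ^ mi_abs (diag \<kappa>)"
      by simp
    also have "\<dots> \<le> C * A * B / w' \<mu> * (1 / 2) ^ mi_abs \<kappa>"
    proof (intro mult_left_mono power_decreasing)
      have "0 \<le> B * w 0"
        using w_ge[of 0] by (rule order.trans[rotated]) simp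
      then have "B \<ge> 0"
        using w_pos[of 0] by (simp add: zero_le_mult_iff)
      then show "C * A * B / w' \<mu> \<ge> 0"
        using A0 C0 w'_pos[of \<mu>] by simp
    qed auto
    finally show ?thesis .
  qed
  have sumk: "(\<lambda>\<kappa> :: 'd \<Rightarrow> nat. C * A * B / w' \<mu> * (1 / 2) ^ mi_abs \<kappa>) summable_on UNIV"
    by (intro summable_on_cmult_right summable_on_geometric_mi) auto
  have "norm (wick_shift t c \<mu>) \<le> (\<Sum>\<^sub>\<infinity>\<kappa> :: 'd \<Rightarrow> nat. C * A * B / w' \<mu> * (1 / 2) ^ mi_abs \<kappa>)"
    by (rule norm_infsum_le[OF wick_shift_has_sum[OF c] has_sum_infsum[OF sumk]]) (use t term_le in auto)
  also have "\<dots> = C * A * B / w' \<mu> * (\<Sum>\<^sub>\<infinity>\<kappa> :: 'd \<Rightarrow> nat. (1 / 2) ^ mi_abs \<kappa>)"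
    by (rule infsum_cmult_right')
  finally show "norm (wick_shift t c \<mu>) * w' \<mu> \<le> C * A * B * (\<Sum>\<^sub>\<infinity>\<kappa> :: 'd \<Rightarrow> nat. (1 / 2) ^ mi_abs \<kappa>)"
    using w'_pos[of \<mu>] by (simp add: field_simps)
qed

section \<open>Boundedness, geometric decay and membership in l^p\<close>

lemma in_lp_imp_bounded:
  assumes p: "0 < p" and f: "\<And>i. f i \<ge> 0" and lp: "in_lp p (\<lambda>i. ennreal (f i))"
  shows "\<exists>C. \<forall>i. f i \<le> C"
proof (cases "p = \<infinity>")
  case True
  with lp f show ?thesis
    by (auto simp: in_lp_def bdd_above_def)
next
  case False
  define q where "q = enn2real p"
  have q: "q > 0"
    using p False by (simp add: q_def enn2real_positive_iff less_top)
  have s: "(\<lambda>i. f i powr q) summable_on UNIV"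
    using lp False f by (simp add: in_lp_def q_def)
  have "f i \<le> infsum (\<lambda>i. f i powr q) UNIV powr (1 / q)" for i
  proof -
    have "f i powr q = (\<Sum>i\<in>{i}. f i powr q)"
      by simp
    also have "\<dots> \<le> infsum (\<lambda>i. f i powr q) UNIV"
      by (intro finite_sum_le_infsum s) auto
    finally have "(f i powr q) powr (1 / q) \<le> infsum (\<lambda>i. f i powr q) UNIV powr (1 / q)"
      using q by (intro powr_mono2) auto
    then show ?thesis
      using q f[of i] by (simp add: powr_powr)
  qed
  then show ?thesis
    by blast
qed

text \<open>Raised to any power q > 0, the ratio 1/2 is still a ratio below 1, so p < 1 is
  included.\<close>

lemma geometric_imp_in_lp:
  fixes f :: "('n::finite \<Rightarrow> nat) \<Rightarrow> real"
  assumes p: "0 < p" and f: "\<And>i. f i \<ge> 0" and le: "\<And>i. f i \<le> C * (1 / 2) ^ mi_abs i"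
  shows "in_lp p (\<lambda>i. ennreal (f i))"
proof -
  have C: "C \<ge> 0"
    using order.trans[OF f[of 0] le[of 0]] by (simp add: mi_abs_def)
  show ?thesis
  proof (cases "p = \<infinity>")
    case True
    have "f i \<le> C" for i
      by (rule order.trans[OF le]) (use C in \<open>simp add: mult_left_le power_le_one\<close>)
    with True f show ?thesis
      by (auto simp: in_lp_def bdd_above_def)
  next
    case False
    define q where "q = enn2real p"
    have q: "q > 0"
      using p False by (simp add: q_def enn2real_positive_iff less_top)
    define y :: real where "y = (1 / 2) powr q"
    have y: "0 \<le> y" "y < 1"
      using q powr_less_mono2[of q "1/2" 1] by (auto simp: y_def)
    have "(\<lambda>i. f i powr q) summable_on UNIV"
    proof (rule summable_on_comparison_test)
      show "(\<lambda>i :: 'n \<Rightarrow> nat. C powr q * y ^ mi_abs i) summable_on UNIV"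
        using y by (intro summable_on_cmult_right summable_on_geometric_mi)
      fix i :: "'n \<Rightarrow> nat"
      have "f i powr q \<le> (C * (1 / 2) ^ mi_abs i) powr q"
        using q by (intro powr_mono2 le f) auto
      also have "\<dots> = C powr q * ((1 / 2) ^ mi_abs i) powr q"
        using C by (simp add: powr_mult)
      also have "((1 / 2) ^ mi_abs i) powr q = y ^ mi_abs i"
        by (simp add: y_def powr_realpow[symmetric] powr_powr mult.commute)
      finally show "f i powr q \<le> C powr q * y ^ mi_abs i" .
    qed auto
    then show ?thesis
      using False f by (simp add: in_lp_def q_def less_top)
  qed
qed

section \<open>Growth of the weights\<close>

fun real_weight :: "real \<Rightarrow> flat_index \<Rightarrow> ('n::finite \<Rightarrow> nat) \<Rightarrow> real" where
  "real_weight r (Reg s) \<alpha> = exp (r * real (mi_abs \<alpha>) powr (1 / (2 * s)))"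
| "real_weight r (Flat \<sigma>) \<alpha> = r ^ mi_abs \<alpha> * mi_fact \<alpha> powr (1 / (2 * \<sigma>))"

text \<open>At \<open>Reg 0\<close> the weight takes infinite values; that index is handled through
  finite supports instead.\<close>

lemma weight_eq_real_weight: "s \<noteq> Reg 0 \<Longrightarrow> weight r s \<alpha> = ennreal (real_weight r s \<alpha>)"
  by (cases s) auto

lemma real_weight_pos: "r > 0 \<Longrightarrow> real_weight r s \<alpha> > 0"
  by (cases s) auto

lemma real_weight_mono: "0 < r \<Longrightarrow> r \<le> r' \<Longrightarrow> real_weight r s \<alpha> \<le> real_weight r' s \<alpha>"
  by (cases s) (auto intro!: mult_right_mono power_mono)

text \<open>Every flat index lies strictly below \<open>Reg (1/2)\<close>, so the upper bound
  restricts only the regular ones.\<close>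

lemma flat_index_cases:
  assumes "s \<in> Rflat" "s \<le> Reg (1/2)" "s \<noteq> Reg 0"
  obtains x where "s = Reg x" "0 < x" "x \<le> 1/2" | \<sigma> where "s = Flat \<sigma>" "\<sigma> > 0"
proof (cases s)
  case (Reg x)
  with assms have "0 < x" "x \<le> 1/2"
    by (auto simp: Rflat_def less_eq_flat_index_def)
  with Reg show thesis
    by (rule that(1))
next
  case (Flat \<sigma>)
  with assms have "\<sigma> > 0"
    by (auto simp: Rflat_def)
  with Flat show thesis
    by (rule that(2))
qed

lemma one_le_inverse_double: "0 < x \<Longrightarrow> x \<le> 1/2 \<Longrightarrow> 1 \<le> 1 / (2 * x)" for x :: real
  by (simp add: le_divide_eq)

lemma real_le_powr_nat: "1 \<le> q \<Longrightarrow> real n \<le> real n powr q"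
  using powr_mono[of 1 q "real n"] by (cases "n = 0") auto

text \<open>Split off one factor: k^q = k k^(q-1), and both powers k^(q-1) are at most
  (m+n)^(q-1).\<close>

lemma powr_add_superadditive:
  fixes q :: real
  assumes "1 \<le> q"
  shows "real m powr q + real n powr q \<le> real (m + n) powr q"
proof -
  have *: "real k powr q \<le> real k * real (m + n) powr (q - 1)" if "k \<le> m + n" for k
  proof -
    have "real k powr q = real k * real k powr (q - 1)"
      using powr_mult_base[of "real k" "q - 1"] by simp
    also have "\<dots> \<le> real k * real (m + n) powr (q - 1)"
      using that assms by (intro mult_left_mono powr_mono2) auto
    finally show ?thesis .
  qed
  have "real m powr q + real n powr q \<le> real m * real (m + n) powr (q - 1) + real n * real (m + n) powr (q - 1)"
    by (intro add_mono *) auto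
  also have "\<dots> = real (m + n) * real (m + n) powr (q - 1)"
    by (simp add: distrib_right)
  also have "\<dots> = real (m + n) powr q"
    using powr_mult_base[of "real (m + n)" "q - 1"] by simp
  finally show ?thesis .
qed

text \<open>For regular indices x \<le> 1/2 means that the exponent 1/(2x) is at least 1, hence
  superadditivity of the power; for flat ones the factorials are supermultiplicative.\<close>

lemma real_weight_supermult:
  assumes s: "s \<in> Rflat" "s \<le> Reg (1/2)" "s \<noteq> Reg 0" and r: "r > 0"
  shows "real_weight r s \<mu> * real_weight r s \<nu> \<le> real_weight r s (\<mu> + \<nu>)"
  using s
proof (cases rule: flat_index_cases)
  case (1 x)
  have "r * (real (mi_abs \<mu>) powr (1 / (2 * x)) + real (mi_abs \<nu>) powr (1 / (2 * x))) \<le>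
      r * real (mi_abs \<mu> + mi_abs \<nu>) powr (1 / (2 * x))"
    using r 1 by (intro mult_left_mono powr_add_superadditive one_le_inverse_double) auto
  then show ?thesis
    by (simp add: 1(1) exp_add[symmetric] distrib_left)
next
  case (2 \<sigma>)
  have "mi_fact \<mu> powr (1 / (2 * \<sigma>)) * mi_fact \<nu> powr (1 / (2 * \<sigma>)) \<le> mi_fact (\<mu> + \<nu>) powr (1 / (2 * \<sigma>))"
    using 2 by (subst powr_mult[symmetric]) (auto intro!: powr_mono2 mi_fact_add_ge)
  then have "r ^ (mi_abs \<mu> + mi_abs \<nu>) * (mi_fact \<mu> powr (1 / (2 * \<sigma>)) * mi_fact \<nu> powr (1 / (2 * \<sigma>))) \<le>
      r ^ (mi_abs \<mu> + mi_abs \<nu>) * mi_fact (\<mu> + \<nu>) powr (1 / (2 * \<sigma>))"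
    using r by (intro mult_left_mono) auto
  then show ?thesis
    by (simp add: 2(1) power_add mult_ac)
qed

text \<open>An exponential factor is bought by a larger r: r + 1 in the regular case, since 2 \<le>
  e and n \<le> n^(1/(2x)), and 2r in the flat case. The projective spaces use this.\<close>

lemma real_weight_step:
  fixes s :: flat_index
  assumes s: "s \<in> Rflat" "s \<le> Reg (1/2)" "s \<noteq> Reg 0" and r: "r > 0"
  shows "\<exists>r'>0. \<forall>\<nu> :: 'n::finite \<Rightarrow> nat. real_weight r s \<nu> * 2 ^ mi_abs \<nu> \<le> real_weight r' s \<nu>"
  using s
proof (cases rule: flat_index_cases)
  case (1 x)
  have "real_weight r s \<nu> * 2 ^ mi_abs \<nu> \<le> real_weight (r + 1) s \<nu>" for \<nu> :: "'n \<Rightarrow> nat"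
  proof -
    have "(2 :: real) ^ mi_abs \<nu> \<le> exp 1 ^ mi_abs \<nu>"
      using exp_ge_add_one_self[of 1] by (intro power_mono) auto
    also have "\<dots> = exp (real (mi_abs \<nu>))"
      by (simp flip: exp_of_nat_mult)
    also have "\<dots> \<le> exp (real (mi_abs \<nu>) powr (1 / (2 * x)))"
      using real_le_powr_nat[OF one_le_inverse_double[OF 1(2,3)]] by simp
    finally have "exp (r * real (mi_abs \<nu>) powr (1 / (2 * x))) * 2 ^ mi_abs \<nu> \<le>
        exp (r * real (mi_abs \<nu>) powr (1 / (2 * x))) * exp (real (mi_abs \<nu>) powr (1 / (2 * x)))"
      by (intro mult_left_mono) auto
    then show ?thesis
      by (simp add: 1(1) distrib_right exp_add)
  qed
  then show ?thesis
    using r by (intro exI[of _ "r + 1"]) auto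
next
  case (2 \<sigma>)
  then show ?thesis
    using r by (intro exI[of _ "2 * r"]) (auto simp: power_mult_distrib)
qed

text \<open>Here r is given and R arbitrary, which requires x < 1/2: at x = 1/2 the weight exp(rn)
  does not dominate R^n once R > e^r.\<close>

lemma real_weight_superexponential:
  fixes s :: flat_index
  assumes s: "s \<in> Rflat" "s < Reg (1/2)" "s \<noteq> Reg 0" and r: "r > 0" and R: "R > 0"
  shows "\<exists>C\<ge>0. \<forall>\<nu> :: 'n::finite \<Rightarrow> nat. R ^ mi_abs \<nu> \<le> C * real_weight r s \<nu>"
proof -
  have "s \<le> Reg (1/2)"
    using s by simp
  from s(1) this s(3) show ?thesis
  proof (cases rule: flat_index_cases)
    case (1 x)
    define q where "q = 1 / (2 * x)"
    have q: "q > 1"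
      using 1 s(2) by (simp add: q_def less_divide_eq)
    define L where "L = \<bar>ln R\<bar>"
    \<comment> \<open>The crossover at which r x0^(q-1) = L. Above it r n^q exceeds n L; below it n
      L \<le> x0 L, which the constant exp(x0 L) covers.\<close>
    define x0 where "x0 = (L / r) powr (1 / (q - 1))"
    have "R ^ n \<le> exp (x0 * L) * exp (r * real n powr q)" for n
    proof -
      have "real n * L \<le> x0 * L + r * real n powr q"
      proof (cases "real n \<le> x0")
        case True
        then have "real n * L \<le> x0 * L"
          by (intro mult_right_mono) (auto simp: L_def)
        then show ?thesis
          using r by (simp add: add_increasing2)
      next
        case False
        then have "x0 powr (q - 1) \<le> real n powr (q - 1)"
          using q by (intro powr_mono2) (auto simp: x0_def)
        moreover have "x0 powr (q - 1) = L / r"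
          using q r by (simp add: x0_def powr_powr L_def)
        ultimately have "L \<le> r * real n powr (q - 1)"
          using r by (simp add: divide_le_eq mult.commute)
        then have "real n * L \<le> real n * (r * real n powr (q - 1))"
          by (intro mult_left_mono) auto
        also have "\<dots> = r * real n powr q"
          using powr_mult_base[of "real n" "q - 1"] by (simp add: mult.left_commute)
        finally show ?thesis
          by (simp add: add_increasing x0_def L_def)
      qed
      moreover have "real n * ln R \<le> real n * L"
        by (intro mult_left_mono) (auto simp: L_def)
      ultimately have "real n * ln R \<le> x0 * L + r * real n powr q"
        by linarith
      then have "exp (real n * ln R) \<le> exp (x0 * L) * exp (r * real n powr q)"
        by (simp flip: exp_add)
      also have "exp (real n * ln R) = R ^ n"
        using R by (simp add: exp_of_nat_mult)
      finally show ?thesis .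
    qed
    then show ?thesis
      by (intro exI[of _ "exp (x0 * L)"]) (auto simp: 1(1) q_def)
  next
    case (2 \<sigma>)
    define \<rho> where "\<rho> = 1 / (2 * \<sigma>)"
    have \<rho>: "\<rho> > 0"
      using 2 by (simp add: \<rho>_def)
    \<comment> \<open>Chosen so that X^\<rho> = R/r. The bound X^k \<le> k! e^X in each coordinate,
      raised to the power \<rho>, then gives the claim with one factor e^X per coordinate in
      \<open>C\<close>.\<close>
    define X where "X = (R / r) powr (1 / \<rho>)"
    define C where "C = (exp X ^ CARD('n)) powr \<rho>"
    have X: "X > 0"
      using r R by (simp add: X_def)
    have "R ^ mi_abs \<nu> \<le> C * (r ^ mi_abs \<nu> * mi_fact \<nu> powr \<rho>)" for \<nu> :: "'n \<Rightarrow> nat"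
    proof -
      have "X ^ mi_abs \<nu> = (\<Prod>j\<in>UNIV. X ^ \<nu> j)"
        by (simp add: mi_abs_def power_sum)
      also have "\<dots> \<le> (\<Prod>j\<in>UNIV. fact (\<nu> j) * exp X)"
        using X by (intro prod_mono conjI power_le_fact_mult_exp) auto
      also have "\<dots> = mi_fact \<nu> * exp X ^ CARD('n)"
        by (simp add: mi_fact_def prod.distrib)
      finally have "(X ^ mi_abs \<nu>) powr \<rho> \<le> (mi_fact \<nu> * exp X ^ CARD('n)) powr \<rho>"
        using X \<rho> by (intro powr_mono2) auto
      also have "\<dots> = mi_fact \<nu> powr \<rho> * C"
        unfolding C_def by (simp add: powr_mult)
      also have "(X ^ mi_abs \<nu>) powr \<rho> = (R / r) ^ mi_abs \<nu>"
        using X \<rho> r R by (simp add: X_def powr_powr flip: powr_realpow)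
      finally show ?thesis
        using r by (simp add: power_divide field_simps)
    qed
    then show ?thesis
      by (intro exI[of _ C]) (auto simp: 2(1) \<rho>_def C_def)
  qed
qed

text \<open>Here r may depend on R, so the endpoint x = 1/2 is included: \<open>r \<ge> ln R\<close>
  suffices because n \<le> n^(1/(2x)).\<close>

lemma real_weight_exponential:
  fixes s :: flat_index
  assumes s: "s \<in> Rflat" "s \<le> Reg (1/2)" "s \<noteq> Reg 0" and R: "R > 0"
  shows "\<exists>r>0. \<exists>C\<ge>0. \<forall>\<nu> :: 'n::finite \<Rightarrow> nat. R ^ mi_abs \<nu> \<le> C * real_weight r s \<nu>"
  using s
proof (cases rule: flat_index_cases)
  case (1 x)
  define r where "r = max 1 (ln R)"
  have "R ^ n \<le> 1 * exp (r * real n powr (1 / (2 * x)))" for n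
  proof -
    have "real n * ln R \<le> real n * r"
      by (intro mult_left_mono) (auto simp: r_def)
    also have "\<dots> \<le> real n powr (1 / (2 * x)) * r"
      by (intro mult_right_mono real_le_powr_nat one_le_inverse_double 1) (auto simp: r_def)
    finally have "exp (real n * ln R) \<le> exp (r * real n powr (1 / (2 * x)))"
      by (simp add: mult.commute)
    then show ?thesis
      using R by (simp add: exp_of_nat_mult)
  qed
  then show ?thesis
    by (intro exI[of _ r] conjI exI[of _ 1]) (auto simp: 1(1) r_def)
next
  case (2 \<sigma>)
  then have "s < Reg (1/2)"
    by simp
  then show ?thesis
    using real_weight_superexponential[OF s(1) _ s(3), of 1 R] R by (intro exI[of _ 1]) auto
qed

text \<open>A regular weight at r is the square of the one at r/2; one factor dominates 2^n, the
  other remains. For flat weights halving r supplies 2^n exactly.\<close>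

lemma real_weight_step_down:
  fixes s :: flat_index
  assumes s: "s \<in> Rflat" "s < Reg (1/2)" "s \<noteq> Reg 0" and r: "r > 0"
  shows "\<exists>r'>0. \<exists>C\<ge>0. \<forall>\<nu> :: 'n::finite \<Rightarrow> nat. real_weight r' s \<nu> * 2 ^ mi_abs \<nu> \<le> C * real_weight r s \<nu>"
proof -
  have "s \<le> Reg (1/2)"
    using s by simp
  from s(1) this s(3) show ?thesis
  proof (cases rule: flat_index_cases)
    case (1 x)
    obtain C where C: "C \<ge> 0" "\<And>\<nu> :: 'n \<Rightarrow> nat. 2 ^ mi_abs \<nu> \<le> C * real_weight (r / 2) s \<nu>"
      using real_weight_superexponential[OF s, of "r / 2" 2] r by auto
    have "real_weight (r / 2) s \<nu> * 2 ^ mi_abs \<nu> \<le> C * real_weight r s \<nu>" for \<nu> :: "'n \<Rightarrow> nat"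
    proof -
      have "real_weight (r / 2) s \<nu> * 2 ^ mi_abs \<nu> \<le> real_weight (r / 2) s \<nu> * (C * real_weight (r / 2) s \<nu>)"
        using r real_weight_pos[of "r / 2" s \<nu>] by (intro mult_left_mono C) auto
      also have "\<dots> = C * real_weight r s \<nu>"
        by (simp add: 1(1) exp_add[symmetric])
      finally show ?thesis .
    qed
    then show ?thesis
      using r C(1) by (intro exI[of _ "r / 2"]) auto
  next
    case (2 \<sigma>)
    then show ?thesis
      using r by (intro exI[of _ "r / 2"] conjI exI[of _ 1]) (auto simp: power_divide)
  qed
qed

section \<open>The coefficient spaces as bounds on weighted coefficients\<close>

lemma ennreal_cmod_mult_weight:
  "s \<noteq> Reg 0 \<Longrightarrow> r > 0 \<Longrightarrow>
    (\<lambda>\<alpha>. ennreal (cmod (c \<alpha>)) * weight r s \<alpha>) = (\<lambda>\<alpha>. ennreal (cmod (c \<alpha>) * real_weight r s \<alpha>))"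
  by (intro ext) (simp add: weight_eq_real_weight ennreal_mult less_imp_le real_weight_pos)

lemma in_lp_weight_bounded:
  assumes "0 < p" "s \<noteq> Reg 0" "r > 0" "in_lp p (\<lambda>\<alpha>. ennreal (cmod (c \<alpha>)) * weight r s \<alpha>)"
  shows "\<exists>C. \<forall>\<nu>. cmod (c \<nu>) * real_weight r s \<nu> \<le> C"
  using assms unfolding ennreal_cmod_mult_weight[OF assms(2,3)]
  by (intro in_lp_imp_bounded[OF assms(1)]) (auto simp: less_imp_le real_weight_pos)

lemma bounded_imp_in_lp_weight:
  fixes c :: "('n::finite \<Rightarrow> nat) \<Rightarrow> complex"
  assumes p: "0 < p" and s: "s \<noteq> Reg 0" and r: "r > 0" and A: "A \<ge> 0"
    and le: "\<And>\<nu> :: 'n \<Rightarrow> nat. real_weight r s \<nu> * 2 ^ mi_abs \<nu> \<le> A * real_weight r' s \<nu>"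
    and C: "\<And>\<nu>. cmod (c \<nu>) * real_weight r' s \<nu> \<le> C"
  shows "in_lp p (\<lambda>\<alpha>. ennreal (cmod (c \<alpha>)) * weight r s \<alpha>)"
  unfolding ennreal_cmod_mult_weight[OF s r]
proof (rule geometric_imp_in_lp[OF p])
  fix \<nu> :: "'n \<Rightarrow> nat"
  show "0 \<le> cmod (c \<nu>) * real_weight r s \<nu>"
    using r by (simp add: less_imp_le real_weight_pos)
  have "cmod (c \<nu>) * (real_weight r s \<nu> * 2 ^ mi_abs \<nu>) \<le> cmod (c \<nu>) * (A * real_weight r' s \<nu>)"
    by (intro mult_left_mono le) auto
  also have "\<dots> = A * (cmod (c \<nu>) * real_weight r' s \<nu>)"
    by simp
  also have "\<dots> \<le> A * C"
    by (intro mult_left_mono C A)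
  finally show "cmod (c \<nu>) * real_weight r s \<nu> \<le> A * C * (1 / 2) ^ mi_abs \<nu>"
    by (simp add: field_simps power_one_over)
qed

text \<open>The exponent \<open>p\<close> is irrelevant, because an increase of \<open>r\<close> gains an exponential factor.\<close>

lemma ell_iff:
  assumes p: "0 < p" and s: "s \<in> Rflat" "s < Reg (1/2)" "s \<noteq> Reg 0"
  shows "c \<in> ell p s \<longleftrightarrow> (\<exists>r>0. \<exists>C. \<forall>\<nu>. cmod (c \<nu>) * real_weight r s \<nu> \<le> C)"
proof
  assume "c \<in> ell p s"
  then show "\<exists>r>0. \<exists>C. \<forall>\<nu>. cmod (c \<nu>) * real_weight r s \<nu> \<le> C"
    using in_lp_weight_bounded[OF p s(3)] by (fastforce simp: ell_def)
next
  assume "\<exists>r>0. \<exists>C. \<forall>\<nu>. cmod (c \<nu>) * real_weight r s \<nu> \<le> C"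
  then obtain r C where r: "r > 0" and C: "\<And>\<nu>. cmod (c \<nu>) * real_weight r s \<nu> \<le> C"
    by blast
  obtain r' A where "r' > 0" "A \<ge> 0" "\<And>\<nu> :: 'a \<Rightarrow> nat. real_weight r' s \<nu> * 2 ^ mi_abs \<nu> \<le> A * real_weight r s \<nu>"
    using real_weight_step_down[OF s r] by blast
  then have "in_lp p (\<lambda>\<alpha>. ennreal (cmod (c \<alpha>)) * weight r' s \<alpha>)"
    using bounded_imp_in_lp_weight[OF p s(3) _ _ _ C] by blast
  with \<open>r' > 0\<close> show "c \<in> ell p s"
    by (auto simp: ell_def)
qed

lemma ell0_iff:
  assumes p: "0 < p" and s: "s \<in> Rflat" "s \<le> Reg (1/2)" "s \<noteq> Reg 0"
  shows "c \<in> ell0 p s \<longleftrightarrow> (\<forall>r>0. \<exists>C. \<forall>\<nu>. cmod (c \<nu>) * real_weight r s \<nu> \<le> C)"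
proof
  assume "c \<in> ell0 p s"
  then show "\<forall>r>0. \<exists>C. \<forall>\<nu>. cmod (c \<nu>) * real_weight r s \<nu> \<le> C"
    using in_lp_weight_bounded[OF p s(3)] s(3) by (fastforce simp: ell0_def)
next
  assume *: "\<forall>r>0. \<exists>C. \<forall>\<nu>. cmod (c \<nu>) * real_weight r s \<nu> \<le> C"
  have "in_lp p (\<lambda>\<alpha>. ennreal (cmod (c \<alpha>)) * weight r s \<alpha>)" if r: "r > 0" for r
  proof -
    obtain r' where r': "r' > 0" "\<And>\<nu> :: 'a \<Rightarrow> nat. real_weight r s \<nu> * 2 ^ mi_abs \<nu> \<le> real_weight r' s \<nu>"
      using real_weight_step[OF s r] by blast
    obtain C where "\<And>\<nu>. cmod (c \<nu>) * real_weight r' s \<nu> \<le> C"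
      using * r'(1) by blast
    then show ?thesis
      using r' by (intro bounded_imp_in_lp_weight[OF p s(3) r, of 1]) auto
  qed
  then show "c \<in> ell0 p s"
    using s(3) by (simp add: ell0_def)
qed

lemma finite_support_rapidly_decaying:
  fixes c :: "('n::finite \<Rightarrow> nat) \<Rightarrow> complex"
  assumes "\<And>\<nu>. real (mi_abs \<nu>) > r \<Longrightarrow> c \<nu> = 0"
  shows "rapidly_decaying c"
proof -
  \<comment> \<open>A finite box containing all multi-indices of degree at most r.\<close>
  define S where "S = {\<nu> :: 'n \<Rightarrow> nat. \<nu> \<le> (\<lambda>_. nat \<lceil>r\<rceil>)}"
  have S: "finite S"
    by (simp add: S_def)
  have c0: "c \<nu> = 0" if "\<nu> \<notin> S" for \<nu>
  proof -
    obtain j where "\<nu> j > nat \<lceil>r\<rceil>"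
      using \<open>\<nu> \<notin> S\<close> by (auto simp: S_def le_fun_def not_le)
    moreover have "\<nu> j \<le> mi_abs \<nu>"
      unfolding mi_abs_def by (rule member_le_sum) auto
    ultimately have "r < real (mi_abs \<nu>)"
      by linarith
    then show ?thesis
      by (rule assms)
  qed
  show ?thesis
    unfolding rapidly_decaying_def
  proof (intro allI impI exI)
    fix R :: real and \<nu> assume R: "R > 0"
    show "cmod (c \<nu>) * R ^ mi_abs \<nu> \<le> (\<Sum>\<nu>\<in>S. cmod (c \<nu>) * R ^ mi_abs \<nu>)"
    proof (cases "\<nu> \<in> S")
      case True
      then show ?thesis
        using S R by (intro member_le_sum) auto
    next
      case False
      then show ?thesis
        using R c0 by (simp add: sum_nonneg)
    qed
  qed
qed

text \<open>Beyond degree r the weight is infinite, so finiteness of the products forces the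
  coefficients there to vanish. Conversely the weight is 1 on the support, and a finitely supported
  sequence lies in every l^p.\<close>

lemma ell_Reg_0_iff:
  assumes p: "0 < p"
  shows "c \<in> ell p (Reg 0) \<longleftrightarrow> (\<exists>r>0. \<forall>\<nu>. real (mi_abs \<nu>) > r \<longrightarrow> c \<nu> = 0)"
proof
  assume "c \<in> ell p (Reg 0)"
  then obtain r where r: "r > 0" and "in_lp p (\<lambda>\<alpha>. ennreal (cmod (c \<alpha>)) * weight r (Reg 0) \<alpha>)"
    by (auto simp: ell_def)
  then have fin: "ennreal (cmod (c \<nu>)) * weight r (Reg 0) \<nu> < \<infinity>" for \<nu>
    by (simp add: in_lp_def)
  have "c \<nu> = 0" if "real (mi_abs \<nu>) > r" for \<nu>
    using fin[of \<nu>] that by (auto simp: ennreal_mult_top split: if_splits)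
  with r show "\<exists>r>0. \<forall>\<nu>. real (mi_abs \<nu>) > r \<longrightarrow> c \<nu> = 0"
    by blast
next
  assume "\<exists>r>0. \<forall>\<nu>. real (mi_abs \<nu>) > r \<longrightarrow> c \<nu> = 0"
  then obtain r where r: "r > 0" and c0: "\<And>\<nu>. real (mi_abs \<nu>) > r \<Longrightarrow> c \<nu> = 0"
    by blast
  have eq: "(\<lambda>\<alpha>. ennreal (cmod (c \<alpha>)) * weight r (Reg 0) \<alpha>) = (\<lambda>\<alpha>. ennreal (cmod (c \<alpha>)))"
    using c0 by (auto simp: fun_eq_iff not_le)
  obtain C where "\<And>\<nu>. norm (c \<nu>) \<le> C * (1 / 2) ^ mi_abs \<nu>"
    using rapidly_decayingE[OF finite_support_rapidly_decaying[of r c, OF c0], of 2] by auto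
  then have "in_lp p (\<lambda>\<alpha>. ennreal (cmod (c \<alpha>)) * weight r (Reg 0) \<alpha>)"
    unfolding eq by (intro geometric_imp_in_lp[OF p]) auto
  with r show "c \<in> ell p (Reg 0)"
    by (auto simp: ell_def)
qed

section \<open>Stability of weighted bounds\<close>

lemma bounded_weight_add:
  assumes "\<exists>C. \<forall>\<nu>. cmod (c \<nu>) * w \<nu> \<le> C" "\<exists>C. \<forall>\<nu>. cmod (c' \<nu>) * w \<nu> \<le> C" "\<And>\<nu>. w \<nu> \<ge> 0"
  shows "\<exists>C. \<forall>\<nu>. cmod (c \<nu> + c' \<nu>) * w \<nu> \<le> C"
proof -
  obtain C C' where C: "cmod (c \<nu>) * w \<nu> \<le> C" "cmod (c' \<nu>) * w \<nu> \<le> C'" for \<nu>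
    using assms(1,2) by auto
  have "cmod (c \<nu> + c' \<nu>) * w \<nu> \<le> C + C'" for \<nu>
  proof -
    have "cmod (c \<nu> + c' \<nu>) * w \<nu> \<le> (cmod (c \<nu>) + cmod (c' \<nu>)) * w \<nu>"
      by (intro mult_right_mono norm_triangle_ineq assms)
    then show ?thesis
      using C[of \<nu>] by (simp add: distrib_right)
  qed
  then show ?thesis
    by blast
qed

lemma bounded_weight_cmult:
  assumes "\<exists>C. \<forall>\<nu>. cmod (c \<nu>) * w \<nu> \<le> C"
  shows "\<exists>C. \<forall>\<nu>. cmod (k * c \<nu>) * w \<nu> \<le> C"
proof -
  obtain C where C: "\<And>\<nu>. cmod (c \<nu>) * w \<nu> \<le> C"
    using assms by blast
  have "cmod (k * c \<nu>) * w \<nu> \<le> cmod k * C" for \<nu>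
    unfolding norm_mult mult.assoc by (intro mult_left_mono C) auto
  then show ?thesis
    by blast
qed

lemma bounded_weight_mono:
  assumes "\<exists>C. \<forall>\<nu>. cmod (c \<nu>) * w \<nu> \<le> C" "\<And>\<nu>. w' \<nu> \<le> w \<nu>"
  shows "\<exists>C. \<forall>\<nu>. cmod (c \<nu>) * w' \<nu> \<le> C"
  using assms by (meson mult_left_mono norm_ge_zero order.trans)

lemma bounded_weight_rapidly_decaying:
  assumes "\<And>R. R > 0 \<Longrightarrow> \<exists>w C A. (\<forall>\<nu>. cmod (c \<nu>) * w \<nu> \<le> C) \<and> A \<ge> 0 \<and> (\<forall>\<nu>. R ^ mi_abs \<nu> \<le> A * w \<nu>)"
  shows "rapidly_decaying c"
  unfolding rapidly_decaying_def
proof (intro allI impI)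
  fix R :: real assume "R > 0"
  then obtain w C A where *: "\<And>\<nu>. cmod (c \<nu>) * w \<nu> \<le> C" "A \<ge> 0" "\<And>\<nu>. R ^ mi_abs \<nu> \<le> A * w \<nu>"
    using assms by meson
  have "cmod (c \<nu>) * R ^ mi_abs \<nu> \<le> A * C" for \<nu>
  proof -
    have "cmod (c \<nu>) * R ^ mi_abs \<nu> \<le> cmod (c \<nu>) * (A * w \<nu>)"
      by (intro mult_left_mono *) auto
    also have "\<dots> = A * (cmod (c \<nu>) * w \<nu>)"
      by simp
    also have "\<dots> \<le> A * C"
      by (intro mult_left_mono *)
    finally show ?thesis .
  qed
  then show "\<exists>C. \<forall>\<nu>. cmod (c \<nu>) * R ^ mi_abs \<nu> \<le> C"
    by blast
qed

section \<open>The inductive and the projective spaces\<close>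

lemma linear_bijection_Ahat:
  assumes p: "0 < p" and s: "s \<in> Rflat" "s < Reg (1/2)"
  shows "linear_bijection Op_antiwick
    (Ahat p s :: (complex ^ 'd::finite \<Rightarrow> complex ^ 'd \<Rightarrow> complex) set) (Op_wick ` Ahat p s)"
proof (cases "s = Reg 0")
  case True
  note iff = ell_Reg_0_iff[OF p, folded True]
  have rapid: "rapidly_decaying c" if c: "c \<in> ell p s" for c :: "('d + 'd \<Rightarrow> nat) \<Rightarrow> complex"
    using that finite_support_rapidly_decaying by (auto simp: iff)
  show ?thesis
    unfolding Ahat_def
  proof (rule linear_bijection_Op_antiwick)
    show "(\<lambda>_. 0) \<in> ell p s"
      by (auto simp: iff intro: exI[of _ 1])
  next
    fix c c' :: "('d + 'd \<Rightarrow> nat) \<Rightarrow> complex" assume "c \<in> ell p s" "c' \<in> ell p s"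
    then obtain r r' where "r > 0" "\<forall>\<nu>. real (mi_abs \<nu>) > r \<longrightarrow> c \<nu> = 0"
      "r' > 0" "\<forall>\<nu>. real (mi_abs \<nu>) > r' \<longrightarrow> c' \<nu> = 0"
      unfolding iff by blast
    then show "(\<lambda>\<nu>. c \<nu> + c' \<nu>) \<in> ell p s"
      unfolding iff by (intro exI[of _ "max r r'"]) auto
  next
    fix c :: "('d + 'd \<Rightarrow> nat) \<Rightarrow> complex" and k assume "c \<in> ell p s"
    then show "(\<lambda>\<nu>. k * c \<nu>) \<in> ell p s"
      unfolding iff by auto
  next
    fix c :: "('d + 'd \<Rightarrow> nat) \<Rightarrow> complex" and t :: complex assume "c \<in> ell p s"
    then obtain r where r: "r > 0" "\<And>\<nu>. real (mi_abs \<nu>) > r \<Longrightarrow> c \<nu> = 0"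
      unfolding iff by blast
    \<comment> \<open>The shift only evaluates \<open>c\<close> at degrees at least |\<mu>|, so the
      same r bounds the support of the result.\<close>
    have "wick_shift t c \<mu> = 0" if "real (mi_abs \<mu>) > r" for \<mu>
      unfolding wick_shift_def using that by (intro infsum_0) (simp add: r(2))
    with r(1) show "wick_shift t c \<in> ell p s"
      unfolding iff by blast
  qed (rule rapid)
next
  case False
  note s = s False
  have s': "s \<le> Reg (1/2)"
    using s by simp
  note iff = ell_iff[OF p s]
  have rapid: "rapidly_decaying c" if c: "c \<in> ell p s" for c :: "('d + 'd \<Rightarrow> nat) \<Rightarrow> complex"
  proof (rule bounded_weight_rapidly_decaying)
    fix R :: real assume R: "R > 0"
    obtain r C where r: "r > 0" "\<forall>\<nu>. cmod (c \<nu>) * real_weight r s \<nu> \<le> C"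
      using c unfolding iff by blast
    with real_weight_superexponential[OF s r(1) R]
    show "\<exists>w C A. (\<forall>\<nu>. cmod (c \<nu>) * w \<nu> \<le> C) \<and> A \<ge> 0 \<and> (\<forall>\<nu>. R ^ mi_abs \<nu> \<le> A * w \<nu>)"
      by blast
  qed
  show ?thesis
    unfolding Ahat_def
  proof (rule linear_bijection_Op_antiwick)
    show "(\<lambda>_. 0) \<in> ell p s"
      by (auto simp: iff intro: exI[of _ 1])
  next
    fix c c' :: "('d + 'd \<Rightarrow> nat) \<Rightarrow> complex" assume "c \<in> ell p s" "c' \<in> ell p s"
    then obtain r r' where r: "r > 0" "r' > 0" "\<exists>C. \<forall>\<nu>. cmod (c \<nu>) * real_weight r s \<nu> \<le> C"
      "\<exists>C. \<forall>\<nu>. cmod (c' \<nu>) * real_weight r' s \<nu> \<le> C"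
      unfolding iff by blast
    \<comment> \<open>Each sequence has its own r; the smaller one gives a weight below
      both.\<close>
    define r0 where "r0 = min r r'"
    have "r0 > 0" "r0 \<le> r" "r0 \<le> r'"
      using r by (auto simp: r0_def)
    moreover from this have "\<exists>C. \<forall>\<nu>. cmod (c \<nu>) * real_weight r0 s \<nu> \<le> C" "\<exists>C. \<forall>\<nu>. cmod (c' \<nu>) * real_weight r0 s \<nu> \<le> C"
      using bounded_weight_mono[OF r(3)] bounded_weight_mono[OF r(4)] real_weight_mono by blast+
    ultimately have "\<exists>C. \<forall>\<nu>. cmod (c \<nu> + c' \<nu>) * real_weight r0 s \<nu> \<le> C"
      by (intro bounded_weight_add) (auto intro: less_imp_le real_weight_pos)
    with \<open>r0 > 0\<close> show "(\<lambda>\<nu>. c \<nu> + c' \<nu>) \<in> ell p s"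
      unfolding iff by blast
  next
    fix c :: "('d + 'd \<Rightarrow> nat) \<Rightarrow> complex" and k assume "c \<in> ell p s"
    then show "(\<lambda>\<nu>. k * c \<nu>) \<in> ell p s"
      unfolding iff using bounded_weight_cmult by blast
  next
    fix c :: "('d + 'd \<Rightarrow> nat) \<Rightarrow> complex" and t :: complex assume t: "norm t = 1" and c: "c \<in> ell p s"
    then obtain r C where r: "r > 0" and C: "\<And>\<nu>. cmod (c \<nu>) * real_weight r s \<nu> \<le> C"
      unfolding iff by blast
    \<comment> \<open>The result is controlled only at a smaller r', which is enough for membership
      with some r.\<close>
    obtain r' A where r': "r' > 0" and A: "\<And>\<nu> :: 'd + 'd \<Rightarrow> nat. real_weight r' s \<nu> * 2 ^ mi_abs \<nu> \<le> A * real_weight r s \<nu>"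
      using real_weight_step_down[OF s r] by blast
    obtain B where B: "\<And>\<nu> :: 'd + 'd \<Rightarrow> nat. 4 ^ mi_abs \<nu> \<le> B * real_weight r s \<nu>"
      using real_weight_superexponential[OF s r, of 4] by auto
    have "\<exists>D. \<forall>\<mu>. cmod (wick_shift t c \<mu>) * real_weight r' s \<mu> \<le> D"
      by (rule wick_shift_weight_bound[OF rapid[OF c] t real_weight_pos[OF r] real_weight_pos[OF r']
            real_weight_supermult[OF s(1) s' s(3) r] A B C])
    with r' show "wick_shift t c \<in> ell p s"
      unfolding iff by blast
  qed (rule rapid)
qed

lemma linear_bijection_Ahat0:
  assumes p: "0 < p" and s: "s \<in> Rflat" "s \<le> Reg (1/2)"
  shows "linear_bijection Op_antiwick
    (Ahat0 p s :: (complex ^ 'd::finite \<Rightarrow> complex ^ 'd \<Rightarrow> complex) set) (Op_wick ` Ahat0 p s)"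
proof (cases "s = Reg 0")
  case True
  then have ell0: "ell0 p s = {\<lambda>_. 0}"
    by (simp add: ell0_def)
  show ?thesis
    unfolding Ahat0_def ell0
    by (rule linear_bijection_Op_antiwick) (auto simp: rapidly_decaying_def wick_shift_def)
next
  case False
  note s = s False
  note iff = ell0_iff[OF p s]
  have rapid: "rapidly_decaying c" if c: "c \<in> ell0 p s" for c :: "('d + 'd \<Rightarrow> nat) \<Rightarrow> complex"
  proof (rule bounded_weight_rapidly_decaying)
    fix R :: real assume R: "R > 0"
    obtain r A where r: "r > 0" "A \<ge> 0" "\<forall>\<nu> :: 'd + 'd \<Rightarrow> nat. R ^ mi_abs \<nu> \<le> A * real_weight r s \<nu>"
      using real_weight_exponential[OF s R] by blast
    with c show "\<exists>w C A. (\<forall>\<nu>. cmod (c \<nu>) * w \<nu> \<le> C) \<and> A \<ge> 0 \<and> (\<forall>\<nu>. R ^ mi_abs \<nu> \<le> A * w \<nu>)"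
      unfolding iff by meson
  qed
  show ?thesis
    unfolding Ahat0_def
  proof (rule linear_bijection_Op_antiwick)
    show "(\<lambda>_. 0) \<in> ell0 p s"
      by (auto simp: iff)
  next
    fix c c' :: "('d + 'd \<Rightarrow> nat) \<Rightarrow> complex" assume "c \<in> ell0 p s" "c' \<in> ell0 p s"
    then show "(\<lambda>\<nu>. c \<nu> + c' \<nu>) \<in> ell0 p s"
      unfolding iff by (auto intro!: bounded_weight_add less_imp_le real_weight_pos)
  next
    fix c :: "('d + 'd \<Rightarrow> nat) \<Rightarrow> complex" and k assume "c \<in> ell0 p s"
    then show "(\<lambda>\<nu>. k * c \<nu>) \<in> ell0 p s"
      unfolding iff using bounded_weight_cmult by blast
  next
    fix c :: "('d + 'd \<Rightarrow> nat) \<Rightarrow> complex" and t :: complex assume t: "norm t = 1" and c: "c \<in> ell0 p s"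
    show "wick_shift t c \<in> ell0 p s"
      unfolding iff
    proof (intro allI impI)
      fix r' :: real assume r': "r' > 0"
      obtain r1 where r1: "r1 > 0" "\<And>\<nu> :: 'd + 'd \<Rightarrow> nat. real_weight r' s \<nu> * 2 ^ mi_abs \<nu> \<le> real_weight r1 s \<nu>"
        using real_weight_step[OF s r'] by blast
      obtain r2 B where r2: "r2 > 0" "B \<ge> 0" "\<And>\<nu> :: 'd + 'd \<Rightarrow> nat. 4 ^ mi_abs \<nu> \<le> B * real_weight r2 s \<nu>"
        using real_weight_exponential[OF s, of 4] by auto
      \<comment> \<open>The target r' is arbitrary and r is chosen after it: \<open>r1\<close>
        absorbs the factor 2^|\<mu>|, \<open>r2\<close> dominates 4^|\<nu>|, and the hypothesis on
        \<open>c\<close> is available at their maximum.\<close>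
      define r where "r = max r1 r2"
      have r: "r > 0"
        using r1 by (simp add: r_def)
      obtain C where C: "\<And>\<nu>. cmod (c \<nu>) * real_weight r s \<nu> \<le> C"
        using c r unfolding iff by blast
      have A: "real_weight r' s \<nu> * 2 ^ mi_abs \<nu> \<le> 1 * real_weight r s \<nu>" for \<nu> :: "'d + 'd \<Rightarrow> nat"
        using r1(2)[of \<nu>] real_weight_mono[OF r1(1), of r s \<nu>] by (simp add: r_def)
      have B: "4 ^ mi_abs \<nu> \<le> B * real_weight r s \<nu>" for \<nu> :: "'d + 'd \<Rightarrow> nat"
        using r2(3)[of \<nu>] mult_left_mono[OF real_weight_mono[OF r2(1), of r s \<nu>] r2(2)] by (simp add: r_def)
      show "\<exists>D. \<forall>\<mu>. cmod (wick_shift t c \<mu>) * real_weight r' s \<mu> \<le> D"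
        by (rule wick_shift_weight_bound[OF rapid[OF c] t real_weight_pos[OF r] real_weight_pos[OF r']
              real_weight_supermult[OF s r] A B C])
    qed
  qed (rule rapid)
qed

theorem theorem4p6:
  fixes s1 s2 :: flat_index and p :: ennreal
  assumes "0 < p"
    and "s1 \<in> Rflat" and "s2 \<in> Rflat"
    and "s1 < Reg (1/2)" and "s2 \<le> Reg (1/2)"
  shows "linear_bijection Op_antiwick
           (Ahat p s1 :: (complex ^ 'd::finite \<Rightarrow> complex ^ 'd \<Rightarrow> complex) set)
           (Op_wick ` Ahat p s1) \<and>
         linear_bijection Op_antiwick
           (Ahat0 p s2 :: (complex ^ 'd::finite \<Rightarrow> complex ^ 'd \<Rightarrow> complex) set)
           (Op_wick ` Ahat0 p s2)"
  using assms by (intro conjI linear_bijection_Ahat linear_bijection_Ahat0)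

end
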